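(* Let $d\ge2$ be an integer, $q\ge 2$ and $s\ge 0$. Then the following two statements are equivalent: (a) there is a constant $C$ such that $\big\| \sup_{t \in (0,1)} |e^{it\sqrt{-\Delta}}f|\big\|_{L^{q}(\mathbb{R}^d)} \le C \|f\|_{H^s(\mathbb{R}^d)}$ for all $f\in H^s(\mathbb R^d)$; (b) there is a constant $C$ such that $\big\| \sup_{t \in (0,1)} |e^{it\sqrt{-\Delta}}f|\big\|_{L^{q}(B^d(0,1))} \le C \|f\|_{H^s(\mathbb{R}^d)}$ for all $f\in H^s(\mathbb R^d)$.
   Context: The wave operator is $e^{it\sqrt{-\Delta}}f(x)=\frac1{(2\pi)^d}\int_{\mathbb R^d}e^{i(x\cdot\xi+t|\xi|)}\widehat f(\xi)\,d\xi$, with $\widehat f(\xi)=\int e^{-ix\cdot\xi}f(x)\,dx$. $H^s(\mathbb R^d)$ is the inhomogeneous $L^2$ Sobolev space with norm $\|(1-\Delta)^{s/2}f\|_{L^2}$, and $B^d(0,1)$ is the unit ball of $\mathbb R^d$ centered at the origin. As usual, such maximal estimates may be read as a priori estimates for Schwartz functions $f$ with constants independent of $f$, extended to the whole Sobolev space by density. *)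

theory Defs
  imports "HOL-Analysis.Analysis"
begin

definition partial_deriv :: "'a::euclidean_space \<Rightarrow> ('a \<Rightarrow> complex) \<Rightarrow> 'a \<Rightarrow> complex"
  where "partial_deriv b f = (\<lambda>x. frechet_derivative f (at x) b)"

primrec iter_partial_deriv :: "'a::euclidean_space list \<Rightarrow> ('a \<Rightarrow> complex) \<Rightarrow> 'a \<Rightarrow> complex"
  where
    "iter_partial_deriv [] f = f"
  | "iter_partial_deriv (b # bs) f = partial_deriv b (iter_partial_deriv bs f)"

text \<open>
  The Schwartz class. Lists of basis vectors stand for multi-indices. The derivative operator
  \<open>frechet_derivative\<close> is total, hence the explicit differentiability requirement, which at all
  orders amounts to smoothness.
\<close>

definition schwartz :: "('a::euclidean_space \<Rightarrow> complex) \<Rightarrow> bool"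
  where "schwartz f \<longleftrightarrow>
    (\<forall>bs \<in> lists Basis.
      (\<forall>x. iter_partial_deriv bs f differentiable (at x)) \<and>
      (\<forall>k::nat. bounded (range (\<lambda>x. norm x ^ k *\<^sub>R iter_partial_deriv bs f x))))"

definition fourier :: "('a::euclidean_space \<Rightarrow> complex) \<Rightarrow> 'a \<Rightarrow> complex"
  where "fourier f \<xi> = (\<integral>x. cis (- (x \<bullet> \<xi>)) * f x \<partial>lborel)"

definition wave :: "real \<Rightarrow> ('a::euclidean_space \<Rightarrow> complex) \<Rightarrow> 'a \<Rightarrow> complex"
  where "wave t f x =
    (\<integral>\<xi>. cis (x \<bullet> \<xi> + t * norm \<xi>) * fourier f \<xi> \<partial>lborel) /\<^sub>R (2 * pi) ^ DIM('a)"

text \<open>The operator $(1-\Delta)^{s/2}$, i.e. the Fourier multiplier with symbol $(1+|\xi|^2)^{s/2}$.\<close>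

definition bessel :: "real \<Rightarrow> ('a::euclidean_space \<Rightarrow> complex) \<Rightarrow> 'a \<Rightarrow> complex"
  where "bessel s f x =
    (\<integral>\<xi>. cis (x \<bullet> \<xi>) * of_real ((1 + (norm \<xi>)\<^sup>2) powr (s / 2)) * fourier f \<xi> \<partial>lborel)
      /\<^sub>R (2 * pi) ^ DIM('a)"

text \<open>Real powers of extended nonnegative reals; meant for exponents \<open>a > 0\<close>.\<close>

definition ennpowr :: "ennreal \<Rightarrow> real \<Rightarrow> ennreal"
  where "ennpowr x a = (if x = \<infinity> then \<infinity> else ennreal (enn2real x powr a))"

definition Lq_norm :: "real \<Rightarrow> 'a::euclidean_space set \<Rightarrow> ('a \<Rightarrow> ennreal) \<Rightarrow> ennreal"
  where "Lq_norm q A g = ennpowr (\<integral>\<^sup>+x\<in>A. ennpowr (g x) q \<partial>lborel) (1 / q)"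

definition sobolev_norm :: "real \<Rightarrow> ('a::euclidean_space \<Rightarrow> complex) \<Rightarrow> ennreal"
  where "sobolev_norm s f = Lq_norm 2 UNIV (\<lambda>x. ennreal (cmod (bessel s f x)))"

definition wave_maximal :: "('a::euclidean_space \<Rightarrow> complex) \<Rightarrow> 'a \<Rightarrow> ennreal"
  where "wave_maximal f x = (SUP t\<in>{0<..<1}. ennreal (cmod (wave t f x)))"

text \<open>
  The maximal estimate on a set \<open>A\<close> is read as an a priori estimate: for general \<open>f\<close> in the Sobolev
  space the wave at a fixed time is only defined almost everywhere, so the pointwise supremum over
  the uncountable set of times is taken for Schwartz \<open>f\<close>, with a constant independent of \<open>f\<close>.
\<close>

definition maximal_estimate :: "real \<Rightarrow> real \<Rightarrow> 'a::euclidean_space set \<Rightarrow> bool"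
  where "maximal_estimate q s A \<longleftrightarrow>
    (\<exists>C::real. \<forall>f. schwartz f \<longrightarrow>
      Lq_norm q A (wave_maximal f) \<le> ennreal C * sobolev_norm s f)"

end

theory Submission
  imports Defs "HOL-Probability.Probability" "HOL-Complex_Analysis.Complex_Analysis"
begin

text \<open>
  Only the passage from the ball to the whole space needs an argument. With \<open>\<psi>\<close> a smooth cutoff
  equal to 1 near the unit ball, split each translate of \<open>f\<close> as
  \<open>\<psi> f(\<cdot> + y) + (1 - \<psi>) f(\<cdot> + y)\<close> and average over \<open>y\<close>.

  The local estimate applies to the first part. By Plancherel and inversion in the variable \<open>y\<close>,
  the squared \<open>H\<^sup>s\<close> norm of \<open>\<psi> f(\<cdot> + y)\<close> is bounded in \<open>y\<close>, and also integrable in \<open>y\<close>, by a multiple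
  of the squared \<open>H\<^sup>s\<close> norm of \<open>f\<close>; since \<open>q \<ge> 2\<close> its power \<open>q/2\<close> is then integrable too.

  The second part vanishes near the light cone. There the half-wave kernel at time \<open>t\<close> is the analytic
  continuation of the Poisson kernel from \<open>\<tau> > 0\<close> to \<open>\<tau> = -it\<close>. Writing the Poisson kernel as a
  superposition of Gaussians, one sees that the continuation is dominated, uniformly in \<open>t < 1\<close>, by a
  bounded integrable convolution kernel.
\<close>

section \<open>Gaussian integrals\<close>

lemma
  fixes f :: "'a::euclidean_space \<Rightarrow> real \<Rightarrow> 'b::{real_normed_field,banach,second_countable_topology}"
  assumes f: "\<And>b. b \<in> Basis \<Longrightarrow> integrable lborel (f b)"
  shows integrable_lborel_prod: "integrable lborel (\<lambda>x::'a. \<Prod>b\<in>Basis. f b (x \<bullet> b))"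
    and integral_lborel_prod:
      "(\<integral>x. (\<Prod>b\<in>Basis. f b ((x::'a) \<bullet> b)) \<partial>lborel) = (\<Prod>b\<in>Basis. \<integral>t. f b t \<partial>lborel)"
proof -
  interpret P: product_sigma_finite "\<lambda>b::'a. lborel :: real measure" ..
  let ?T = "\<lambda>f::'a \<Rightarrow> real. \<Sum>b\<in>Basis. f b *\<^sub>R b"
  have T[measurable]: "?T \<in> measurable (\<Pi>\<^sub>M b\<in>Basis. lborel) borel" by measurable
  have mf: "f b \<in> borel_measurable borel" if "b \<in> Basis" for b
    using f[OF that] by (simp add: integrable_iff_bounded)
  have m[measurable]: "(\<lambda>x::'a. \<Prod>b\<in>Basis. f b (x \<bullet> b)) \<in> borel_measurable borel"
  proof (rule borel_measurable_prod)
    fix b :: 'a assume b: "b \<in> Basis"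
    have "(\<lambda>x::'a. x \<bullet> b) \<in> borel_measurable borel" by measurable
    from measurable_compose[OF this mf[OF b]]
    show "(\<lambda>x::'a. f b (x \<bullet> b)) \<in> borel_measurable borel" .
  qed
  have eq: "(\<Prod>b\<in>Basis. f b (?T x \<bullet> b)) = (\<Prod>b\<in>Basis. f b (x b))" for x
    by (intro prod.cong refl) simp
  show "integrable lborel (\<lambda>x::'a. \<Prod>b\<in>Basis. f b (x \<bullet> b))"
    unfolding lborel_eq[where 'a='a] using P.product_integrable_prod[of Basis f] f
    by (subst integrable_distr_eq) (simp_all add: eq del: inner_sum_left_Basis)
  show "(\<integral>x. (\<Prod>b\<in>Basis. f b ((x::'a) \<bullet> b)) \<partial>lborel) = (\<Prod>b\<in>Basis. \<integral>t. f b t \<partial>lborel)"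
    unfolding lborel_eq[where 'a='a] using P.product_integral_prod[of Basis f] f
    by (subst integral_distr) (simp_all add: eq del: inner_sum_left_Basis)
qed

lemma exp_neg_norm_sq_prod:
  fixes x :: "'a::euclidean_space"
  shows "exp (- c * (norm x)\<^sup>2) = (\<Prod>b\<in>Basis. exp (- c * (x \<bullet> b)\<^sup>2))"
proof -
  have "(norm x)\<^sup>2 = (\<Sum>b\<in>Basis. (x \<bullet> b)\<^sup>2)"
    unfolding power2_norm_eq_inner by (subst euclidean_inner) (simp add: power2_eq_square)
  then show ?thesis by (simp add: exp_sum sum_distrib_left flip: sum_negf)
qed

lemma cis_inner_prod:
  fixes x z :: "'a::euclidean_space"
  shows "cis (z \<bullet> x) = (\<Prod>b\<in>Basis. cis ((z \<bullet> b) * (x \<bullet> b)))"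
  unfolding cis_conv_exp euclidean_inner[of z x]
  by (simp add: exp_sum sum_distrib_left)

lemma integrable_gaussian_real:
  assumes "v > 0" shows "integrable lborel (\<lambda>t::real. exp (- (t\<^sup>2) / v\<^sup>2))"
proof -
  have "integrable lborel (\<lambda>t. normal_density 0 (v / sqrt 2) t * sqrt (pi * v\<^sup>2))"
    using assms by (intro integrable_mult_left integrable_normal_density) auto
  also have "(\<lambda>t. normal_density 0 (v / sqrt 2) t * sqrt (pi * v\<^sup>2)) = (\<lambda>t. exp (- (t\<^sup>2) / v\<^sup>2))"
    using assms by (auto simp: normal_density_def power_divide real_sqrt_mult)
  finally show ?thesis .
qed

lemma fourier_gaussian_real:
  assumes "v > 0"
  shows "(\<integral>t. cis (z * t) * of_real (exp (- (t\<^sup>2) / v\<^sup>2)) \<partial>lborel)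
    = of_real (v * sqrt pi * exp (- (v\<^sup>2) * z\<^sup>2 / 4))"
proof -
  let ?s = "v / sqrt 2"
  have "(\<integral>t. cis (z * t) * of_real (exp (- (t\<^sup>2) / v\<^sup>2)) \<partial>lborel)
    = of_real ?s * (\<integral>t. cis (z * (0 + ?s * t)) * of_real (exp (- ((0 + ?s * t)\<^sup>2) / v\<^sup>2)) \<partial>lborel)"
    using assms by (subst lborel_integral_real_affine[where c="?s" and t=0]) (auto simp: scaleR_conv_of_real)
  also have "(\<integral>t. cis (z * (0 + ?s * t)) * of_real (exp (- ((0 + ?s * t)\<^sup>2) / v\<^sup>2)) \<partial>lborel)
     = (\<integral>t. std_normal_density t *\<^sub>R (iexp (z * ?s * t) * sqrt (2 * pi)) \<partial>lborel)"
    using assms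
    by (intro Bochner_Integration.integral_cong)
      (auto simp: std_normal_density_def cis_conv_exp scaleR_conv_of_real power_mult_distrib power_divide mult_ac)
  also have "\<dots> = char std_normal_distribution (z * ?s) * sqrt (2 * pi)"
    unfolding char_def by (subst integral_density) (auto simp flip: integral_mult_left_zero)
  also have "\<dots> = of_real (exp (- (v\<^sup>2) * z\<^sup>2 / 4) * sqrt (2 * pi))"
    by (simp add: char_std_normal_distribution power_mult_distrib power_divide mult_ac)
  finally show ?thesis by (simp add: real_sqrt_mult)
qed

lemma
  fixes z :: "'a::euclidean_space"
  assumes v: "v > 0"
  shows integrable_gaussian: "integrable lborel (\<lambda>\<xi>::'a. exp (- ((norm \<xi>)\<^sup>2) / v\<^sup>2))"
    and fourier_gaussian: "(\<integral>\<xi>. cis (z \<bullet> \<xi>) * of_real (exp (- ((norm \<xi>)\<^sup>2) / v\<^sup>2)) \<partial>lborel)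
      = of_real ((v * sqrt pi) ^ DIM('a) * exp (- (v\<^sup>2) * (norm z)\<^sup>2 / 4))"
proof -
  have e: "exp (- ((norm \<xi>)\<^sup>2) / v\<^sup>2) = (\<Prod>b\<in>Basis. exp (- ((\<xi> \<bullet> b)\<^sup>2) / v\<^sup>2))" for \<xi> :: 'a
    using exp_neg_norm_sq_prod[of "1/v\<^sup>2" \<xi>] by simp
  show "integrable lborel (\<lambda>\<xi>::'a. exp (- ((norm \<xi>)\<^sup>2) / v\<^sup>2))"
    unfolding e by (intro integrable_lborel_prod integrable_gaussian_real v)
  have "(\<integral>\<xi>. cis (z \<bullet> \<xi>) * of_real (exp (- ((norm \<xi>)\<^sup>2) / v\<^sup>2)) \<partial>lborel)
     = (\<integral>\<xi>. (\<Prod>b\<in>Basis. cis ((z \<bullet> b) * (\<xi> \<bullet> b)) * of_real (exp (- ((\<xi> \<bullet> b)\<^sup>2) / v\<^sup>2))) \<partial>lborel)"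
    unfolding e cis_inner_prod by (simp add: prod.distrib)
  also have "\<dots> = (\<Prod>b\<in>Basis. \<integral>t. cis ((z \<bullet> b) * t) * of_real (exp (- (t\<^sup>2) / v\<^sup>2)) \<partial>lborel)"
  proof (rule integral_lborel_prod)
    fix b :: 'a
    show "integrable lborel (\<lambda>t. cis ((z \<bullet> b) * t) * complex_of_real (exp (- (t\<^sup>2) / v\<^sup>2)))"
      by (rule Bochner_Integration.integrable_bound[OF integrable_gaussian_real[OF v]])
        (auto simp: norm_mult cis_conv_exp)
  qed
  also have "\<dots> = (\<Prod>b\<in>Basis. of_real (v * sqrt pi * exp (- (v\<^sup>2) * (z \<bullet> b)\<^sup>2 / 4)))"
    by (simp only: fourier_gaussian_real[OF v])
  also have "\<dots> = of_real ((v * sqrt pi) ^ DIM('a) * (\<Prod>b\<in>Basis. exp (- (v\<^sup>2/4) * (z \<bullet> b)\<^sup>2)))"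
    by (simp add: prod.distrib)
  also have "\<dots> = of_real ((v * sqrt pi) ^ DIM('a) * exp (- (v\<^sup>2) * (norm z)\<^sup>2 / 4))"
    by (subst exp_neg_norm_sq_prod[symmetric]) simp
  finally show "(\<integral>\<xi>. cis (z \<bullet> \<xi>) * of_real (exp (- ((norm \<xi>)\<^sup>2) / v\<^sup>2)) \<partial>lborel)
      = of_real ((v * sqrt pi) ^ DIM('a) * exp (- (v\<^sup>2) * (norm z)\<^sup>2 / 4))" .
qed

section \<open>Fourier inversion and Plancherel\<close>

lemma borel_measurable_cis [measurable]: "cis \<in> borel_measurable borel"
  by (intro borel_measurable_continuous_onI continuous_intros)

lemma borel_measurable_cnj [measurable]: "cnj \<in> borel_measurable borel"
  by (intro borel_measurable_continuous_onI continuous_intros)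

lemma integrable_cis_mult:
  assumes "integrable M f" "\<phi> \<in> borel_measurable M"
  shows "integrable M (\<lambda>x. cis (\<phi> x) * f x)"
proof (rule Bochner_Integration.integrable_bound[OF assms(1)])
  have "f \<in> borel_measurable M" using assms(1) by auto
  with assms(2) show "(\<lambda>x. cis (\<phi> x) * f x) \<in> borel_measurable M" by measurable
qed (simp add: norm_mult)

lemma nn_integral_lborel_affine:
  fixes f :: "'a::euclidean_space \<Rightarrow> ennreal"
  assumes [measurable]: "f \<in> borel_measurable borel" and c: "c \<noteq> 0"
  shows "(\<integral>\<^sup>+x. f x \<partial>lborel) = ennreal (\<bar>c\<bar> ^ DIM('a)) * (\<integral>\<^sup>+x. f (t + c *\<^sub>R x) \<partial>lborel)"
  by (subst lborel_affine[OF c, of t])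
    (simp add: nn_integral_density nn_integral_distr nn_integral_cmult)

lemma nn_integral_lborel_translation:
  fixes f :: "'a::euclidean_space \<Rightarrow> ennreal"
  assumes "f \<in> borel_measurable borel"
  shows "(\<integral>\<^sup>+x. f (x + t) \<partial>lborel) = (\<integral>\<^sup>+x. f x \<partial>lborel)"
  using nn_integral_lborel_affine[OF assms, of 1 t] by (simp add: add.commute)

lemma nn_integral_lborel_reflect:
  fixes f :: "'a::euclidean_space \<Rightarrow> ennreal"
  assumes "f \<in> borel_measurable borel"
  shows "(\<integral>\<^sup>+x. f (t - x) \<partial>lborel) = (\<integral>\<^sup>+x. f x \<partial>lborel)"
  using nn_integral_lborel_affine[OF assms, of "-1" t] by simp

lemma integral_lborel_affine:
  fixes f :: "'a::euclidean_space \<Rightarrow> 'b::{banach,second_countable_topology}"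
  assumes [measurable]: "f \<in> borel_measurable borel" and c: "c \<noteq> 0"
  shows "(\<integral>x. f x \<partial>lborel) = \<bar>c\<bar> ^ DIM('a) *\<^sub>R (\<integral>x. f (t + c *\<^sub>R x) \<partial>lborel)"
  by (subst lborel_affine[OF c, of t]) (simp add: integral_density integral_distr)

lemma integrable_lborel_affine:
  fixes f :: "'a::euclidean_space \<Rightarrow> 'b::{banach,second_countable_topology}"
  assumes f: "integrable lborel f" and c: "c \<noteq> 0"
  shows "integrable lborel (\<lambda>x. f (t + c *\<^sub>R x))"
proof -
  have [measurable]: "f \<in> borel_measurable borel" using f by auto
  have "integrable (density (distr lborel borel (\<lambda>x. t + c *\<^sub>R x)) (\<lambda>_. ennreal (\<bar>c\<bar>^DIM('a)))) f"
    using f lborel_affine[OF c, of t] by simp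
  then have "integrable lborel (\<lambda>x. \<bar>c\<bar> ^ DIM('a) *\<^sub>R f (t + c *\<^sub>R x))"
    by (simp add: integrable_density integrable_distr_eq)
  from integrable_scaleR_right[OF this, of "inverse (\<bar>c\<bar> ^ DIM('a))"] show ?thesis using c by simp
qed

lemma integral_lborel_translation:
  fixes f :: "'a::euclidean_space \<Rightarrow> 'b::{banach,second_countable_topology}"
  assumes "f \<in> borel_measurable borel"
  shows "(\<integral>x. f (x + t) \<partial>lborel) = (\<integral>x. f x \<partial>lborel)"
  using integral_lborel_affine[OF assms, of 1 t] by (simp add: add.commute)

lemma integrable_lborel_translation:
  fixes f :: "'a::euclidean_space \<Rightarrow> 'b::{banach,second_countable_topology}"
  assumes "integrable lborel f"
  shows "integrable lborel (\<lambda>x. f (x + t))"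
  using integrable_lborel_affine[OF assms, of 1 t] by (simp add: add.commute)

lemma (in pair_sigma_finite) integrable_product_bound:
  fixes F :: "'a \<times> 'b \<Rightarrow> 'c::{banach,second_countable_topology}" and g h :: "_ \<Rightarrow> real"
  assumes g: "integrable M1 g" and h: "integrable M2 h"
    and F: "F \<in> borel_measurable (M1 \<Otimes>\<^sub>M M2)"
    and le: "\<And>x y. norm (F (x, y)) \<le> g x * h y"
  shows "integrable (M1 \<Otimes>\<^sub>M M2) F"
proof (rule Bochner_Integration.integrable_bound[where f="\<lambda>(x, y). g x * h y"])
  have [measurable]: "g \<in> borel_measurable M1" "h \<in> borel_measurable M2" using g h by auto
  show "integrable (M1 \<Otimes>\<^sub>M M2) (\<lambda>(x, y). g x * h y)"
    using g h by (intro Fubini_integrable) (auto simp: abs_mult)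
  show "AE z in M1 \<Otimes>\<^sub>M M2. norm (F z) \<le> norm (case z of (x, y) \<Rightarrow> g x * h y)"
    using le by (intro AE_I2) (auto intro: order_trans[OF _ abs_ge_self])
qed (rule F)

lemma continuous_on_integral_dominated:
  fixes F :: "'x::metric_space \<Rightarrow> 'b \<Rightarrow> 'c::{banach,second_countable_topology}"
  assumes cont: "\<And>y. y \<in> space M \<Longrightarrow> continuous_on S (\<lambda>x. F x y)"
    and meas: "\<And>x. x \<in> S \<Longrightarrow> F x \<in> borel_measurable M"
    and g: "integrable M g" and le: "\<And>x y. x \<in> S \<Longrightarrow> y \<in> space M \<Longrightarrow> norm (F x y) \<le> g y"
  shows "continuous_on S (\<lambda>x. \<integral>y. F x y \<partial>M)"
  unfolding continuous_on_sequentially comp_def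
proof (intro allI ballI impI)
  fix u a assume a: "a \<in> S" and u: "(\<forall>n. u n \<in> S) \<and> u \<longlonglongrightarrow> a"
  show "(\<lambda>n. \<integral>y. F (u n) y \<partial>M) \<longlonglongrightarrow> (\<integral>y. F a y \<partial>M)"
  proof (rule integral_dominated_convergence[where w=g])
    show "AE y in M. (\<lambda>n. F (u n) y) \<longlonglongrightarrow> F a y"
      using cont a u unfolding continuous_on_sequentially comp_def by (intro AE_I2) blast
  qed (use meas a u g le in auto)
qed

lemma continuous_on_fourier:
  fixes f :: "'a::euclidean_space \<Rightarrow> complex"
  assumes f: "integrable lborel f"
  shows "continuous_on UNIV (fourier f)"
proof -
  have [measurable]: "f \<in> borel_measurable borel" using f by auto
  show ?thesis
    unfolding fourier_def[abs_def]
    by (rule continuous_on_integral_dominated[where g="\<lambda>x. norm (f x)"])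
      (auto intro!: continuous_intros f simp: norm_mult)
qed

lemma borel_measurable_fourier:
  fixes f :: "'a::euclidean_space \<Rightarrow> complex"
  assumes "integrable lborel f"
  shows "fourier f \<in> borel_measurable borel"
  by (rule borel_measurable_continuous_onI) (rule continuous_on_fourier[OF assms])

lemma norm_fourier_le:
  fixes f :: "'a::euclidean_space \<Rightarrow> complex"
  shows "cmod (fourier f \<xi>) \<le> (\<integral>x. cmod (f x) \<partial>lborel)"
proof -
  have "cmod (fourier f \<xi>) \<le> (\<integral>x. cmod (cis (- (x \<bullet> \<xi>)) * f x) \<partial>lborel)"
    unfolding fourier_def by (rule integral_norm_bound)
  then show ?thesis by (simp add: norm_mult)
qed

lemma heat_fourier:
  fixes f :: "'a::euclidean_space \<Rightarrow> complex" and x :: 'a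
  assumes f: "integrable lborel f" and v: "v > 0"
  shows "(\<integral>\<xi>. cis (x \<bullet> \<xi>) * of_real (exp (- ((norm \<xi>)\<^sup>2) / v\<^sup>2)) * fourier f \<xi> \<partial>lborel)
    = of_real ((2 * pi) ^ DIM('a)) *
      (\<integral>y. of_real ((v / (2 * sqrt pi)) ^ DIM('a) * exp (- (v\<^sup>2) * (norm (x - y))\<^sup>2 / 4)) * f y \<partial>lborel)"
proof -
  have [measurable]: "f \<in> borel_measurable borel" using f by auto
  define e where "e = (\<lambda>\<xi>::'a. exp (- ((norm \<xi>)\<^sup>2) / v\<^sup>2))"
  have e: "integrable lborel e" "\<And>\<xi>. e \<xi> \<ge> 0" unfolding e_def by (rule integrable_gaussian[OF v]) simp
  have [measurable]: "e \<in> borel_measurable borel" using e by auto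
  define F where "F = (\<lambda>\<xi> y. cis ((x - y) \<bullet> \<xi>) * of_real (e \<xi>) * f y)"
  have c: "cis ((x - y) \<bullet> \<xi>) = cis (x \<bullet> \<xi>) * cis (- (y \<bullet> \<xi>))" for y \<xi>
    by (simp only: cis_mult inner_diff_left) simp
  have intF: "integrable (lborel \<Otimes>\<^sub>M lborel) (case_prod F)"
    by (rule lborel_pair.integrable_product_bound[OF e(1) integrable_norm[OF f]])
      (auto simp: F_def norm_mult e)
  have "(\<integral>\<xi>. cis (x \<bullet> \<xi>) * of_real (e \<xi>) * fourier f \<xi> \<partial>lborel) = (\<integral>\<xi>. \<integral>y. F \<xi> y \<partial>lborel \<partial>lborel)"
    unfolding fourier_def F_def integral_mult_right_zero[symmetric] c
    by (simp only: mult_ac)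
  also have "\<dots> = (\<integral>y. \<integral>\<xi>. F \<xi> y \<partial>lborel \<partial>lborel)"
    by (rule lborel_pair.Fubini_integral[OF intF, symmetric])
  also have "\<dots> = (\<integral>y. of_real ((v * sqrt pi) ^ DIM('a) * exp (- (v\<^sup>2) * (norm (x - y))\<^sup>2 / 4)) * f y \<partial>lborel)"
    unfolding F_def e_def by (simp only: integral_mult_left_zero fourier_gaussian[OF v])
  also have "\<dots> = (\<integral>y. of_real ((2 * pi) ^ DIM('a)) * (of_real ((v / (2 * sqrt pi)) ^ DIM('a) * exp (- (v\<^sup>2) * (norm (x - y))\<^sup>2 / 4)) * f y) \<partial>lborel)"
  proof -
    have "v * sqrt pi = 2 * pi * (v / (2 * sqrt pi))"
      by (simp add: field_simps)
    then have "(v * sqrt pi) ^ DIM('a) = (2 * pi) ^ DIM('a) * (v / (2 * sqrt pi)) ^ DIM('a)"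
      by (simp only: power_mult_distrib[symmetric])
    then show ?thesis by (simp only: mult.assoc of_real_mult)
  qed
  finally show ?thesis unfolding e_def by simp
qed

lemma heat_rescaled:
  fixes f :: "'a::euclidean_space \<Rightarrow> complex"
  assumes [measurable]: "f \<in> borel_measurable borel" and v: "v > 0"
  shows "(\<integral>y. of_real ((v / (2 * sqrt pi)) ^ DIM('a) * exp (- (v\<^sup>2) * (norm (x - y))\<^sup>2 / 4)) * f y \<partial>lborel)
   = (\<integral>w. of_real ((1 / (2 * sqrt pi)) ^ DIM('a) * exp (- ((norm w)\<^sup>2) / 4)) * f (x + (1 / v) *\<^sub>R w) \<partial>lborel)"
  using v
  by (subst integral_lborel_affine[where c="1 / v" and t=x])
    (auto simp: power_mult_distrib power_divide scaleR_conv_of_real mult_ac simp flip: integral_mult_right_zero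
      intro!: Bochner_Integration.integral_cong)

lemma
  shows integrable_heat_kernel_unit:
      "integrable lborel (\<lambda>w::'a::euclidean_space. (1 / (2 * sqrt pi)) ^ DIM('a) * exp (- ((norm w)\<^sup>2) / 4))"
    and integral_heat_kernel_unit:
      "integral\<^sup>L lborel (\<lambda>w::'a. (1 / (2 * sqrt pi)) ^ DIM('a) * exp (- ((norm w)\<^sup>2) / 4)) = 1"
proof -
  show "integrable lborel (\<lambda>w::'a::euclidean_space. (1 / (2 * sqrt pi)) ^ DIM('a) * exp (- ((norm w)\<^sup>2) / 4))"
    using integrable_gaussian[of 2] by simp
  have "complex_of_real (integral\<^sup>L lborel (\<lambda>w::'a. exp (- ((norm w)\<^sup>2) / 4))) = of_real ((2 * sqrt pi) ^ DIM('a))"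
    using fourier_gaussian[of 2 "0::'a"] by simp
  then have "integral\<^sup>L lborel (\<lambda>w::'a. exp (- ((norm w)\<^sup>2) / 4)) = (2 * sqrt pi) ^ DIM('a)"
    by (simp only: of_real_eq_iff)
  then show "integral\<^sup>L lborel (\<lambda>w::'a. (1 / (2 * sqrt pi)) ^ DIM('a) * exp (- ((norm w)\<^sup>2) / 4)) = 1"
    by (simp only: integral_mult_right_zero power_mult_distrib[symmetric]) simp
qed

lemma heat_bounded:
  fixes f :: "'a::euclidean_space \<Rightarrow> complex"
  assumes f: "f \<in> borel_measurable borel" "\<And>x. cmod (f x) \<le> B" and v: "v > 0"
  shows "cmod (\<integral>y. of_real ((v / (2 * sqrt pi)) ^ DIM('a) * exp (- (v\<^sup>2) * (norm (x - y))\<^sup>2 / 4)) * f y \<partial>lborel) \<le> B"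
proof -
  let ?k = "\<lambda>w::'a. (1 / (2 * sqrt pi)) ^ DIM('a) * exp (- ((norm w)\<^sup>2) / 4)"
  have [measurable]: "f \<in> borel_measurable borel" by fact
  define k where "k = ?k"
  have k: "integrable lborel k" "integral\<^sup>L lborel k = 1" "\<And>w. k w \<ge> 0"
    unfolding k_def using integrable_heat_kernel_unit[where 'a='a] integral_heat_kernel_unit[where 'a='a]
    by auto
  then have [measurable]: "k \<in> borel_measurable borel" by auto
  have int: "integrable lborel (\<lambda>w. k w * B)" by (intro integrable_mult_left k)
  have le: "cmod (of_real (k w) * f z) \<le> k w * B" for w z
    using k(3)[of w] by (auto simp: norm_mult intro!: mult_left_mono f)
  have "cmod (\<integral>w. of_real (k w) * f (x + (1 / v) *\<^sub>R w) \<partial>lborel) \<le> (\<integral>w. k w * B \<partial>lborel)"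
  proof (rule Bochner_Integration.integral_norm_bound_integral)
    show "integrable lborel (\<lambda>w. of_real (k w) * f (x + (1 / v) *\<^sub>R w))"
      by (rule Bochner_Integration.integrable_bound[OF int], measurable)
        (use le in \<open>auto intro: order_trans[OF _ abs_ge_self]\<close>)
  qed (use int le in auto)
  also have "\<dots> = B" using k by simp
  finally show ?thesis using heat_rescaled[OF f(1) v] unfolding k_def by simp
qed

lemma heat_tendsto:
  fixes f :: "'a::euclidean_space \<Rightarrow> complex"
  assumes cont: "continuous_on UNIV f" and B: "\<And>x. cmod (f x) \<le> B"
  shows "(\<lambda>n. \<integral>y. of_real ((real (Suc n) / (2 * sqrt pi)) ^ DIM('a) * exp (- ((real (Suc n))\<^sup>2) * (norm (x - y))\<^sup>2 / 4)) * f y \<partial>lborel)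
    \<longlonglongrightarrow> f x"
proof -
  let ?k = "\<lambda>w::'a. (1 / (2 * sqrt pi)) ^ DIM('a) * exp (- ((norm w)\<^sup>2) / 4)"
  define k where "k = ?k"
  have k: "integrable lborel k" "integral\<^sup>L lborel k = 1" "\<And>w. k w \<ge> 0"
    unfolding k_def using integrable_heat_kernel_unit[where 'a='a] integral_heat_kernel_unit[where 'a='a]
    by auto
  then have [measurable]: "k \<in> borel_measurable borel" by auto
  have m[measurable]: "f \<in> borel_measurable borel" by (rule borel_measurable_continuous_onI[OF cont])
  have "(\<lambda>n. \<integral>w. of_real (k w) * f (x + (1 / real (Suc n)) *\<^sub>R w) \<partial>lborel) \<longlonglongrightarrow> (\<integral>w. of_real (k w) * f x \<partial>lborel)"
  proof (rule integral_dominated_convergence[where w="\<lambda>w. k w * B"])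
    show "integrable lborel (\<lambda>w. k w * B)" by (intro integrable_mult_left k)
    show "AE w in lborel. (\<lambda>n. of_real (k w) * f (x + (1 / real (Suc n)) *\<^sub>R w)) \<longlonglongrightarrow> of_real (k w) * f x"
    proof (intro AE_I2 tendsto_mult tendsto_const)
      fix w
      have "(\<lambda>n. x + (1 / real (Suc n)) *\<^sub>R w) \<longlonglongrightarrow> x + 0 *\<^sub>R w"
        by (intro tendsto_intros LIMSEQ_Suc[OF lim_1_over_n])
      then show "(\<lambda>n. f (x + (1 / real (Suc n)) *\<^sub>R w)) \<longlonglongrightarrow> f x"
        by (intro continuous_on_tendsto_compose[OF cont]) auto
    qed
  qed (use k(3) in \<open>auto simp: norm_mult intro!: mult_left_mono B\<close>)
  also have "(\<integral>w. of_real (k w) * f x \<partial>lborel) = f x"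
    using k(2)
    by (simp only: integral_mult_left_zero integral_complex_of_real of_real_1 mult_1_left)
  finally show ?thesis
    unfolding k_def by (simp only: heat_rescaled[OF m] of_nat_0_less_iff zero_less_Suc)
qed

lemma gaussian_multiplier_tendsto:
  "(\<lambda>n. exp (- (r\<^sup>2) / (real (Suc n))\<^sup>2)) \<longlonglongrightarrow> (1::real)"
proof -
  have "(\<lambda>n. exp (- (r\<^sup>2) * (1 / real (Suc n))\<^sup>2)) \<longlonglongrightarrow> exp (- (r\<^sup>2) * 0\<^sup>2)"
    by (intro tendsto_intros LIMSEQ_Suc[OF lim_1_over_n])
  then show ?thesis by (simp add: power_divide)
qed

lemma fourier_inversion:
  fixes f :: "'a::euclidean_space \<Rightarrow> complex"
  assumes f: "integrable lborel f" and cont: "continuous_on UNIV f" and B: "\<And>x. cmod (f x) \<le> B"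
    and ff: "integrable lborel (fourier f)"
  shows "(\<integral>\<xi>. cis (x \<bullet> \<xi>) * fourier f \<xi> \<partial>lborel) = of_real ((2 * pi) ^ DIM('a)) * f x"
proof (rule LIMSEQ_unique)
  have [measurable]: "fourier f \<in> borel_measurable borel" using ff by auto
  show "(\<lambda>n. \<integral>\<xi>. cis (x \<bullet> \<xi>) * of_real (exp (- ((norm \<xi>)\<^sup>2) / (real (Suc n))\<^sup>2)) * fourier f \<xi> \<partial>lborel)
      \<longlonglongrightarrow> of_real ((2 * pi) ^ DIM('a)) * f x"
    using heat_tendsto[OF cont B, of x]
    by (subst heat_fourier[OF f]) (auto intro!: tendsto_mult tendsto_const simp del: of_nat_Suc)
  show "(\<lambda>n. \<integral>\<xi>. cis (x \<bullet> \<xi>) * of_real (exp (- ((norm \<xi>)\<^sup>2) / (real (Suc n))\<^sup>2)) * fourier f \<xi> \<partial>lborel)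
      \<longlonglongrightarrow> (\<integral>\<xi>. cis (x \<bullet> \<xi>) * fourier f \<xi> \<partial>lborel)"
  proof (rule integral_dominated_convergence[where w="\<lambda>\<xi>. cmod (fourier f \<xi>)"])
    have "(\<lambda>n. cis (x \<bullet> \<xi>) * of_real (exp (- ((norm \<xi>)\<^sup>2) / (real (Suc n))\<^sup>2)) * fourier f \<xi>)
        \<longlonglongrightarrow> cis (x \<bullet> \<xi>) * of_real 1 * fourier f \<xi>" for \<xi>
      by (intro tendsto_mult tendsto_const tendsto_of_real gaussian_multiplier_tendsto)
    then show "AE \<xi> in lborel. (\<lambda>n. cis (x \<bullet> \<xi>) * of_real (exp (- ((norm \<xi>)\<^sup>2) / (real (Suc n))\<^sup>2)) * fourier f \<xi>)
        \<longlonglongrightarrow> cis (x \<bullet> \<xi>) * fourier f \<xi>" by simp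
  qed (auto simp: norm_mult intro!: ff mult_left_le_one_le)
qed

lemma plancherel:
  fixes f :: "'a::euclidean_space \<Rightarrow> complex"
  assumes f: "integrable lborel f" and cont: "continuous_on UNIV f" and B: "\<And>x. cmod (f x) \<le> B"
  shows "(\<integral>\<^sup>+\<xi>. ennreal ((cmod (fourier f \<xi>))\<^sup>2) \<partial>lborel)
    = ennreal ((2 * pi) ^ DIM('a)) * (\<integral>\<^sup>+x. ennreal ((cmod (f x))\<^sup>2) \<partial>lborel)"
proof -
  have m[measurable]: "f \<in> borel_measurable borel" "fourier f \<in> borel_measurable borel"
    using f by (auto intro: borel_measurable_fourier)
  let ?N = "\<integral>x. cmod (f x) \<partial>lborel"
  define e where "e = (\<lambda>n (\<xi>::'a). exp (- ((norm \<xi>)\<^sup>2) / (real (Suc n))\<^sup>2))"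
  have e: "integrable lborel (e n)" "e n \<xi> \<ge> 0" for n \<xi>
    unfolding e_def by (rule integrable_gaussian, simp) simp
  have [measurable]: "e n \<in> borel_measurable borel" for n using e(1)[of n] by auto
  define H where "H = (\<lambda>n x. \<integral>y. of_real ((real (Suc n) / (2 * sqrt pi)) ^ DIM('a) *
      exp (- ((real (Suc n))\<^sup>2) * (norm (x - y))\<^sup>2 / 4)) * f y \<partial>lborel)"
  have Hm[measurable]: "H n \<in> borel_measurable borel" for n
    unfolding H_def by measurable
  have main: "complex_of_real (\<integral>\<xi>. e n \<xi> * (cmod (fourier f \<xi>))\<^sup>2 \<partial>lborel)
      = of_real ((2 * pi) ^ DIM('a)) * (\<integral>x. cnj (f x) * H n x \<partial>lborel)" for n
  proof -
    let ?F = "\<lambda>\<xi> x. of_real (e n \<xi>) * fourier f \<xi> * (cis (x \<bullet> \<xi>) * cnj (f x))"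
    have int: "integrable (lborel \<Otimes>\<^sub>M lborel) (case_prod ?F)"
      by (rule lborel_pair.integrable_product_bound[where g="\<lambda>\<xi>. e n \<xi> * ?N" and h="\<lambda>x. cmod (f x)"])
        (auto simp: norm_mult e f intro!: mult_mono norm_fourier_le)
    have c: "cnj (fourier f \<xi>) = (\<integral>x. cis (x \<bullet> \<xi>) * cnj (f x) \<partial>lborel)" for \<xi>
      unfolding fourier_def
      by (simp only: Bochner_Integration.integral_cnj[symmetric] complex_cnj_mult cis_cnj minus_minus)
    have "complex_of_real (\<integral>\<xi>. e n \<xi> * (cmod (fourier f \<xi>))\<^sup>2 \<partial>lborel)
        = (\<integral>\<xi>. of_real (e n \<xi>) * fourier f \<xi> * cnj (fourier f \<xi>) \<partial>lborel)"
      unfolding integral_complex_of_real[symmetric]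
      by (intro Bochner_Integration.integral_cong refl) (simp only: of_real_mult complex_norm_square mult.assoc)
    also have "\<dots> = (\<integral>\<xi>. \<integral>x. ?F \<xi> x \<partial>lborel \<partial>lborel)"
      unfolding c by (simp only: integral_mult_right_zero)
    also have "\<dots> = (\<integral>x. \<integral>\<xi>. ?F \<xi> x \<partial>lborel \<partial>lborel)"
      by (rule lborel_pair.Fubini_integral[OF int, symmetric])
    also have "\<dots> = (\<integral>x. cnj (f x) * (\<integral>\<xi>. cis (x \<bullet> \<xi>) * of_real (e n \<xi>) * fourier f \<xi> \<partial>lborel) \<partial>lborel)"
      by (simp add: mult_ac flip: integral_mult_right_zero)
    also have "\<dots> = (\<integral>x. of_real ((2 * pi) ^ DIM('a)) * (cnj (f x) * H n x) \<partial>lborel)"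
      unfolding e_def H_def
      by (subst heat_fourier[OF f]) (auto simp: mult_ac simp del: of_nat_Suc)
    finally show ?thesis by simp
  qed
  have lim: "(\<lambda>n. \<integral>x. cnj (f x) * H n x \<partial>lborel) \<longlonglongrightarrow> (\<integral>x. cnj (f x) * f x \<partial>lborel)"
  proof (rule integral_dominated_convergence[where w="\<lambda>x. cmod (f x) * B"])
    show "AE x in lborel. (\<lambda>n. cnj (f x) * H n x) \<longlonglongrightarrow> cnj (f x) * f x"
      unfolding H_def by (intro AE_I2 tendsto_mult tendsto_const heat_tendsto[OF cont B])
    have "cmod (H n x) \<le> B" for n x
      unfolding H_def by (rule heat_bounded[OF m(1) B]) simp
    then show "AE x in lborel. cmod (cnj (f x) * H n x) \<le> cmod (f x) * B" for n
      by (auto simp: norm_mult intro!: mult_left_mono)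
  qed (use f in auto)
  have B0: "B \<ge> 0" using order_trans[OF norm_ge_zero B] .
  have f2: "integrable lborel (\<lambda>x. (cmod (f x))\<^sup>2)"
    by (rule Bochner_Integration.integrable_bound[where f="\<lambda>x. B * cmod (f x)"])
      (use f B0 in \<open>auto simp: power2_eq_square intro!: mult_right_mono B\<close>)
  have "(\<integral>x. cnj (f x) * f x \<partial>lborel) = of_real (\<integral>x. (cmod (f x))\<^sup>2 \<partial>lborel)"
    unfolding integral_complex_of_real[symmetric]
    by (intro Bochner_Integration.integral_cong refl) (simp only: complex_norm_square mult.commute)
  with lim have "(\<lambda>n. complex_of_real (\<integral>\<xi>. e n \<xi> * (cmod (fourier f \<xi>))\<^sup>2 \<partial>lborel))
      \<longlonglongrightarrow> of_real ((2 * pi) ^ DIM('a) * (\<integral>x. (cmod (f x))\<^sup>2 \<partial>lborel))"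
    unfolding main of_real_mult by (intro tendsto_mult tendsto_const) simp
  then have "(\<lambda>n. \<integral>\<xi>. e n \<xi> * (cmod (fourier f \<xi>))\<^sup>2 \<partial>lborel)
      \<longlonglongrightarrow> (2 * pi) ^ DIM('a) * (\<integral>x. (cmod (f x))\<^sup>2 \<partial>lborel)"
    by (simp only: tendsto_of_real_iff)
  then have L1: "(\<lambda>n. ennreal (\<integral>\<xi>. e n \<xi> * (cmod (fourier f \<xi>))\<^sup>2 \<partial>lborel))
      \<longlonglongrightarrow> ennreal ((2 * pi) ^ DIM('a) * (\<integral>x. (cmod (f x))\<^sup>2 \<partial>lborel))"
    by (rule tendsto_ennrealI)
  have inte: "integrable lborel (\<lambda>\<xi>. e n \<xi> * (cmod (fourier f \<xi>))\<^sup>2)" for n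
    by (rule Bochner_Integration.integrable_bound[where f="\<lambda>\<xi>. e n \<xi> * ?N\<^sup>2"])
      (use e(1)[of n] e(2) in \<open>auto intro!: mult_left_mono power_mono norm_fourier_le\<close>)
  have eq: "ennreal (\<integral>\<xi>. e n \<xi> * (cmod (fourier f \<xi>))\<^sup>2 \<partial>lborel)
      = (\<integral>\<^sup>+\<xi>. ennreal (e n \<xi> * (cmod (fourier f \<xi>))\<^sup>2) \<partial>lborel)" for n
    by (rule nn_integral_eq_integral[symmetric]) (auto intro: inte simp: e)
  have L2: "(\<lambda>n. \<integral>\<^sup>+\<xi>. ennreal (e n \<xi> * (cmod (fourier f \<xi>))\<^sup>2) \<partial>lborel)
      \<longlonglongrightarrow> (\<integral>\<^sup>+\<xi>. ennreal ((cmod (fourier f \<xi>))\<^sup>2) \<partial>lborel)"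
  proof (rule nn_integral_LIMSEQ)
    have "e m \<xi> \<le> e n \<xi>" if "m \<le> n" for m n \<xi>
      using that unfolding e_def by (auto intro!: divide_left_mono power_mono)
    then show "incseq (\<lambda>n \<xi>. ennreal (e n \<xi> * (cmod (fourier f \<xi>))\<^sup>2))"
      by (auto simp: incseq_def le_fun_def intro!: ennreal_leI mult_right_mono)
    have "(\<lambda>n. e n \<xi> * (cmod (fourier f \<xi>))\<^sup>2) \<longlonglongrightarrow> 1 * (cmod (fourier f \<xi>))\<^sup>2" for \<xi>
      unfolding e_def by (intro tendsto_mult tendsto_const gaussian_multiplier_tendsto)
    then show "(\<lambda>n. ennreal (e n \<xi> * (cmod (fourier f \<xi>))\<^sup>2)) \<longlonglongrightarrow> ennreal ((cmod (fourier f \<xi>))\<^sup>2)" for \<xi>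
      by (intro tendsto_ennrealI) simp
  qed auto
  have "(\<integral>\<^sup>+\<xi>. ennreal ((cmod (fourier f \<xi>))\<^sup>2) \<partial>lborel)
      = ennreal ((2 * pi) ^ DIM('a) * (\<integral>x. (cmod (f x))\<^sup>2 \<partial>lborel))"
    using LIMSEQ_unique[OF L2 L1[unfolded eq]] .
  also have "\<dots> = ennreal ((2 * pi) ^ DIM('a)) * (\<integral>\<^sup>+x. ennreal ((cmod (f x))\<^sup>2) \<partial>lborel)"
    by (subst nn_integral_eq_integral[OF f2]) (auto simp: ennreal_mult)
  finally show ?thesis .
qed

section \<open>Smooth functions and cutoffs\<close>

definition smooth :: "('a::euclidean_space \<Rightarrow> complex) \<Rightarrow> bool"
  where "smooth f \<longleftrightarrow> (\<forall>bs \<in> lists Basis. \<forall>x. iter_partial_deriv bs f differentiable (at x))"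

lemma partial_deriv_eq: "(f has_derivative f') (at x) \<Longrightarrow> partial_deriv b f x = f' b"
  unfolding partial_deriv_def using frechet_derivative_at by metis

lemma iter_partial_deriv_append:
  "iter_partial_deriv (bs @ cs) f = iter_partial_deriv bs (iter_partial_deriv cs f)"
  by (induction bs) auto

lemma smooth_differentiable: "smooth f \<Longrightarrow> f differentiable (at x)"
  unfolding smooth_def by (metis iter_partial_deriv.simps(1) lists.Nil)

lemma smooth_iter_partial_deriv: "smooth f \<Longrightarrow> bs \<in> lists Basis \<Longrightarrow> smooth (iter_partial_deriv bs f)"
  unfolding smooth_def by (simp flip: iter_partial_deriv_append)

lemma smooth_partial_deriv: "smooth f \<Longrightarrow> b \<in> Basis \<Longrightarrow> smooth (partial_deriv b f)"
  using smooth_iter_partial_deriv[of f "[b]"] by simp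

lemma smooth_has_derivative:
  "smooth f \<Longrightarrow> (f has_derivative frechet_derivative f (at x)) (at x)"
  using smooth_differentiable frechet_derivative_works by blast

inductive_set fun_span :: "('a \<Rightarrow> complex) set \<Rightarrow> ('a \<Rightarrow> complex) set" for X where
  base: "f \<in> X \<Longrightarrow> f \<in> fun_span X"
| zero: "(\<lambda>x. 0) \<in> fun_span X"
| add: "f \<in> fun_span X \<Longrightarrow> g \<in> fun_span X \<Longrightarrow> (\<lambda>x. f x + g x) \<in> fun_span X"
| cmult: "f \<in> fun_span X \<Longrightarrow> (\<lambda>x. c * f x) \<in> fun_span X"

text \<open>A coinduction principle up to linear combinations, which spares the Leibniz and Faa di Bruno
  formulas for iterated derivatives.\<close>

lemma smooth_coinduct:
  assumes X: "\<And>g x. g \<in> X \<Longrightarrow> g differentiable (at x)"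
    and der: "\<And>g b. g \<in> X \<Longrightarrow> b \<in> Basis \<Longrightarrow> partial_deriv b g \<in> fun_span X"
    and f: "f \<in> fun_span X"
  shows "smooth f"
proof -
  have diff: "g differentiable (at x)" if "g \<in> fun_span X" for g x
    using that by induction (auto intro: X)
  have pd: "partial_deriv b g \<in> fun_span X" if "g \<in> fun_span X" "b \<in> Basis" for g b
    using that
  proof induction
    case zero
    have "partial_deriv b (\<lambda>x. 0) = (\<lambda>x::'a. 0)"
      unfolding partial_deriv_def by simp
    then show ?case by (simp add: fun_span.zero)
  next
    case (add g h)
    have "partial_deriv b (\<lambda>x. g x + h x) x = partial_deriv b g x + partial_deriv b h x" for x
      using diff[OF add(1), of x] diff[OF add(2), of x] unfolding frechet_derivative_works
      by (subst partial_deriv_eq[OF has_derivative_add]) (auto simp: partial_deriv_def)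
    then have "partial_deriv b (\<lambda>x. g x + h x) = (\<lambda>x. partial_deriv b g x + partial_deriv b h x)" by blast
    with add show ?case by (auto intro: fun_span.add)
  next
    case (cmult g c)
    have "partial_deriv b (\<lambda>x. c * g x) x = c * partial_deriv b g x" for x
      using diff[OF cmult(1), of x] unfolding frechet_derivative_works
      by (subst partial_deriv_eq[OF has_derivative_mult_right]) (auto simp: partial_deriv_def)
    then have "partial_deriv b (\<lambda>x. c * g x) = (\<lambda>x. c * partial_deriv b g x)" by blast
    with cmult show ?case by (auto intro: fun_span.cmult)
  qed (auto intro: der)
  have "iter_partial_deriv bs f \<in> fun_span X" if "bs \<in> lists Basis" for bs
    using that by induction (auto intro: f pd)
  then show ?thesis unfolding smooth_def by (auto intro: diff)
qed

lemma smooth_add: "smooth f \<Longrightarrow> smooth g \<Longrightarrow> smooth (\<lambda>x. f x + g x)"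
  by (rule smooth_coinduct[where X="{f. smooth f}"])
    (auto intro: fun_span.intros smooth_differentiable smooth_partial_deriv)

lemma smooth_cmult: "smooth f \<Longrightarrow> smooth (\<lambda>x. c * f x)"
  by (rule smooth_coinduct[where X="{f. smooth f}"])
    (auto intro: fun_span.intros smooth_differentiable smooth_partial_deriv)

lemma smooth_diff: "smooth f \<Longrightarrow> smooth g \<Longrightarrow> smooth (\<lambda>x. f x - g x)"
  using smooth_add[OF _ smooth_cmult[of g "-1"]] by simp

lemma partial_deriv_mult:
  assumes "smooth f" "smooth g"
  shows "partial_deriv b (\<lambda>x. f x * g x) = (\<lambda>x. f x * partial_deriv b g x + partial_deriv b f x * g x)"
  using partial_deriv_eq[OF has_derivative_mult[OF smooth_has_derivative[OF assms(1)] smooth_has_derivative[OF assms(2)]]]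
  by (auto simp: partial_deriv_def)

lemma smooth_mult:
  assumes "smooth f" "smooth g"
  shows "smooth (\<lambda>x. f x * g x)"
proof (rule smooth_coinduct[where X="{\<lambda>x. f x * g x | f g. smooth f \<and> smooth g}"])
  fix h x assume "h \<in> {\<lambda>x. f x * g x | f g. smooth f \<and> smooth g}"
  then show "h differentiable (at x)" by (auto intro!: differentiable_mult[OF smooth_differentiable smooth_differentiable])
next
  fix h :: "'a \<Rightarrow> complex" and b :: 'a
  assume "h \<in> {\<lambda>x. f x * g x | f g. smooth f \<and> smooth g}" and b: "b \<in> Basis"
  then obtain f g where h: "h = (\<lambda>x. f x * g x)" "smooth f" "smooth g" by auto
  show "partial_deriv b h \<in> fun_span {\<lambda>x. f x * g x | f g. smooth f \<and> smooth g}"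
    unfolding h(1) partial_deriv_mult[OF h(2,3)]
    using h b smooth_partial_deriv by (intro fun_span.add fun_span.base) blast+
qed (use assms in \<open>auto intro: fun_span.base\<close>)

lemma smooth_const: "smooth (\<lambda>x. c)"
  by (rule smooth_coinduct[where X="{\<lambda>x. c}"])
    (auto simp: partial_deriv_def intro: fun_span.intros)

lemma smooth_inner: "smooth (\<lambda>x. of_real (x \<bullet> c))"
proof (rule smooth_coinduct[where X="{\<lambda>x. of_real (x \<bullet> c)} \<union> {f. smooth f}"])
  have d: "((\<lambda>x. complex_of_real (x \<bullet> c)) has_derivative (\<lambda>h. of_real (h \<bullet> c))) (at x)" for x
    by (intro derivative_intros)
  fix g assume g: "g \<in> {\<lambda>x. complex_of_real (x \<bullet> c)} \<union> {f. smooth f}"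
  show "g differentiable (at x)" for x
    using g d by (auto simp: differentiable_def intro: smooth_differentiable[unfolded differentiable_def])
  fix b :: 'a assume "b \<in> Basis"
  have "partial_deriv b (\<lambda>x. complex_of_real (x \<bullet> c)) = (\<lambda>x. of_real (b \<bullet> c))"
    using partial_deriv_eq[OF d] by auto
  with g show "partial_deriv b g \<in> fun_span ({\<lambda>x. complex_of_real (x \<bullet> c)} \<union> {f. smooth f})"
    using \<open>b \<in> Basis\<close> smooth_partial_deriv by (elim UnE) (auto intro!: fun_span.base smooth_const)
qed (auto intro: fun_span.base)

lemma smooth_sum: "(\<And>i. i \<in> I \<Longrightarrow> smooth (f i)) \<Longrightarrow> smooth (\<lambda>x. \<Sum>i\<in>I. f i x)"
  by (induction I rule: infinite_finite_induct) (auto intro: smooth_const smooth_add)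

lemma smooth_compose:
  fixes G :: "real \<Rightarrow> complex" and q :: "'a::euclidean_space \<Rightarrow> real"
  assumes G: "smooth G" and q: "smooth (\<lambda>x. of_real (q x))"
  shows "smooth (\<lambda>x. G (q x))"
proof -
  let ?X = "{\<lambda>x. p x * G (q x) | p G. smooth p \<and> smooth G}"
  define Q where "Q = (\<lambda>x. complex_of_real (q x))"
  have Q: "smooth Q" unfolding Q_def by (rule q)
  have dq: "(q has_derivative (\<lambda>h. Re (frechet_derivative Q (at x) h))) (at x)" for x
    using bounded_linear.has_derivative[OF bounded_linear_Re smooth_has_derivative[OF Q]] by (simp add: Q_def)
  have dQ: "(Q has_derivative (\<lambda>h. of_real (Re (frechet_derivative Q (at x) h)))) (at x)" for x
    using has_derivative_of_real[OF dq[of x], where 'a=complex] by (simp add: Q_def)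
  have Qq: "frechet_derivative Q (at x) h = of_real (Re (frechet_derivative Q (at x) h))" for x h
    using has_derivative_unique[OF smooth_has_derivative[OF Q] dQ]
    by metis
  have d: "((\<lambda>x. p x * G (q x)) has_derivative
      (\<lambda>h. p x * frechet_derivative G (at (q x)) (Re (frechet_derivative Q (at x) h)) + frechet_derivative p (at x) h * G (q x))) (at x)"
    if "smooth p" "smooth G" for p G x
    by (intro has_derivative_mult smooth_has_derivative that has_derivative_compose[OF dq smooth_has_derivative[OF that(2)]])
  have lin: "frechet_derivative G (at y) t = of_real t * partial_deriv 1 G y" if "smooth G" for G :: "real \<Rightarrow> complex" and y t
    using linear_cmul[OF linear_frechet_derivative[OF smooth_differentiable[OF that]], of y t 1]
    by (simp add: partial_deriv_def scaleR_conv_of_real)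
  have pd: "partial_deriv b (\<lambda>x. p x * G (q x)) =
      (\<lambda>x. p x * partial_deriv b Q x * partial_deriv 1 G (q x) + partial_deriv b p x * G (q x))"
    if "smooth p" "smooth G" for p G b
    by (rule ext, subst partial_deriv_eq[OF d[OF that]])
      (simp only: lin[OF that(2)] Qq[symmetric] mult.assoc, simp only: partial_deriv_def)
  have "smooth (\<lambda>x. 1 * G (q x))"
  proof (rule smooth_coinduct[where X="?X"])
    show "h differentiable (at x)" if "h \<in> ?X" for h x
      using that d unfolding differentiable_def by blast
    fix h and b :: 'a assume "h \<in> ?X" and b: "b \<in> Basis"
    then obtain p G where h: "h = (\<lambda>x. p x * G (q x))" and pG: "smooth p" "smooth G" by auto
    have "smooth (\<lambda>x. p x * partial_deriv b Q x)" "smooth (partial_deriv 1 G)" "smooth (partial_deriv b p)"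
      using b pG Q by (auto intro!: smooth_mult smooth_partial_deriv)
    moreover have "(\<lambda>x. p x * G (q x)) \<in> fun_span ?X" if "smooth p" "smooth G" for p G
      using that by (intro fun_span.base) blast
    ultimately show "partial_deriv b h \<in> fun_span ?X"
      unfolding h pd[OF pG] using pG(2) by (intro fun_span.add)
  qed (use G in \<open>auto intro!: fun_span.base smooth_const exI[of _ "\<lambda>x. 1"] exI[of _ G]\<close>)
  then show ?thesis by simp
qed

lemma smooth_inverse:
  fixes u :: "'a::euclidean_space \<Rightarrow> complex"
  assumes u: "smooth u" and nz: "\<And>x. u x \<noteq> 0"
  shows "smooth (\<lambda>x. inverse (u x))"
proof -
  let ?X = "{\<lambda>x. p x * inverse (u x) ^ n | p n. smooth p}"
  have d: "((\<lambda>x. p x * inverse (u x) ^ n) has_derivative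
     (\<lambda>h. - of_nat n * p x * frechet_derivative u (at x) h * inverse (u x) ^ Suc n + frechet_derivative p (at x) h * inverse (u x) ^ n)) (at x)"
    if p: "smooth p" for p n x
  proof -
    have "inverse (u x) ^ (n - 1) * inverse (u x) * (of_nat n :: complex) = inverse (u x) ^ n * of_nat n"
      by (cases n) auto
    then show ?thesis using nz[of x]
      by (auto intro!: derivative_eq_intros smooth_has_derivative p u simp: fun_eq_iff algebra_simps)
  qed
  have pd: "partial_deriv b (\<lambda>x. p x * inverse (u x) ^ n) =
    (\<lambda>x. (- of_nat n * (p x * partial_deriv b u x)) * inverse (u x) ^ Suc n + partial_deriv b p x * inverse (u x) ^ n)"
    if p: "smooth p" for p n b
    by (rule ext, subst partial_deriv_eq[OF d[OF p]]) (simp add: partial_deriv_def)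
  have "smooth (\<lambda>x. 1 * inverse (u x) ^ 1)"
  proof (rule smooth_coinduct[where X="?X"])
    show "h differentiable (at x)" if "h \<in> ?X" for h x
      using that d unfolding differentiable_def by blast
    fix h and b :: 'a assume "h \<in> ?X" and b: "b \<in> Basis"
    then obtain p n where h: "h = (\<lambda>x. p x * inverse (u x) ^ n)" and p: "smooth p" by auto
    have "smooth (\<lambda>x. - of_nat n * (p x * partial_deriv b u x))" "smooth (partial_deriv b p)"
      by (rule smooth_cmult[OF smooth_mult[OF p smooth_partial_deriv[OF u b]]], rule smooth_partial_deriv[OF p b])
    moreover have "(\<lambda>x. p x * inverse (u x) ^ n) \<in> fun_span ?X" if "smooth p" for p n
      using that by (intro fun_span.base) blast
    ultimately show "partial_deriv b h \<in> fun_span ?X"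
      unfolding h pd[OF p] by (intro fun_span.add)
  next
    show "(\<lambda>x. 1 * inverse (u x) ^ 1) \<in> fun_span ?X"
      by (intro fun_span.base CollectI exI[of _ "\<lambda>x. 1"] exI[of _ 1] conjI smooth_const refl)
  qed
  then show ?thesis by simp
qed

lemma smooth_translation:
  fixes f :: "'a::euclidean_space \<Rightarrow> complex"
  assumes "smooth f"
  shows "smooth (\<lambda>x. f (x + y))"
proof (rule smooth_coinduct[where X="{\<lambda>x. f (x + y) | f. smooth f}"])
  have d: "((\<lambda>x. f (x + y)) has_derivative frechet_derivative f (at (x + y))) (at x)" if "smooth f"
    for f :: "'a \<Rightarrow> complex" and x
    by (rule has_derivative_compose[OF _ smooth_has_derivative[OF that], of "\<lambda>x. x + y" "\<lambda>h. h"]) 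
      (auto intro!: derivative_eq_intros)
  show "g differentiable (at x)" if "g \<in> {\<lambda>x. f (x + y) | f. smooth f}" for g x
    using that d unfolding differentiable_def by blast
  fix g and b :: 'a assume "g \<in> {\<lambda>x. f (x + y) | f. smooth f}" and b: "b \<in> Basis"
  then obtain f where g: "g = (\<lambda>x. f (x + y))" "smooth f" by auto
  have "partial_deriv b g = (\<lambda>x. partial_deriv b f (x + y))"
    unfolding g(1) by (rule ext, subst partial_deriv_eq[OF d[OF g(2)]]) (simp add: partial_deriv_def)
  then show "partial_deriv b g \<in> fun_span {\<lambda>x. f (x + y) | f. smooth f}"
    using smooth_partial_deriv[OF g(2) b] by (auto intro: fun_span.base)
qed (use assms in \<open>auto intro: fun_span.base\<close>)

definition flat :: "nat \<Rightarrow> real \<Rightarrow> real"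
  where "flat n r = (if r > 0 then inverse r ^ n * exp (- inverse r) else 0)"

lemma DERIV_flat: "(flat n has_real_derivative - real n * flat (n + 1) r + flat (n + 2) r) (at r)"
proof -
  consider "r > 0" | "r < 0" | "r = 0" by linarith
  then show ?thesis
  proof cases
    case 1
    have c: "inverse r ^ (n - 1) * inverse r * real n = inverse r ^ n * real n" by (cases n) auto
    have "((\<lambda>r. inverse r ^ n * exp (- inverse r)) has_real_derivative - real n * flat (n + 1) r + flat (n + 2) r) (at r)"
      using 1 c by (auto intro!: derivative_eq_intros simp: flat_def algebra_simps power2_eq_square)
    then show ?thesis
      by (rule has_field_derivative_transform_within_open[where S="{0<..}"]) (use 1 in \<open>auto simp: flat_def\<close>)
  next
    case 2
    have "((\<lambda>r. 0) has_real_derivative - real n * flat (n + 1) r + flat (n + 2) r) (at r)"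
      using 2 by (auto simp: flat_def)
    then show ?thesis
      by (rule has_field_derivative_transform_within_open[where S="{..<0}"]) (use 2 in \<open>auto simp: flat_def\<close>)
  next
    case 3
    have "((\<lambda>h. inverse h ^ Suc n / exp (inverse h)) \<longlongrightarrow> (0::real)) (at_right 0)"
      by (rule filterlim_compose[OF tendsto_power_div_exp_0 filterlim_inverse_at_top_right])
    then have "((\<lambda>h. flat n h / h) \<longlongrightarrow> 0) (at_right 0)"
      by (rule Lim_transform_eventually)
        (auto simp: eventually_at_right_field flat_def exp_minus field_simps intro!: exI[of _ 1])
    moreover have "((\<lambda>h. flat n h / h) \<longlongrightarrow> 0) (at_left 0)"
      by (rule Lim_transform_eventually[OF tendsto_const])
        (auto simp: eventually_at_left_field flat_def intro!: exI[of _ "-1"])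
    ultimately have "((\<lambda>h. flat n h / h) \<longlongrightarrow> 0) (at 0)"
      by (simp add: filterlim_split_at)
    then show ?thesis using 3 by (simp add: has_field_derivative_iff flat_def)
  qed
qed

lemma smooth_flat: "smooth (\<lambda>r. of_real (flat n r))"
proof (rule smooth_coinduct[where X="{\<lambda>r. of_real (flat n r) | n. True}"])
  have d: "((\<lambda>r. complex_of_real (flat n r)) has_derivative
      (\<lambda>h. of_real (h * (- real n * flat (n + 1) r + flat (n + 2) r)))) (at r)" for n r
    using has_derivative_of_real[OF DERIV_flat[unfolded has_field_derivative_def]] by (simp add: mult.commute)
  show "g differentiable (at x)" if "g \<in> {\<lambda>r. complex_of_real (flat n r) | n. True}" for g x
    using that d unfolding differentiable_def by blast
  fix g and b :: real assume "g \<in> {\<lambda>r. complex_of_real (flat n r) | n. True}" and b: "b \<in> Basis"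
  then obtain n where g: "g = (\<lambda>r. complex_of_real (flat n r))" by auto
  have "partial_deriv b g = (\<lambda>r. (- of_nat n) * of_real (flat (n + 1) r) + of_real (flat (n + 2) r))"
    unfolding g by (rule ext, subst partial_deriv_eq[OF d]) (use b in simp)
  then show "partial_deriv b g \<in> fun_span {\<lambda>r. complex_of_real (flat n r) | n. True}"
    by (simp only:, intro fun_span.add[OF fun_span.cmult[OF fun_span.base] fun_span.base]) blast+
qed (auto intro: fun_span.base)

lemma smooth_bump:
  obtains \<psi> :: "'a::euclidean_space \<Rightarrow> complex"
  where "smooth \<psi>" "\<And>x. norm x \<le> 3 \<Longrightarrow> \<psi> x = 1" "\<And>x. norm x \<ge> 4 \<Longrightarrow> \<psi> x = 0"
proof -
  define q where "q = (\<lambda>x::'a. x \<bullet> x)"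
  have "smooth (\<lambda>x::'a. \<Sum>b\<in>Basis. of_real (x \<bullet> b) * of_real (x \<bullet> b))"
    by (intro smooth_sum smooth_mult smooth_inner)
  then have q: "smooth (\<lambda>x. complex_of_real (q x))"
    unfolding q_def by (subst euclidean_inner) simp
  have u: "smooth (\<lambda>x. complex_of_real (flat 0 (16 - q x)))" "smooth (\<lambda>x. complex_of_real (flat 0 (q x - 9)))"
    using smooth_compose[OF smooth_flat[of 0], of "\<lambda>x. 16 - q x"] smooth_compose[OF smooth_flat[of 0], of "\<lambda>x. q x - 9"]
      smooth_diff[OF smooth_const[of 16] q] smooth_diff[OF q smooth_const[of 9]]
    by simp_all
  define w where "w = (\<lambda>x. complex_of_real (flat 0 (16 - q x)) + complex_of_real (flat 0 (q x - 9)))"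
  have nz: "w x \<noteq> 0" for x
  proof -
    have "flat 0 (16 - q x) + flat 0 (q x - 9) > 0"
      by (cases "q x < 16") (auto simp: flat_def add_pos_pos)
    then show ?thesis unfolding w_def by (simp flip: of_real_add)
  qed
  show ?thesis
  proof
    show "smooth (\<lambda>x. complex_of_real (flat 0 (16 - q x)) * inverse (w x))"
      by (intro smooth_mult u smooth_inverse nz) (auto simp: w_def intro!: smooth_add u)
    show "complex_of_real (flat 0 (16 - q x)) * inverse (w x) = 1" if "norm x \<le> 3" for x
    proof -
      have "(norm x)\<^sup>2 \<le> 3\<^sup>2" using that by (intro power_mono) auto
      then have "q x \<le> 9" by (simp add: q_def power2_norm_eq_inner)
      then have "w x = of_real (flat 0 (16 - q x))" by (simp add: w_def flat_def)
      then show ?thesis using nz[of x] by simp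
    qed
    show "complex_of_real (flat 0 (16 - q x)) * inverse (w x) = 0" if "norm x \<ge> 4" for x
    proof -
      have "4\<^sup>2 \<le> (norm x)\<^sup>2" using that by (intro power_mono) auto
      then have "q x \<ge> 16" by (simp add: q_def power2_norm_eq_inner)
      then show ?thesis by (simp add: flat_def)
    qed
  qed
qed

lemma smooth_compact_support_imp_schwartz:
  fixes f :: "'a::euclidean_space \<Rightarrow> complex"
  assumes f: "smooth f" and z: "\<And>x. norm x \<ge> R \<Longrightarrow> f x = 0"
  shows "schwartz f"
  unfolding schwartz_def
proof (intro ballI conjI allI)
  fix bs :: "'a list" assume bs: "bs \<in> lists Basis"
  note sm = smooth_iter_partial_deriv[OF f bs]
  show "iter_partial_deriv bs f differentiable (at x)" for x by (rule smooth_differentiable[OF sm])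
  fix k
  have zero: "iter_partial_deriv bs f x = 0" if "norm x > R" for x
    using bs that
  proof (induction arbitrary: x)
    case Nil then show ?case using z by simp
  next
    case (Cons b bs)
    have "open {x::'a. norm x > R}" by (intro open_Collect_less continuous_intros)
    then have "frechet_derivative (\<lambda>x. 0) (at x) = frechet_derivative (iter_partial_deriv bs f) (at x)"
      using Cons by (intro frechet_derivative_transform_within_open[where X="{x. norm x > R}"]) auto
    then show ?case by (simp add: partial_deriv_def) (metis frechet_derivative_const)
  qed
  have "continuous_on UNIV (iter_partial_deriv bs f)"
    using smooth_differentiable[OF sm] by (auto intro!: continuous_at_imp_continuous_on differentiable_imp_continuous_within)
  then have c: "continuous_on (cball 0 R) (\<lambda>x. norm x ^ k *\<^sub>R iter_partial_deriv bs f x)"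
    by (intro continuous_intros) (auto intro: continuous_on_subset)
  have "bounded (insert 0 ((\<lambda>x. norm x ^ k *\<^sub>R iter_partial_deriv bs f x) ` cball 0 R))"
    using compact_imp_bounded[OF compact_continuous_image[OF c compact_cball]] by simp
  then show "bounded (range (\<lambda>x. norm x ^ k *\<^sub>R iter_partial_deriv bs f x))"
  proof (rule bounded_subset)
    show "range (\<lambda>x. norm x ^ k *\<^sub>R iter_partial_deriv bs f x) \<subseteq> insert 0 ((\<lambda>x. norm x ^ k *\<^sub>R iter_partial_deriv bs f x) ` cball 0 R)"
      using zero by (force simp: not_le)
  qed
qed

lemma schwartz_imp_smooth: "schwartz f \<Longrightarrow> smooth f"
  unfolding schwartz_def smooth_def by blast

section \<open>Rapid decay of Schwartz functions and their transforms\<close>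

definition rapid :: "('a::euclidean_space \<Rightarrow> complex) \<Rightarrow> bool"
  where "rapid f \<longleftrightarrow> continuous_on UNIV f \<and> (\<forall>k. \<exists>C. \<forall>x. norm x ^ k * cmod (f x) \<le> C)"

lemma rapid_continuous: "rapid f \<Longrightarrow> continuous_on UNIV f"
  unfolding rapid_def by blast

lemma rapid_measurable: "rapid f \<Longrightarrow> f \<in> borel_measurable borel"
  by (intro borel_measurable_continuous_onI rapid_continuous)

lemma rapid_weight_bound:
  fixes f :: "'a::euclidean_space \<Rightarrow> complex"
  assumes "rapid f"
  obtains C where "\<And>x. (1 + (norm x)\<^sup>2) ^ k * cmod (f x) \<le> C"
proof -
  obtain C0 C1 where C0: "\<And>x. norm x ^ 0 * cmod (f x) \<le> C0" and C1: "\<And>x. norm x ^ (2 * k) * cmod (f x) \<le> C1"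
    using assms unfolding rapid_def by metis
  show ?thesis
  proof
    fix x :: 'a
    have "(1 + (norm x)\<^sup>2) ^ k \<le> (2 * max 1 ((norm x)\<^sup>2)) ^ k" by (intro power_mono) auto
    also have "\<dots> \<le> 2 ^ k * (norm x ^ 0 + norm x ^ (2 * k))"
      by (auto simp: power_mult_distrib power_mult max_def)
    finally have "(1 + (norm x)\<^sup>2) ^ k * cmod (f x) \<le> 2 ^ k * (norm x ^ 0 + norm x ^ (2 * k)) * cmod (f x)"
      by (rule mult_right_mono) simp
    also have "\<dots> = 2 ^ k * (norm x ^ 0 * cmod (f x) + norm x ^ (2 * k) * cmod (f x))"
      by (simp only: distrib_right mult.assoc)
    also have "\<dots> \<le> 2 ^ k * (C0 + C1)"
      by (intro mult_left_mono add_mono C0 C1) simp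
    finally show "(1 + (norm x)\<^sup>2) ^ k * cmod (f x) \<le> 2 ^ k * (C0 + C1)" .
  qed
qed

lemma rapid_bounded:
  fixes f :: "'a::euclidean_space \<Rightarrow> complex"
  assumes "rapid f"
  obtains B where "\<And>x. cmod (f x) \<le> B" "B \<ge> 0"
proof -
  obtain C where C: "\<And>x. (1 + (norm x)\<^sup>2) ^ 0 * cmod (f x) \<le> C" using rapid_weight_bound[OF assms] by metis
  show ?thesis
  proof
    show "cmod (f x) \<le> C" for x using C[of x] by simp
    show "C \<ge> 0" using order_trans[OF norm_ge_zero[of "f 0"]] C[of 0] by simp
  qed
qed

lemma integrable_inverse_weight:
  "integrable lborel (\<lambda>x::'a::euclidean_space. inverse ((1 + (norm x)\<^sup>2) ^ DIM('a)))"
proof -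
  have 1: "integrable lborel (\<lambda>t::real. inverse (1 + t\<^sup>2))"
    using integrable_inverse_1_plus_square by (simp add: set_integrable_def)
  show ?thesis
  proof (rule Bochner_Integration.integrable_bound[OF integrable_lborel_prod[of "\<lambda>_ t. inverse (1 + t\<^sup>2)", OF 1]])
    show "AE x::'a in lborel. norm (inverse ((1 + (norm x)\<^sup>2) ^ DIM('a))) \<le> norm (\<Prod>b\<in>Basis. inverse (1 + (x \<bullet> b)\<^sup>2))"
    proof (rule AE_I2)
      fix x :: 'a
      have "(\<Prod>b::'a\<in>Basis. inverse (1 + (norm x)\<^sup>2)) \<le> (\<Prod>b\<in>Basis. inverse (1 + (x \<bullet> b)\<^sup>2))"
      proof (intro prod_mono conjI le_imp_inverse_le add_left_mono)
        fix b :: 'a assume "b \<in> Basis"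
        then have "\<bar>x \<bullet> b\<bar> \<le> norm x" by (rule Basis_le_norm)
        then have "\<bar>x \<bullet> b\<bar>\<^sup>2 \<le> (norm x)\<^sup>2" by (intro power_mono) auto
        then show "(x \<bullet> b)\<^sup>2 \<le> (norm x)\<^sup>2" by simp
      qed (auto simp: add_pos_nonneg)
      then show "norm (inverse ((1 + (norm x)\<^sup>2) ^ DIM('a))) \<le> norm (\<Prod>b\<in>Basis. inverse (1 + (x \<bullet> b)\<^sup>2))"
        by (simp add: power_inverse prod_nonneg add_nonneg_nonneg)
    qed
  qed measurable
qed

lemma rapid_integrable:
  fixes f :: "'a::euclidean_space \<Rightarrow> complex"
  assumes f: "rapid f"
  shows "integrable lborel f"
proof -
  obtain C where C: "\<And>x. (1 + (norm x)\<^sup>2) ^ DIM('a) * cmod (f x) \<le> C" using rapid_weight_bound[OF f] by metis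
  have [measurable]: "f \<in> borel_measurable borel" by (rule rapid_measurable[OF f])
  show ?thesis
  proof (rule Bochner_Integration.integrable_bound[OF integrable_mult_right[OF integrable_inverse_weight[where 'a='a], of C]])
    have "cmod (f x) \<le> C * inverse ((1 + (norm x)\<^sup>2) ^ DIM('a))" for x
    proof -
      have "(1 + (norm x)\<^sup>2) ^ DIM('a) > 0" by (intro zero_less_power add_pos_nonneg) auto
      with C[of x] show ?thesis by (simp add: field_simps)
    qed
    then show "AE x in lborel. cmod (f x) \<le> norm (C * inverse ((1 + (norm x)\<^sup>2) ^ DIM('a)))"
      by (intro AE_I2) (auto intro: order_trans[OF _ abs_ge_self])
  qed simp
qed

lemma rapid_mult_weight:
  fixes f :: "'a::euclidean_space \<Rightarrow> complex"
  assumes f: "rapid f"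
  shows "rapid (\<lambda>x. of_real ((1 + (norm x)\<^sup>2) powr s) * f x)"
  unfolding rapid_def
proof (intro conjI allI)
  have pos: "1 + (norm x)\<^sup>2 > 0" for x :: 'a by (simp add: add_pos_nonneg)
  then have "1 + (norm x)\<^sup>2 \<noteq> 0" for x :: 'a using less_irrefl by metis
  then show "continuous_on UNIV (\<lambda>x. of_real ((1 + (norm x)\<^sup>2) powr s) * f x)"
    by (intro continuous_intros rapid_continuous[OF f]) auto
  fix k
  obtain n :: nat where n: "s \<le> real n" using real_arch_simple by blast
  obtain C where C: "\<And>x. (1 + (norm x)\<^sup>2) ^ (n + k) * cmod (f x) \<le> C" using rapid_weight_bound[OF f] by metis
  show "\<exists>C. \<forall>x. norm x ^ k * cmod (of_real ((1 + (norm x)\<^sup>2) powr s) * f x) \<le> C"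
  proof (intro exI allI)
    fix x :: 'a
    have "(1 + (norm x)\<^sup>2) powr s \<le> (1 + (norm x)\<^sup>2) powr real n" by (intro powr_mono n) simp
    also have "\<dots> = (1 + (norm x)\<^sup>2) ^ n" by (rule powr_realpow[OF pos])
    finally have 1: "(1 + (norm x)\<^sup>2) powr s \<le> (1 + (norm x)\<^sup>2) ^ n" .
    have "0 \<le> (norm x - 1)\<^sup>2 + (norm x)\<^sup>2" by simp
    then have "norm x \<le> 1 + (norm x)\<^sup>2" unfolding power2_eq_square by (simp add: algebra_simps)
    then have 2: "norm x ^ k \<le> (1 + (norm x)\<^sup>2) ^ k" by (intro power_mono) auto
    have "norm x ^ k * (1 + (norm x)\<^sup>2) powr s \<le> (1 + (norm x)\<^sup>2) ^ k * (1 + (norm x)\<^sup>2) ^ n"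
      by (intro mult_mono 1 2) (auto intro!: zero_le_power add_nonneg_nonneg)
    then have "norm x ^ k * (1 + (norm x)\<^sup>2) powr s * cmod (f x) \<le> (1 + (norm x)\<^sup>2) ^ (n + k) * cmod (f x)"
      by (intro mult_right_mono) (auto simp: power_add mult.commute)
    then show "norm x ^ k * cmod (of_real ((1 + (norm x)\<^sup>2) powr s) * f x) \<le> C"
      using C[of x] by (simp add: norm_mult mult.assoc)
  qed
qed

lemma rapid_integrable_weight_sq:
  fixes f :: "'a::euclidean_space \<Rightarrow> complex"
  assumes f: "rapid f"
  shows "integrable lborel (\<lambda>x. (1 + (norm x)\<^sup>2) powr s * (cmod (f x))\<^sup>2)"
proof -
  obtain B where B: "\<And>x. cmod (f x) \<le> B" "B \<ge> 0" using rapid_bounded[OF f] by metis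
  have [measurable]: "f \<in> borel_measurable borel" by (rule rapid_measurable[OF f])
  show ?thesis
    by (rule Bochner_Integration.integrable_bound[OF integrable_mult_right[OF rapid_integrable[OF rapid_mult_weight[OF f, of s]], of "of_real B"]])
      (auto simp: norm_mult power2_eq_square mult_ac intro!: mult_left_mono mult_right_mono order_trans[OF B(1) abs_ge_self] AE_I2)
qed

lemma schwartz_iter_rapid:
  assumes f: "schwartz f" and bs: "bs \<in> lists Basis"
  shows "rapid (iter_partial_deriv bs f)"
  unfolding rapid_def
proof (intro conjI allI)
  show "continuous_on UNIV (iter_partial_deriv bs f)"
    using f bs unfolding schwartz_def
    by (auto intro!: continuous_at_imp_continuous_on differentiable_imp_continuous_within)
  fix k
  have "bounded (range (\<lambda>x. norm x ^ k *\<^sub>R iter_partial_deriv bs f x))"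
    using f bs unfolding schwartz_def by blast
  then show "\<exists>C. \<forall>x. norm x ^ k * cmod (iter_partial_deriv bs f x) \<le> C"
    by (auto simp: bounded_iff)
qed

lemma schwartz_rapid: "schwartz f \<Longrightarrow> rapid f"
  using schwartz_iter_rapid[of f "[]"] by simp

lemma schwartz_partial_deriv:
  assumes "schwartz f" "b \<in> Basis"
  shows "schwartz (partial_deriv b f)"
proof -
  have "iter_partial_deriv bs (partial_deriv b f) = iter_partial_deriv (bs @ [b]) f" for bs
    by (simp add: iter_partial_deriv_append)
  with assms show ?thesis unfolding schwartz_def by simp
qed

lemma fourier_translation:
  fixes f :: "'a::euclidean_space \<Rightarrow> complex"
  assumes "integrable lborel f"
  shows "fourier (\<lambda>x. f (x + y)) \<xi> = cis (y \<bullet> \<xi>) * fourier f \<xi>"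
proof -
  have [measurable]: "f \<in> borel_measurable borel" using assms by auto
  have c: "cis (y \<bullet> \<xi>) * cis (- ((x + y) \<bullet> \<xi>)) = cis (- (x \<bullet> \<xi>))" for x
    by (simp only: cis_mult inner_add_left) simp
  have "fourier f \<xi> = (\<integral>x. cis (- ((x + y) \<bullet> \<xi>)) * f (x + y) \<partial>lborel)"
    unfolding fourier_def by (rule integral_lborel_translation[symmetric]) measurable
  then have "cis (y \<bullet> \<xi>) * fourier f \<xi> = (\<integral>x. cis (y \<bullet> \<xi>) * (cis (- ((x + y) \<bullet> \<xi>)) * f (x + y)) \<partial>lborel)"
    by (simp only: integral_mult_right_zero)
  then show ?thesis unfolding fourier_def mult.assoc[symmetric] c by simp
qed

lemma fourier_partial_deriv:
  fixes f :: "'a::euclidean_space \<Rightarrow> complex"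
  assumes f: "schwartz f" and b: "b \<in> Basis"
  shows "fourier (partial_deriv b f) \<xi> = \<i> * of_real (\<xi> \<bullet> b) * fourier f \<xi>"
proof (rule LIMSEQ_unique)
  define h where "h = (\<lambda>n. 1 / real (Suc n))"
  have h: "h n > 0" "h n \<le> 1" for n by (auto simp: h_def)
  have h0: "h \<longlonglongrightarrow> 0" unfolding h_def by (intro LIMSEQ_Suc[OF lim_1_over_n])
  note fi = rapid_integrable[OF schwartz_rapid[OF f]]
  let ?g = "partial_deriv b f"
  have g: "rapid ?g" by (intro schwartz_rapid schwartz_partial_deriv f b)
  have [measurable]: "f \<in> borel_measurable borel" "?g \<in> borel_measurable borel"
    by (intro rapid_measurable schwartz_rapid[OF f] g)+
  obtain C where C: "\<And>x. (1 + (norm x)\<^sup>2) ^ DIM('a) * cmod (?g x) \<le> C" using rapid_weight_bound[OF g] by metis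
  have C0: "C \<ge> 0" using order_trans[OF _ C[of 0]] by simp
  have der: "(f has_derivative frechet_derivative f (at x)) (at x)" for x
    by (rule smooth_has_derivative[OF schwartz_imp_smooth[OF f]])
  have lin: "frechet_derivative f (at x) (t *\<^sub>R b) = t *\<^sub>R ?g x" for x t
    using linear_cmul[OF linear_frechet_derivative] der unfolding partial_deriv_def differentiable_def by blast
  have line: "((\<lambda>s. f (x + s *\<^sub>R b)) has_derivative (\<lambda>t. t *\<^sub>R ?g (x + s *\<^sub>R b))) (at s)" for x s
  proof -
    have "((\<lambda>s. f (x + s *\<^sub>R b)) has_derivative (\<lambda>t. frechet_derivative f (at (x + s *\<^sub>R b)) (t *\<^sub>R b))) (at s)"
      by (rule has_derivative_compose[OF _ der]) (auto intro!: derivative_eq_intros)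
    then show ?thesis by (simp only: lin)
  qed
  let ?w = "\<lambda>x::'a. 3 ^ DIM('a) * C * inverse ((1 + (norm x)\<^sup>2) ^ DIM('a))"
  have bound: "cmod ((f (x + h n *\<^sub>R b) - f x) / of_real (h n)) \<le> ?w x" for n x
  proof -
    have "continuous_on {0..h n} (\<lambda>s. f (x + s *\<^sub>R b))"
      using line by (auto intro!: continuous_at_imp_continuous_on has_derivative_continuous)
    from mvt_general[OF h(1) this line]
    obtain s where s: "s \<in> {0<..<h n}" and le: "cmod (f (x + h n *\<^sub>R b) - f (x + 0 *\<^sub>R b)) \<le> cmod ((h n - 0) *\<^sub>R ?g (x + s *\<^sub>R b))"
      by blast
    let ?y = "x + s *\<^sub>R b"
    have "norm x \<le> norm ?y + norm (s *\<^sub>R b)" using norm_triangle_ineq4[of ?y "s *\<^sub>R b"] by simp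
    also have "norm (s *\<^sub>R b) \<le> 1" using s h[of n] b by simp
    finally have "norm x \<le> norm ?y + 1" by simp
    then have "(norm x)\<^sup>2 \<le> (norm ?y + 1)\<^sup>2" by (intro power_mono) auto
    also have "\<dots> \<le> 2 * (norm ?y)\<^sup>2 + 2"
      using zero_le_power2[of "norm ?y - 1"] by (simp add: power2_eq_square algebra_simps)
    finally have "1 + (norm x)\<^sup>2 \<le> 3 * (1 + (norm ?y)\<^sup>2)"
      using zero_le_power2[of "norm ?y"] unfolding distrib_left by linarith
    then have "(1 + (norm x)\<^sup>2) ^ DIM('a) \<le> (3 * (1 + (norm ?y)\<^sup>2)) ^ DIM('a)" by (intro power_mono) auto
    then have "(1 + (norm x)\<^sup>2) ^ DIM('a) * cmod (?g ?y) \<le> (3 * (1 + (norm ?y)\<^sup>2)) ^ DIM('a) * cmod (?g ?y)"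
      by (rule mult_right_mono) simp
    also have "\<dots> \<le> 3 ^ DIM('a) * C" using C[of ?y] by (simp only: power_mult_distrib mult.assoc) simp
    finally have k: "(1 + (norm x)\<^sup>2) ^ DIM('a) * cmod (?g ?y) \<le> 3 ^ DIM('a) * C" .
    have p: "(1 + (norm x)\<^sup>2) ^ DIM('a) > 0" by (intro zero_less_power add_pos_nonneg) auto
    have "cmod ((f (x + h n *\<^sub>R b) - f x) / of_real (h n)) \<le> cmod (?g ?y)"
      using le h(1)[of n] by (simp add: norm_divide field_simps)
    also have "\<dots> \<le> ?w x" using k p by (simp add: field_simps)
    finally show ?thesis .
  qed
  have quot: "(\<lambda>n. (f (x + h n *\<^sub>R b) - f x) / of_real (h n)) \<longlonglongrightarrow> ?g x" for x
  proof -
    have "(\<lambda>t. cmod (f (x + t *\<^sub>R b) - f x - t *\<^sub>R ?g x) / norm t) \<midarrow>0\<rightarrow> 0"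
      using line[of x 0] unfolding has_derivative_at by simp
    moreover have "filterlim h (at 0) sequentially"
      unfolding filterlim_at using h h0 by (auto intro!: always_eventually simp: less_imp_neq[THEN not_sym])
    ultimately have "(\<lambda>n. cmod (f (x + h n *\<^sub>R b) - f x - h n *\<^sub>R ?g x) / norm (h n)) \<longlonglongrightarrow> 0"
      by (rule filterlim_compose)
    also have "(\<lambda>n. cmod (f (x + h n *\<^sub>R b) - f x - h n *\<^sub>R ?g x) / norm (h n))
        = (\<lambda>n. cmod ((f (x + h n *\<^sub>R b) - f x) / of_real (h n) - ?g x))"
    proof
      fix n
      have "(f (x + h n *\<^sub>R b) - f x) / of_real (h n) - ?g x = (f (x + h n *\<^sub>R b) - f x - h n *\<^sub>R ?g x) / of_real (h n)"
        using h(1)[of n] by (simp add: scaleR_conv_of_real field_simps)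
      then show "cmod (f (x + h n *\<^sub>R b) - f x - h n *\<^sub>R ?g x) / norm (h n)
        = cmod ((f (x + h n *\<^sub>R b) - f x) / of_real (h n) - ?g x)"
        by (simp only: norm_divide norm_of_real real_norm_def)
    qed
    finally show ?thesis by (rule LIM_zero_cancel[OF tendsto_norm_zero_cancel])
  qed
  show "(\<lambda>n. \<integral>x. cis (- (x \<bullet> \<xi>)) * ((f (x + h n *\<^sub>R b) - f x) / of_real (h n)) \<partial>lborel) \<longlonglongrightarrow> fourier ?g \<xi>"
    unfolding fourier_def
  proof (rule integral_dominated_convergence[where w="?w"])
    show "AE x in lborel. (\<lambda>n. cis (- (x \<bullet> \<xi>)) * ((f (x + h n *\<^sub>R b) - f x) / of_real (h n))) \<longlonglongrightarrow> cis (- (x \<bullet> \<xi>)) * ?g x"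
      by (intro AE_I2 tendsto_mult tendsto_const quot)
    show "AE x in lborel. cmod (cis (- (x \<bullet> \<xi>)) * ((f (x + h n *\<^sub>R b) - f x) / of_real (h n))) \<le> ?w x" for n
      using bound by (simp only: norm_mult norm_cis mult_1_left) simp
    show "integrable lborel ?w" by (intro integrable_mult_right integrable_inverse_weight)
  qed measurable
  have eq: "(\<integral>x. cis (- (x \<bullet> \<xi>)) * ((f (x + h n *\<^sub>R b) - f x) / of_real (h n)) \<partial>lborel)
      = (cis (h n * (\<xi> \<bullet> b)) - 1) / of_real (h n) * fourier f \<xi>" for n
  proof -
    have i: "integrable lborel (\<lambda>x. cis (- (x \<bullet> \<xi>)) * f (x + h n *\<^sub>R b))" "integrable lborel (\<lambda>x. cis (- (x \<bullet> \<xi>)) * f x)"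
      using integrable_lborel_translation[OF fi] fi by (auto intro!: integrable_cis_mult)
    have "(\<integral>x. cis (- (x \<bullet> \<xi>)) * ((f (x + h n *\<^sub>R b) - f x) / of_real (h n)) \<partial>lborel)
       = (\<integral>x. (cis (- (x \<bullet> \<xi>)) * f (x + h n *\<^sub>R b) - cis (- (x \<bullet> \<xi>)) * f x) / of_real (h n) \<partial>lborel)"
      by (simp only: right_diff_distrib times_divide_eq_right)
    also have "\<dots> = (fourier (\<lambda>x. f (x + h n *\<^sub>R b)) \<xi> - fourier f \<xi>) / of_real (h n)"
      unfolding fourier_def by (simp only: integral_divide_zero Bochner_Integration.integral_diff[OF i])
    also have "\<dots> = (cis (h n * (\<xi> \<bullet> b)) - 1) / of_real (h n) * fourier f \<xi>"
      unfolding fourier_translation[OF fi, of "h n *\<^sub>R b" \<xi>]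
      by (simp add: inner_commute[of b \<xi>] left_diff_distrib)
    finally show ?thesis .
  qed
  show "(\<lambda>n. \<integral>x. cis (- (x \<bullet> \<xi>)) * ((f (x + h n *\<^sub>R b) - f x) / of_real (h n)) \<partial>lborel) \<longlonglongrightarrow> \<i> * of_real (\<xi> \<bullet> b) * fourier f \<xi>"
    unfolding eq
  proof (intro tendsto_mult tendsto_const)
    define t where "t = \<xi> \<bullet> b"
    have "((\<lambda>z. exp (\<i> * of_real t * z)) has_field_derivative \<i> * of_real t) (at 0)"
      by (auto intro!: derivative_eq_intros)
    then have "(\<lambda>z. (exp (\<i> * of_real t * z) - 1) / z) \<midarrow>0\<rightarrow> \<i> * of_real t"
      by (simp add: has_field_derivative_iff)
    moreover have "filterlim (\<lambda>n. complex_of_real (h n)) (at 0) sequentially"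
      unfolding filterlim_at using h h0 tendsto_of_real[OF h0, where 'a=complex] by (auto intro!: always_eventually simp: less_imp_neq[THEN not_sym])
    ultimately have "(\<lambda>n. (exp (\<i> * of_real t * of_real (h n)) - 1) / of_real (h n)) \<longlonglongrightarrow> \<i> * of_real t"
      by (rule filterlim_compose)
    then show "(\<lambda>n. (cis (h n * t) - 1) / of_real (h n)) \<longlonglongrightarrow> \<i> * of_real t"
      by (simp add: cis_conv_exp mult_ac)
  qed
qed

lemma fourier_rapid:
  fixes f :: "'a::euclidean_space \<Rightarrow> complex"
  assumes f: "schwartz f"
  shows "rapid (fourier f)"
  unfolding rapid_def
proof (intro conjI allI)
  show "continuous_on UNIV (fourier f)"
    by (intro continuous_on_fourier rapid_integrable schwartz_rapid f)
  fix k
  have it: "schwartz (iter_partial_deriv (replicate k b) f) \<and>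
      fourier (iter_partial_deriv (replicate k b) f) \<xi> = (\<i> * of_real (\<xi> \<bullet> b)) ^ k * fourier f \<xi>" if "b \<in> Basis" for b \<xi>
    by (induction k) (auto simp: f that fourier_partial_deriv mult.assoc intro: schwartz_partial_deriv)
  define M where "M = (\<lambda>b. \<integral>x. cmod (iter_partial_deriv (replicate k b) f x) \<partial>lborel)"
  have M0: "M b \<ge> 0" for b unfolding M_def by simp
  have M: "\<bar>\<xi> \<bullet> b\<bar> ^ k * cmod (fourier f \<xi>) \<le> M b" if b: "b \<in> Basis" for b \<xi>
    using norm_fourier_le[of "iter_partial_deriv (replicate k b) f" \<xi>] it[OF b, of \<xi>]
    by (simp add: M_def norm_mult norm_power)
  show "\<exists>C. \<forall>\<xi>. norm \<xi> ^ k * cmod (fourier f \<xi>) \<le> C"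
  proof (intro exI allI)
    fix \<xi> :: 'a
    obtain b where b: "b \<in> Basis" "norm \<xi> \<le> DIM('a) * \<bar>\<xi> \<bullet> b\<bar>"
    proof (rule ccontr)
      assume *: "\<not> thesis"
      have "(\<Sum>b\<in>Basis. DIM('a) * \<bar>\<xi> \<bullet> b\<bar>) < (\<Sum>b::'a\<in>Basis. norm \<xi>)"
        using * that by (intro sum_strict_mono) (auto simp: not_le intro: leI)
      then have "(\<Sum>b\<in>Basis. \<bar>\<xi> \<bullet> b\<bar>) < norm \<xi>"
        by (simp flip: sum_distrib_left)
      with norm_le_l1[of \<xi>] show False by simp
    qed
    have "norm \<xi> ^ k \<le> (DIM('a) * \<bar>\<xi> \<bullet> b\<bar>) ^ k" by (intro power_mono b) simp
    then have "norm \<xi> ^ k * cmod (fourier f \<xi>) \<le> (DIM('a) * \<bar>\<xi> \<bullet> b\<bar>) ^ k * cmod (fourier f \<xi>)"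
      by (rule mult_right_mono) simp
    also have "\<dots> = DIM('a) ^ k * (\<bar>\<xi> \<bullet> b\<bar> ^ k * cmod (fourier f \<xi>))" by (simp add: power_mult_distrib)
    also have "\<dots> \<le> DIM('a) ^ k * (\<Sum>b\<in>Basis. M b)"
      using M[OF b(1), of \<xi>] member_le_sum[OF b(1), of M] M0 by (intro mult_left_mono) auto
    finally show "norm \<xi> ^ k * cmod (fourier f \<xi>) \<le> DIM('a) ^ k * (\<Sum>b\<in>Basis. M b)" .
  qed
qed

section \<open>Subordination and holomorphic parameter integrals\<close>

definition gauss_int :: "real \<Rightarrow> real"
  where "gauss_int w = (LBINT s=0..w. exp (- s\<^sup>2))"

lemma DERIV_gauss_int: "(gauss_int has_real_derivative exp (- x\<^sup>2)) (at x)"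
proof -
  let ?a = "- \<bar>x\<bar> - 1" and ?b = "\<bar>x\<bar> + 1"
  have "((\<lambda>u. LBINT y=ereal 0..u. exp (- y\<^sup>2)) has_vector_derivative exp (- x\<^sup>2)) (at x within {?a..?b})"
    by (rule interval_integral_FTC2) (auto intro!: continuous_intros)
  then have "((\<lambda>u. LBINT y=ereal 0..u. exp (- y\<^sup>2)) has_vector_derivative exp (- x\<^sup>2)) (at x within {?a<..<?b})"
    by (rule has_vector_derivative_within_subset) auto
  then have "((\<lambda>u. LBINT y=ereal 0..u. exp (- y\<^sup>2)) has_vector_derivative exp (- x\<^sup>2)) (at x)"
    by (subst (asm) at_within_open) auto
  then show ?thesis
    by (simp add: gauss_int_def[abs_def] has_real_derivative_iff_has_vector_derivative zero_ereal_def)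
qed

lemma gauss_int_at_top: "(gauss_int \<longlongrightarrow> sqrt pi / 2) at_top"
proof -
  let ?f = "\<lambda>s::real. indicator {0..} s *\<^sub>R exp (- s\<^sup>2)"
  have f: "integrable lborel ?f" "(\<integral>s. ?f s \<partial>lborel) = sqrt pi / 2"
    using gaussian_moment_0 by (auto simp: has_bochner_integral_iff)
  have "((\<lambda>y. \<integral>s. indicator {..y} s *\<^sub>R ?f s \<partial>lborel) \<longlongrightarrow> sqrt pi / 2) at_top"
    using tendsto_integral_at_top[OF _ f(1)] unfolding f(2) by simp
  moreover have "eventually (\<lambda>y. (\<integral>s. indicator {..y} s *\<^sub>R ?f s \<partial>lborel) = gauss_int y) at_top"
    using eventually_ge_at_top[of 0]
  proof eventually_elim
    case (elim y)
    have "gauss_int y = (LBINT s:{0..y}. exp (- s\<^sup>2))"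
      using interval_integral_Icc[OF elim] by (simp add: gauss_int_def zero_ereal_def)
    also have "\<dots> = (\<integral>s. indicator {..y} s *\<^sub>R ?f s \<partial>lborel)"
      unfolding set_lebesgue_integral_def
      by (intro Bochner_Integration.integral_cong) (auto simp: indicator_def)
    finally show ?case by simp
  qed
  ultimately show ?thesis by (rule Lim_transform_eventually)
qed

lemma gauss_int_minus: "gauss_int (- w) = - gauss_int w"
  unfolding gauss_int_def
  by (subst interval_integral_reflect, subst interval_integral_endpoints_reverse) simp

lemma gauss_int_at_bot: "(gauss_int \<longlongrightarrow> - (sqrt pi / 2)) at_bot"
proof -
  have "((\<lambda>w. - gauss_int (- w)) \<longlongrightarrow> - (sqrt pi / 2)) at_bot"
    by (intro tendsto_minus filterlim_compose[OF gauss_int_at_top filterlim_uminus_at_top_at_bot])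
  then show ?thesis by (simp add: gauss_int_minus)
qed

text \<open>The antiderivative comes from completing the square in the exponent in two ways,
  \<open>(a v - b/v)\<^sup>2 + 2 a b\<close> and \<open>(a v + b/v)\<^sup>2 - 2 a b\<close>.\<close>

lemma subordination:
  fixes a b :: real
  assumes a: "a > 0" and b: "b > 0"
  shows "has_bochner_integral lborel (\<lambda>v. indicator {0<..} v *\<^sub>R exp (- (a\<^sup>2 * v\<^sup>2) - b\<^sup>2 / v\<^sup>2))
    (sqrt pi / (2 * a) * exp (- (2 * a * b)))"
proof -
  define F where "F = (\<lambda>v. (gauss_int (a * v - b / v) * exp (- (2 * a * b)) + gauss_int (a * v + b / v) * exp (2 * a * b)) / (2 * a))"
  let ?f = "\<lambda>v. exp (- (a\<^sup>2 * v\<^sup>2) - b\<^sup>2 / v\<^sup>2)"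
  have DF: "DERIV F v :> ?f v" if "v > 0" for v
  proof -
    have D1: "((\<lambda>v. gauss_int (a * v - b / v)) has_real_derivative exp (- (a * v - b / v)\<^sup>2) * (a + b / v\<^sup>2)) (at v)"
      by (rule DERIV_chain2[OF DERIV_gauss_int])
        (use that in \<open>auto intro!: derivative_eq_intros simp: power2_eq_square\<close>)
    have D2: "((\<lambda>v. gauss_int (a * v + b / v)) has_real_derivative exp (- (a * v + b / v)\<^sup>2) * (a - b / v\<^sup>2)) (at v)"
      by (rule DERIV_chain2[OF DERIV_gauss_int])
        (use that in \<open>auto intro!: derivative_eq_intros simp: power2_eq_square\<close>)
    have e1: "exp (- (a * v - b / v)\<^sup>2) * exp (- (2 * a * b)) = ?f v"
      using that by (simp add: power2_eq_square field_simps flip: exp_add)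
    have e2: "exp (- (a * v + b / v)\<^sup>2) * exp (2 * a * b) = ?f v"
      using that by (simp add: power2_eq_square field_simps flip: exp_add)
    have "(F has_real_derivative (exp (- (a * v - b / v)\<^sup>2) * (a + b / v\<^sup>2) * exp (- (2 * a * b))
         + exp (- (a * v + b / v)\<^sup>2) * (a - b / v\<^sup>2) * exp (2 * a * b)) / (2 * a)) (at v)"
      unfolding F_def by (intro DERIV_cdivide DERIV_add DERIV_cmult_right D1 D2)
    also have "exp (- (a * v - b / v)\<^sup>2) * (a + b / v\<^sup>2) * exp (- (2 * a * b))
         + exp (- (a * v + b / v)\<^sup>2) * (a - b / v\<^sup>2) * exp (2 * a * b)
       = (a + b / v\<^sup>2) * (exp (- (a * v - b / v)\<^sup>2) * exp (- (2 * a * b)))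
         + (a - b / v\<^sup>2) * (exp (- (a * v + b / v)\<^sup>2) * exp (2 * a * b))"
      by (simp only: mult_ac)
    also have "\<dots> = 2 * a * ?f v" unfolding e1 e2 by (simp only: distrib_right[symmetric]) simp
    finally show ?thesis using a by simp
  qed
  let ?A = "(- (sqrt pi / 2) * exp (- (2 * a * b)) + sqrt pi / 2 * exp (2 * a * b)) / (2 * a)"
  let ?B = "(sqrt pi / 2 * exp (- (2 * a * b)) + sqrt pi / 2 * exp (2 * a * b)) / (2 * a)"
  have lims: "filterlim (\<lambda>v. a * v - b / v) at_bot (at_right 0)" "filterlim (\<lambda>v. a * v + b / v) at_top (at_right 0)"
     "filterlim (\<lambda>v. a * v - b / v) at_top at_top" "filterlim (\<lambda>v. a * v + b / v) at_top at_top"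
    using a b by real_asymp+
  have A: "(F \<longlongrightarrow> ?A) (at_right 0)" and B: "(F \<longlongrightarrow> ?B) at_top"
    unfolding F_def
    by (intro tendsto_intros filterlim_compose[OF gauss_int_at_bot] filterlim_compose[OF gauss_int_at_top] lims; use a in simp)+
  have cont: "isCont ?f v" if "v > 0" for v
    using that by (intro continuous_intros) auto
  have FTC: "set_integrable lborel (einterval 0 \<infinity>) ?f" "(LBINT v=0..\<infinity>. ?f v) = ?B - ?A"
    using A B DF cont unfolding zero_ereal_def
    by (intro interval_integral_FTC_nonneg[where F=F]; simp add: ereal_tendsto_simps)+
  have BA: "?B - ?A = sqrt pi / (2 * a) * exp (- (2 * a * b))" using a by (simp add: field_simps)
  have ein: "einterval 0 \<infinity> = {0<..}" by (simp add: einterval_eq zero_ereal_def)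
  show ?thesis
    using FTC(1) FTC(2)[unfolded BA interval_lebesgue_integral_0_infty]
    unfolding has_bochner_integral_iff set_integrable_def set_lebesgue_integral_def ein by blast
qed

lemma holomorphic_integral:
  fixes F :: "complex \<Rightarrow> 'b \<Rightarrow> complex"
  assumes S: "open S"
    and hol: "\<And>y. y \<in> space M \<Longrightarrow> (\<lambda>z. F z y) holomorphic_on S"
    and meas: "\<And>z. z \<in> S \<Longrightarrow> F z \<in> borel_measurable M"
    and g: "integrable M g" and le: "\<And>z y. z \<in> S \<Longrightarrow> y \<in> space M \<Longrightarrow> cmod (F z y) \<le> g y"
  shows "(\<lambda>z. \<integral>y. F z y \<partial>M) holomorphic_on S"
proof (unfold holomorphic_on_open[OF S], intro ballI)
  fix z0 assume z0: "z0 \<in> S"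
  obtain e where e: "e > 0" "cball z0 e \<subseteq> S" using S z0 open_contains_cball_eq by blast
  define r where "r = e / 2"
  have r: "r > 0" using e by (simp add: r_def)
  have sub: "cball z r \<subseteq> S" if "z \<in> ball z0 r" for z
  proof -
    have "cball z r \<subseteq> cball z0 e"
      using that by (intro cball_subset_cball_iff[THEN iffD2] disjI1) (simp add: r_def dist_commute)
    with e show ?thesis by blast
  qed
  have int: "integrable M (F z)" if "z \<in> S" for z
    by (rule Bochner_Integration.integrable_bound[OF g meas[OF that]])
      (use le[OF that] in \<open>auto intro: order_trans[OF _ abs_ge_self]\<close>)
  have der: "((\<lambda>z. F z y) has_field_derivative deriv (\<lambda>z. F z y) z) (at z)" if "y \<in> space M" "z \<in> S" for y z
    using hol[OF that(1)] S that(2) by (rule holomorphic_derivI)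
  have lip: "cmod (F z y - F z0 y) \<le> g y / r * cmod (z - z0)" if y: "y \<in> space M" and z: "z \<in> ball z0 r" for y z
  proof (rule field_differentiable_bound[where S="ball z0 r"])
    show "((\<lambda>z. F z y) has_field_derivative deriv (\<lambda>z. F z y) w) (at w within ball z0 r)" if "w \<in> ball z0 r" for w
    proof -
      have "w \<in> S" using sub[OF that] r by auto
      from der[OF y this] show ?thesis by (rule has_field_derivative_at_within)
    qed
    show "cmod (deriv (\<lambda>z. F z y) w) \<le> g y / r" if w: "w \<in> ball z0 r" for w
    proof -
      have "cmod ((deriv ^^ 1) (\<lambda>z. F z y) w) \<le> fact 1 * g y / r ^ 1"
      proof (rule Cauchy_inequality[OF _ _ r])
        show "(\<lambda>z. F z y) holomorphic_on ball w r"
          using holomorphic_on_subset[OF hol[OF y]] sub[OF w] ball_subset_cball by blast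
        show "continuous_on (cball w r) (\<lambda>z. F z y)"
          using holomorphic_on_imp_continuous_on[OF holomorphic_on_subset[OF hol[OF y] sub[OF w]]] .
        show "cmod (F x y) \<le> g y" if "cmod (w - x) = r" for x
          using sub[OF w] that y by (intro le) (auto simp: dist_norm)
      qed
      then show ?thesis by simp
    qed
  qed (use z r in auto)
  have lim: "((\<lambda>z. ((\<integral>y. F z y \<partial>M) - (\<integral>y. F z0 y \<partial>M)) / (z - z0)) \<longlongrightarrow> (\<integral>y. deriv (\<lambda>z. F z y) z0 \<partial>M)) (at z0 within ball z0 r)"
    unfolding tendsto_at_iff_sequentially comp_def
  proof (intro allI impI)
    fix X assume X: "\<forall>i. X i \<in> ball z0 r - {z0}" "X \<longlonglongrightarrow> z0"
    have XS: "X i \<in> S" for i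
    proof -
      have "X i \<in> ball z0 r" using X by auto
      from sub[OF this] r show ?thesis by auto
    qed
    have conv: "(\<lambda>i. (F (X i) y - F z0 y) / (X i - z0)) \<longlonglongrightarrow> deriv (\<lambda>z. F z y) z0" if "y \<in> space M" for y
    proof -
      have "((\<lambda>z. (F z y - F z0 y) / (z - z0)) \<longlongrightarrow> deriv (\<lambda>z. F z y) z0) (at z0 within ball z0 r)"
        using has_field_derivative_at_within[OF der[OF that z0]] unfolding has_field_derivative_iff .
      with X show ?thesis unfolding tendsto_at_iff_sequentially comp_def by blast
    qed
    have mF: "F (X i) \<in> borel_measurable M" "F z0 \<in> borel_measurable M" for i using meas XS z0 by auto
    have "(\<lambda>i. \<integral>y. (F (X i) y - F z0 y) / (X i - z0) \<partial>M) \<longlonglongrightarrow> (\<integral>y. deriv (\<lambda>z. F z y) z0 \<partial>M)"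
    proof (rule integral_dominated_convergence[where w="\<lambda>y. g y / r"])
      show m: "(\<lambda>y. (F (X i) y - F z0 y) / (X i - z0)) \<in> borel_measurable M" for i
        using mF(1)[of i] mF(2) by measurable
      show "(\<lambda>y. deriv (\<lambda>z. F z y) z0) \<in> borel_measurable M"
        by (rule borel_measurable_LIMSEQ_metric[OF m conv])
      show "AE y in M. cmod ((F (X i) y - F z0 y) / (X i - z0)) \<le> g y / r" for i
      proof (rule AE_I2)
        fix y assume y: "y \<in> space M"
        have "X i \<noteq> z0" "X i \<in> ball z0 r" using X by auto
        with lip[OF y this(2)] show "cmod ((F (X i) y - F z0 y) / (X i - z0)) \<le> g y / r"
          by (simp add: norm_divide divide_le_eq)
      qed
    qed (use conv g in auto)
    moreover have "(\<integral>y. (F (X i) y - F z0 y) / (X i - z0) \<partial>M) = ((\<integral>y. F (X i) y \<partial>M) - (\<integral>y. F z0 y \<partial>M)) / (X i - z0)" for i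
      by (simp only: integral_divide_zero Bochner_Integration.integral_diff[OF int[OF XS] int[OF z0]])
    ultimately show "(\<lambda>i. ((\<integral>y. F (X i) y \<partial>M) - (\<integral>y. F z0 y \<partial>M)) / (X i - z0)) \<longlonglongrightarrow> (\<integral>y. deriv (\<lambda>z. F z y) z0 \<partial>M)"
      by (simp only:)
  qed
  have "((\<lambda>z. \<integral>y. F z y \<partial>M) has_field_derivative (\<integral>y. deriv (\<lambda>z. F z y) z0 \<partial>M)) (at z0 within ball z0 r)"
    unfolding has_field_derivative_iff by (rule lim)
  moreover have "at z0 within ball z0 r = at z0" using r by (intro at_within_open) auto
  ultimately show "\<exists>f'. ((\<lambda>z. \<integral>y. F z y \<partial>M) has_field_derivative f') (at z0)" by auto
qed

section \<open>The wave away from the light cone\<close>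

definition far_weight :: "nat \<Rightarrow> real \<Rightarrow> real"
  where "far_weight d v = (v / (2 * sqrt pi)) ^ d * exp (- (v\<^sup>2) / 4) * indicator {0<..} v"

lemma far_weight_nonneg: "far_weight d v \<ge> 0"
  by (auto simp: far_weight_def indicator_def)

lemma far_weight_measurable [measurable]: "far_weight d \<in> borel_measurable borel"
  unfolding far_weight_def[abs_def] by measurable

lemma integrable_far_weight: "integrable lborel (far_weight d)"
proof -
  have "integrable lborel (\<lambda>v. ((1 / (2 * sqrt pi)) ^ d * sqrt (4 * pi)) * (normal_density 0 (sqrt 2) v * \<bar>v - 0\<bar> ^ d))"
    by (intro integrable_mult_right integrable_normal_moment_abs) simp
  then show ?thesis
  proof (rule Bochner_Integration.integrable_bound)
    show "AE v in lborel. norm (far_weight d v)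
       \<le> norm ((1 / (2 * sqrt pi)) ^ d * sqrt (4 * pi) * (normal_density 0 (sqrt 2) v * \<bar>v - 0\<bar> ^ d))"
      by (intro AE_I2) (auto simp: far_weight_def normal_density_def indicator_def abs_mult power_divide power_mult_distrib mult_ac)
  qed simp
qed

definition far_kernel :: "'a::euclidean_space \<Rightarrow> real"
  where "far_kernel z = (\<integral>v. far_weight DIM('a) v * exp (- (v\<^sup>2 * (norm z)\<^sup>2 / 8)) \<partial>lborel) / sqrt pi"

definition half_plane_wave :: "('a::euclidean_space \<Rightarrow> complex) \<Rightarrow> 'a \<Rightarrow> complex \<Rightarrow> complex"
  where "half_plane_wave f x \<tau> = (\<integral>\<xi>. cis (x \<bullet> \<xi>) * exp (- \<tau> * of_real (norm \<xi>)) * fourier f \<xi> \<partial>lborel)"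

lemma half_plane_wave_imaginary:
  fixes f :: "'a::euclidean_space \<Rightarrow> complex"
  shows "wave t f x = half_plane_wave f x (- \<i> * of_real t) /\<^sub>R (2 * pi) ^ DIM('a)"
proof -
  have "cis (x \<bullet> \<xi> + t * norm \<xi>) = cis (x \<bullet> \<xi>) * exp (- (- \<i> * of_real t) * of_real (norm \<xi>))" for \<xi>
    unfolding cis_mult[symmetric] by (simp add: cis_conv_exp mult.assoc)
  then show ?thesis unfolding wave_def half_plane_wave_def by simp
qed

lemma
  fixes f :: "'a::euclidean_space \<Rightarrow> complex"
  assumes ff: "integrable lborel (fourier f)"
  shows continuous_on_half_plane_wave: "continuous_on {\<tau>. Re \<tau> \<ge> 0} (half_plane_wave f x)"
    and holomorphic_half_plane_wave: "half_plane_wave f x holomorphic_on {\<tau>. Re \<tau> > 0}"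
proof -
  have [measurable]: "fourier f \<in> borel_measurable borel" using ff by auto
  have le: "cmod (cis (x \<bullet> \<xi>) * exp (- \<tau> * of_real (norm \<xi>)) * fourier f \<xi>) \<le> cmod (fourier f \<xi>)" if "Re \<tau> \<ge> 0" for \<tau> \<xi>
    using that by (simp add: norm_mult mult_left_le_one_le)
  show "continuous_on {\<tau>. Re \<tau> \<ge> 0} (half_plane_wave f x)"
    unfolding half_plane_wave_def[abs_def]
    by (rule continuous_on_integral_dominated[where g="\<lambda>\<xi>. cmod (fourier f \<xi>)"])
      (use ff le in \<open>auto intro!: continuous_intros simp del: norm_mult\<close>)
  show "half_plane_wave f x holomorphic_on {\<tau>. Re \<tau> > 0}"
    unfolding half_plane_wave_def[abs_def]
    by (rule holomorphic_integral[where g="\<lambda>\<xi>. cmod (fourier f \<xi>)"])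
      (use ff le in \<open>auto intro!: holomorphic_intros simp: open_halfspace_Re_gt simp del: norm_mult\<close>)
qed

definition poisson_far :: "('a::euclidean_space \<Rightarrow> complex) \<Rightarrow> 'a \<Rightarrow> complex \<Rightarrow> real \<times> 'a \<Rightarrow> complex"
  where "poisson_far f x \<tau> = (\<lambda>(v, y). of_real ((v / (2 * sqrt pi)) ^ DIM('a) * indicator {0<..} v) *
    exp (- (\<tau>\<^sup>2 * of_real (v\<^sup>2 / 4))) * of_real (exp (- (v\<^sup>2) * (norm (x - y))\<^sup>2 / 4)) * f y)"

lemma poisson_far_bound:
  fixes f :: "'a::euclidean_space \<Rightarrow> complex"
  assumes far: "\<And>y. norm (x - y) < 2 \<Longrightarrow> f y = 0" and \<tau>: "cmod \<tau> < 1"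
  shows "cmod (poisson_far f x \<tau> (v, y)) \<le> far_weight DIM('a) v * exp (- (v\<^sup>2 * (norm (x - y))\<^sup>2 / 8)) * cmod (f y)"
proof (cases "f y = 0 \<or> v \<le> 0")
  case False
  then have \<rho>: "2\<^sup>2 \<le> (norm (x - y))\<^sup>2" using far by (intro power_mono) (auto simp: not_le[symmetric])
  have "\<bar>Re (\<tau>\<^sup>2)\<bar> \<le> (cmod \<tau>)\<^sup>2" using abs_Re_le_cmod[of "\<tau>\<^sup>2"] by (simp add: norm_power)
  also have "\<dots> \<le> 1" using \<tau> by (simp add: power_le_one)
  finally have "- Re (\<tau>\<^sup>2) \<le> 1" by simp
  then have "- Re (\<tau>\<^sup>2) - (norm (x - y))\<^sup>2 \<le> - 1 - (norm (x - y))\<^sup>2 / 2" using \<rho> by simp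
  then have "(v\<^sup>2 / 4) * (- Re (\<tau>\<^sup>2) - (norm (x - y))\<^sup>2) \<le> (v\<^sup>2 / 4) * (- 1 - (norm (x - y))\<^sup>2 / 2)"
    by (rule mult_left_mono) simp
  then have "exp (- (Re (\<tau>\<^sup>2) * (v\<^sup>2 / 4))) * exp (- (v\<^sup>2) * (norm (x - y))\<^sup>2 / 4)
     \<le> exp (- (v\<^sup>2) / 4) * exp (- (v\<^sup>2 * (norm (x - y))\<^sup>2 / 8))"
    unfolding exp_add[symmetric] by (simp add: algebra_simps)
  then have "((v / (2 * sqrt pi)) ^ DIM('a) * cmod (f y)) * (exp (- (Re (\<tau>\<^sup>2) * (v\<^sup>2 / 4))) * exp (- (v\<^sup>2) * (norm (x - y))\<^sup>2 / 4))
     \<le> ((v / (2 * sqrt pi)) ^ DIM('a) * cmod (f y)) * (exp (- (v\<^sup>2) / 4) * exp (- (v\<^sup>2 * (norm (x - y))\<^sup>2 / 8)))"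
    using False by (intro mult_left_mono) auto
  moreover have "cmod (poisson_far f x \<tau> (v, y)) = ((v / (2 * sqrt pi)) ^ DIM('a) * cmod (f y)) * (exp (- (Re (\<tau>\<^sup>2) * (v\<^sup>2 / 4))) * exp (- (v\<^sup>2) * (norm (x - y))\<^sup>2 / 4))"
    using False unfolding poisson_far_def prod.case norm_mult norm_exp_eq_Re norm_of_real
    by (simp add: abs_mult)
  ultimately show ?thesis using False by (simp add: far_weight_def mult_ac)
qed (auto simp: poisson_far_def far_weight_def)

lemma poisson_far_measurable:
  fixes f :: "'a::euclidean_space \<Rightarrow> complex"
  assumes [measurable]: "f \<in> borel_measurable borel"
  shows "poisson_far f x \<tau> \<in> borel_measurable (lborel \<Otimes>\<^sub>M lborel)"
  unfolding poisson_far_def by measurable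

lemma integrable_far_product:
  fixes f :: "'a::euclidean_space \<Rightarrow> complex"
  assumes f: "integrable lborel f"
  shows "integrable (lborel \<Otimes>\<^sub>M lborel)
    (\<lambda>(v, y). far_weight DIM('a) v * exp (- (v\<^sup>2 * (norm (x - y))\<^sup>2 / 8)) * cmod (f y))"
proof -
  have [measurable]: "f \<in> borel_measurable borel" using f by auto
  show ?thesis
    by (rule lborel_pair.integrable_product_bound[OF integrable_far_weight[of "DIM('a)"] integrable_norm[OF f]])
      (auto simp: abs_mult far_weight_nonneg intro!: mult_right_mono mult_left_le)
qed

lemma integrable_poisson_far:
  fixes f :: "'a::euclidean_space \<Rightarrow> complex"
  assumes f: "integrable lborel f" and far: "\<And>y. norm (x - y) < 2 \<Longrightarrow> f y = 0" and \<tau>: "cmod \<tau> < 1"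
  shows "integrable (lborel \<Otimes>\<^sub>M lborel) (poisson_far f x \<tau>)"
proof (rule Bochner_Integration.integrable_bound[OF integrable_far_product[OF f, of x] poisson_far_measurable])
  show "AE p in lborel \<Otimes>\<^sub>M lborel. cmod (poisson_far f x \<tau> p)
      \<le> norm (case p of (v, y) \<Rightarrow> far_weight DIM('a) v * exp (- (v\<^sup>2 * (norm (x - y))\<^sup>2 / 8)) * cmod (f y))"
    using poisson_far_bound[OF far \<tau>] by (intro AE_I2) (auto intro!: order_trans[OF _ abs_ge_self])
qed (use f in auto)

lemma half_plane_wave_eq_poisson_far:
  fixes f :: "'a::euclidean_space \<Rightarrow> complex"
  assumes f: "integrable lborel f" and ff: "integrable lborel (fourier f)"
    and far: "\<And>y. norm (x - y) < 2 \<Longrightarrow> f y = 0" and \<tau>: "0 < \<tau>" "\<tau> < 1"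
  shows "half_plane_wave f x (of_real \<tau>) =
    of_real ((2 * pi) ^ DIM('a)) * (of_real \<tau> / of_real (sqrt pi) * (\<integral>p. poisson_far f x (of_real \<tau>) p \<partial>(lborel \<Otimes>\<^sub>M lborel)))"
proof -
  have [measurable]: "f \<in> borel_measurable borel" "fourier f \<in> borel_measurable borel" using f ff by auto
  have intP: "integrable (lborel \<Otimes>\<^sub>M lborel) (poisson_far f x (of_real \<tau>))"
    by (rule integrable_poisson_far[OF f far]) (use \<tau> in auto)
  define G where "G = (\<lambda>v \<xi>::'a. of_real (indicator {0<..} v * exp (- (\<tau>\<^sup>2 * v\<^sup>2 / 4)) * exp (- ((norm \<xi>)\<^sup>2) / v\<^sup>2)) * (cis (x \<bullet> \<xi>) * fourier f \<xi>))"
  have inner: "of_real ((2 * pi) ^ DIM('a)) * (\<integral>y. poisson_far f x (of_real \<tau>) (v, y) \<partial>lborel) = (\<integral>\<xi>. G v \<xi> \<partial>lborel)" for v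
  proof (cases "v > 0")
    case True
    have e: "exp (- ((of_real \<tau>)\<^sup>2 * of_real (v\<^sup>2 / 4))) = complex_of_real (exp (- (\<tau>\<^sup>2 * v\<^sup>2 / 4)))"
      by (simp flip: exp_of_real)
    have pw: "poisson_far f x (of_real \<tau>) (v, y) = of_real (exp (- (\<tau>\<^sup>2 * v\<^sup>2 / 4))) *
        (of_real ((v / (2 * sqrt pi)) ^ DIM('a) * exp (- (v\<^sup>2) * (norm (x - y))\<^sup>2 / 4)) * f y)" for y
      using True unfolding poisson_far_def prod.case e by simp
    have "of_real ((2 * pi) ^ DIM('a)) * (\<integral>y. poisson_far f x (of_real \<tau>) (v, y) \<partial>lborel)
      = of_real ((2 * pi) ^ DIM('a)) * (\<integral>y. of_real (exp (- (\<tau>\<^sup>2 * v\<^sup>2 / 4))) * (of_real ((v / (2 * sqrt pi)) ^ DIM('a) * exp (- (v\<^sup>2) * (norm (x - y))\<^sup>2 / 4)) * f y) \<partial>lborel)"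
      unfolding pw ..
    also have "\<dots> = of_real (exp (- (\<tau>\<^sup>2 * v\<^sup>2 / 4))) * (\<integral>\<xi>. cis (x \<bullet> \<xi>) * of_real (exp (- ((norm \<xi>)\<^sup>2) / v\<^sup>2)) * fourier f \<xi> \<partial>lborel)"
      unfolding heat_fourier[OF f True] integral_mult_right_zero by (simp only: mult_ac)
    also have "\<dots> = (\<integral>\<xi>. G v \<xi> \<partial>lborel)"
      using True by (simp add: G_def mult_ac flip: integral_mult_right_zero)
    finally show ?thesis .
  qed (simp add: poisson_far_def G_def)
  have gaus: "integrable lborel (\<lambda>v::real. exp (- (\<tau>\<^sup>2 * v\<^sup>2 / 4)))"
    using integrable_gaussian_real[of "2 / \<tau>"] \<tau> by (simp add: power_divide mult.commute)
  have intG: "integrable (lborel \<Otimes>\<^sub>M lborel) (case_prod G)"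
    by (rule lborel_pair.integrable_product_bound[OF gaus integrable_norm[OF ff]])
      (auto simp: G_def norm_mult indicator_def intro!: mult_left_le_one_le)
  have "of_real ((2 * pi) ^ DIM('a)) * (\<integral>p. poisson_far f x (of_real \<tau>) p \<partial>(lborel \<Otimes>\<^sub>M lborel))
    = of_real ((2 * pi) ^ DIM('a)) * (\<integral>v. \<integral>y. poisson_far f x (of_real \<tau>) (v, y) \<partial>lborel \<partial>lborel)"
    by (simp only: lborel_pair.integral_fst'[OF intP])
  also have "\<dots> = (\<integral>v. \<integral>\<xi>. G v \<xi> \<partial>lborel \<partial>lborel)"
    unfolding inner[symmetric] by (simp only: integral_mult_right_zero)
  also have "\<dots> = (\<integral>\<xi>. \<integral>v. G v \<xi> \<partial>lborel \<partial>lborel)"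
    by (rule lborel_pair.Fubini_integral[OF intG, symmetric])
  also have "\<dots> = (\<integral>\<xi>. of_real (sqrt pi / \<tau>) * (cis (x \<bullet> \<xi>) * exp (- of_real \<tau> * of_real (norm \<xi>)) * fourier f \<xi>) \<partial>lborel)"
  proof (rule integral_cong_AE)
    show "(\<lambda>\<xi>. \<integral>v. G v \<xi> \<partial>lborel) \<in> borel_measurable lborel"
      unfolding G_def by measurable
    have "AE \<xi> in lborel. \<xi> \<noteq> (0::'a)" by (rule AE_lborel_singleton)
    then show "AE \<xi> in lborel. (\<integral>v. G v \<xi> \<partial>lborel)
       = of_real (sqrt pi / \<tau>) * (cis (x \<bullet> \<xi>) * exp (- of_real \<tau> * of_real (norm \<xi>)) * fourier f \<xi>)"
    proof eventually_elim
      case (elim \<xi>)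
      have "(\<integral>v. G v \<xi> \<partial>lborel) = of_real (\<integral>v. indicator {0<..} v * exp (- (\<tau>\<^sup>2 * v\<^sup>2 / 4)) * exp (- ((norm \<xi>)\<^sup>2) / v\<^sup>2) \<partial>lborel) * (cis (x \<bullet> \<xi>) * fourier f \<xi>)"
        unfolding G_def by (simp only: integral_mult_left_zero integral_complex_of_real)
      also have "(\<integral>v. indicator {0<..} v * exp (- (\<tau>\<^sup>2 * v\<^sup>2 / 4)) * exp (- ((norm \<xi>)\<^sup>2) / v\<^sup>2) \<partial>lborel)
         = sqrt pi / \<tau> * exp (- (\<tau> * norm \<xi>))"
        using has_bochner_integral_integral_eq[OF subordination[of "\<tau> / 2" "norm \<xi>"]] \<tau> elim
        by (simp add: power_divide mult.assoc flip: exp_add)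
      finally show ?case by (simp add: mult_ac flip: exp_of_real)
    qed
  qed measurable
  also have "\<dots> = of_real (sqrt pi / \<tau>) * half_plane_wave f x (of_real \<tau>)"
    unfolding half_plane_wave_def by (simp only: integral_mult_right_zero)
  finally show ?thesis using \<tau> by (simp add: field_simps)
qed

text \<open>Both sides of the previous lemma are holomorphic in \<open>\<tau>\<close> in the right half of the unit disc,
  and the boundary value of the left-hand side at \<open>\<tau> = -it\<close> is the wave at time \<open>t\<close>.\<close>

lemma wave_eq_poisson_far:
  fixes f :: "'a::euclidean_space \<Rightarrow> complex"
  assumes f: "integrable lborel f" and ff: "integrable lborel (fourier f)"
    and far: "\<And>y. norm (x - y) < 2 \<Longrightarrow> f y = 0" and t: "0 < t" "t < 1"
  shows "wave t f x = - \<i> * of_real t / of_real (sqrt pi) * (\<integral>p. poisson_far f x (- \<i> * of_real t) p \<partial>(lborel \<Otimes>\<^sub>M lborel))"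
proof -
  have [measurable]: "f \<in> borel_measurable borel" using f by auto
  define V where "V = (\<lambda>\<tau>. of_real ((2 * pi) ^ DIM('a)) * (\<tau> / of_real (sqrt pi) * (\<integral>p. poisson_far f x \<tau> p \<partial>(lborel \<Otimes>\<^sub>M lborel))))"
  let ?S = "{\<tau>. Re \<tau> > 0} \<inter> ball 0 1"
  have "(\<lambda>\<tau>. \<integral>p. poisson_far f x \<tau> p \<partial>(lborel \<Otimes>\<^sub>M lborel)) holomorphic_on ball 0 1"
  proof (rule holomorphic_integral[OF open_ball _ _ integrable_far_product[OF f, of x]])
    show "(\<lambda>\<tau>. poisson_far f x \<tau> p) holomorphic_on ball 0 1" for p
      unfolding poisson_far_def by (cases p) (auto intro!: holomorphic_intros)
    show "poisson_far f x \<tau> \<in> borel_measurable (lborel \<Otimes>\<^sub>M lborel)" for \<tau>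
      by (rule poisson_far_measurable) measurable
    show "cmod (poisson_far f x \<tau> p) \<le> (case p of (v, y) \<Rightarrow> far_weight DIM('a) v * exp (- (v\<^sup>2 * (norm (x - y))\<^sup>2 / 8)) * cmod (f y))"
      if "\<tau> \<in> ball 0 1" for \<tau> p
      using poisson_far_bound[OF far] that by (cases p) auto
  qed
  then have Vhol: "V holomorphic_on ball 0 1" unfolding V_def by (intro holomorphic_intros) auto
  have eq: "half_plane_wave f x \<tau> - V \<tau> = 0" if "\<tau> \<in> ?S" for \<tau>
  proof (rule analytic_continuation[where f="\<lambda>\<tau>. half_plane_wave f x \<tau> - V \<tau>" and S="?S" and U="of_real ` {0<..<1}" and \<xi>="of_real (1/2)"])
    show "(\<lambda>\<tau>. half_plane_wave f x \<tau> - V \<tau>) holomorphic_on ?S"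
      by (intro holomorphic_intros holomorphic_on_subset[OF Vhol] holomorphic_on_subset[OF holomorphic_half_plane_wave[OF ff]]) auto
    show "open ?S" by (intro open_Int open_halfspace_Re_gt open_ball)
    show "connected ?S" by (intro convex_connected convex_Int convex_halfspace_Re_gt convex_ball)
    show "complex_of_real (1/2) islimpt complex_of_real ` {0<..<1}"
      unfolding islimpt_approachable
    proof (intro allI impI bexI conjI)
      fix e :: real assume e: "e > 0"
      let ?d = "min (e / 2) (1 / 4)"
      have d: "complex_of_real (1/2 + ?d) - complex_of_real (1/2) = of_real ?d" by simp
      show "complex_of_real (1/2 + ?d) \<noteq> complex_of_real (1/2)" using e unfolding of_real_eq_iff by simp
      show "dist (complex_of_real (1/2 + ?d)) (complex_of_real (1/2)) < e"
        unfolding dist_norm d norm_of_real using e by (simp add: min_def)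
      show "complex_of_real (1/2 + ?d) \<in> complex_of_real ` {0<..<1}"
        using e by (intro imageI) (simp add: min_def)
    qed
    show "half_plane_wave f x z - V z = 0" if "z \<in> complex_of_real ` {0<..<1}" for z
      using that half_plane_wave_eq_poisson_far[OF f ff far] by (auto simp: V_def)
  qed (use that in auto)
  define h where "h = (\<lambda>n. of_real ((1 - t) / real (Suc (Suc n))) - \<i> * of_real t)"
  have hlim: "h \<longlonglongrightarrow> - \<i> * of_real t"
  proof -
    have "(\<lambda>n. of_real ((1 - t) * (1 / real (Suc (Suc n)))) - \<i> * of_real t) \<longlonglongrightarrow> of_real ((1 - t) * 0) - \<i> * of_real t"
      by (intro tendsto_intros LIMSEQ_Suc[OF LIMSEQ_Suc[OF lim_1_over_n]])
    then show ?thesis by (simp add: h_def[abs_def])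
  qed
  have hS: "h n \<in> ?S" for n
  proof -
    have "(1 - t) / real (Suc (Suc n)) < 1 - t" using t by (simp add: divide_less_eq)
    moreover have "cmod (h n) \<le> (1 - t) / real (Suc (Suc n)) + t"
      unfolding h_def using t by (intro norm_triangle_le_diff) (simp only: norm_mult norm_of_real norm_ii, simp)
    ultimately have "cmod (h n) < 1" by simp
    then show ?thesis using t by (simp add: h_def)
  qed
  have mem: "- \<i> * of_real t \<in> ball 0 1" using t by (simp add: norm_mult)
  have "(\<lambda>n. half_plane_wave f x (h n)) \<longlonglongrightarrow> half_plane_wave f x (- \<i> * of_real t)"
    by (rule continuous_on_tendsto_compose[OF continuous_on_half_plane_wave[OF ff] hlim])
      (use hS in \<open>auto intro!: always_eventually less_imp_le\<close>)
  moreover have "(\<lambda>n. V (h n)) \<longlonglongrightarrow> V (- \<i> * of_real t)"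
    by (rule continuous_on_tendsto_compose[OF holomorphic_on_imp_continuous_on[OF Vhol] hlim mem])
      (use hS in \<open>auto intro!: always_eventually\<close>)
  moreover have "half_plane_wave f x (h n) = V (h n)" for n using eq[OF hS[of n]] by simp
  ultimately have "half_plane_wave f x (- \<i> * of_real t) = V (- \<i> * of_real t)"
    using LIMSEQ_unique by (metis (no_types, lifting) ext)
  then show ?thesis unfolding half_plane_wave_imaginary V_def
    by (simp add: scaleR_conv_of_real field_simps)
qed

lemma wave_far:
  fixes f :: "'a::euclidean_space \<Rightarrow> complex"
  assumes f: "integrable lborel f" and ff: "integrable lborel (fourier f)"
    and far: "\<And>y. norm (x - y) < 2 \<Longrightarrow> f y = 0" and t: "0 < t" "t < 1"
  shows "cmod (wave t f x) \<le> (\<integral>y. far_kernel (x - y) * cmod (f y) \<partial>lborel)"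
    and "integrable lborel (\<lambda>y. far_kernel (x - y) * cmod (f y))"
proof -
  let ?g = "\<lambda>(v, y). far_weight DIM('a) v * exp (- (v\<^sup>2 * (norm (x - y))\<^sup>2 / 8)) * cmod (f y)"
  note g = integrable_far_product[OF f, of x]
  have g0: "?g p \<ge> 0" for p by (auto simp: far_weight_nonneg split: prod.split)
  have k: "far_kernel (x - y) * cmod (f y) = (\<integral>v. ?g (v, y) \<partial>lborel) / sqrt pi" for y
    unfolding far_kernel_def by (simp flip: integral_mult_left_zero)
  show "integrable lborel (\<lambda>y. far_kernel (x - y) * cmod (f y))"
    unfolding k using lborel_pair.integrable_snd[OF g] by (intro integrable_divide) simp
  have \<tau>: "cmod (- \<i> * of_real t) < 1" using t by (simp add: norm_mult)
  have "cmod (\<integral>p. poisson_far f x (- \<i> * of_real t) p \<partial>(lborel \<Otimes>\<^sub>M lborel)) \<le> (\<integral>p. ?g p \<partial>(lborel \<Otimes>\<^sub>M lborel))"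
    by (rule Bochner_Integration.integral_norm_bound_integral[OF integrable_poisson_far[OF f far \<tau>] g])
      (use poisson_far_bound[OF far \<tau>] in auto)
  also have "\<dots> = (\<integral>y. \<integral>v. ?g (v, y) \<partial>lborel \<partial>lborel)"
    using lborel_pair.integral_snd[OF g] by simp
  finally have le: "cmod (\<integral>p. poisson_far f x (- \<i> * of_real t) p \<partial>(lborel \<Otimes>\<^sub>M lborel)) \<le> (\<integral>y. \<integral>v. ?g (v, y) \<partial>lborel \<partial>lborel)" .
  have "cmod (wave t f x) = t / sqrt pi * cmod (\<integral>p. poisson_far f x (- \<i> * of_real t) p \<partial>(lborel \<Otimes>\<^sub>M lborel))"
    by (subst wave_eq_poisson_far[OF f ff far t]) (use t in \<open>auto simp: norm_mult norm_divide\<close>)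
  also have "\<dots> \<le> 1 / sqrt pi * (\<integral>y. \<integral>v. ?g (v, y) \<partial>lborel \<partial>lborel)"
    using t by (intro mult_mono le divide_right_mono) auto
  also have "\<dots> = (\<integral>y. far_kernel (x - y) * cmod (f y) \<partial>lborel)"
    unfolding k by (simp only: integral_divide_zero) simp
  finally show "cmod (wave t f x) \<le> (\<integral>y. far_kernel (x - y) * cmod (f y) \<partial>lborel)" .
qed

section \<open>Sobolev norms of localized functions\<close>

lemma ennpowr_ennreal: "a \<ge> 0 \<Longrightarrow> ennpowr (ennreal a) p = ennreal (a powr p)"
  by (simp add: ennpowr_def)

lemma ennpowr_measurable [measurable]: "(\<lambda>x. ennpowr x p) \<in> borel_measurable borel"
  unfolding ennpowr_def[abs_def] by measurable

lemma ennpowr_mono: "x \<le> y \<Longrightarrow> p > 0 \<Longrightarrow> ennpowr x p \<le> ennpowr y p"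
  unfolding ennpowr_def
  by (auto simp: top_unique less_top[symmetric] intro!: ennreal_leI powr_mono2 enn2real_mono)

lemma ennpowr_inverse_le_iff:
  assumes p: "p > 0" and a: "a \<ge> 0"
  shows "ennpowr x (1 / p) \<le> ennreal a \<longleftrightarrow> x \<le> ennreal (a powr p)"
proof (cases x)
  case (real r)
  have "r powr (1 / p) \<le> a \<longleftrightarrow> r \<le> a powr p"
  proof
    assume "r powr (1 / p) \<le> a"
    then have "(r powr (1 / p)) powr p \<le> a powr p" using p by (intro powr_mono2) auto
    then show "r \<le> a powr p" using p real by (simp add: powr_powr)
  next
    assume "r \<le> a powr p"
    then have "r powr (1 / p) \<le> (a powr p) powr (1 / p)" using p real by (intro powr_mono2) auto
    then show "r powr (1 / p) \<le> a" using p a by (simp add: powr_powr)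
  qed
  then show ?thesis using real a by (simp add: ennpowr_ennreal ennreal_le_iff)
qed (auto simp: ennpowr_def top_unique)

lemma ennpowr_add_le:
  assumes h: "h \<ge> 0" and q: "q > 0"
  shows "ennpowr (x + ennreal h) q \<le> ennreal (2 powr q) * (ennpowr x q + ennreal (h powr q))"
proof (cases x)
  case (real r)
  have "(r + h) powr q \<le> (2 * max r h) powr q" using q h real by (intro powr_mono2) auto
  also have "\<dots> = 2 powr q * max r h powr q" using h by (simp add: powr_mult)
  also have "\<dots> \<le> 2 powr q * (r powr q + h powr q)" by (intro mult_left_mono) (auto simp: max_def)
  finally show ?thesis using real h
    by (simp add: ennpowr_ennreal flip: ennreal_plus ennreal_mult)
qed (simp add: ennpowr_def ennreal_mult_top)

lemma nn_integral_powr_le: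
  fixes P :: "'b \<Rightarrow> real"
  assumes [measurable]: "P \<in> borel_measurable M" and P0: "\<And>x. P x \<ge> 0" and PA: "\<And>x. P x \<le> A" and A: "A \<ge> 0"
    and int: "(\<integral>\<^sup>+x. ennreal (P x) \<partial>M) \<le> ennreal A" and p: "p \<ge> 1"
  shows "(\<integral>\<^sup>+x. ennreal (P x powr p) \<partial>M) \<le> ennreal (A powr p)"
proof -
  have split: "a powr p = a powr (p - 1) * a" if "a \<ge> 0" for a :: real
    using that p by (cases "a = 0") (auto simp: powr_diff)
  have "(\<integral>\<^sup>+x. ennreal (P x powr p) \<partial>M) \<le> (\<integral>\<^sup>+x. ennreal (A powr (p - 1)) * ennreal (P x) \<partial>M)"
    using P0 PA p by (intro nn_integral_mono)
      (auto simp: split[OF P0] simp flip: ennreal_mult intro!: ennreal_leI mult_right_mono powr_mono2)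
  also have "\<dots> \<le> ennreal (A powr (p - 1)) * ennreal A"
    by (subst nn_integral_cmult) (auto intro!: mult_left_mono int)
  also have "\<dots> = ennreal (A powr p)" using A by (simp add: split flip: ennreal_mult)
  finally show ?thesis .
qed

lemma nn_integral_convolution:
  fixes k h :: "'a::euclidean_space \<Rightarrow> ennreal"
  assumes [measurable]: "k \<in> borel_measurable borel" "h \<in> borel_measurable borel"
  shows "(\<integral>\<^sup>+x. \<integral>\<^sup>+y. k (x - y) * h y \<partial>lborel \<partial>lborel) = (\<integral>\<^sup>+x. k x \<partial>lborel) * (\<integral>\<^sup>+y. h y \<partial>lborel)"
proof -
  have "(\<integral>\<^sup>+x. \<integral>\<^sup>+y. k (x - y) * h y \<partial>lborel \<partial>lborel) = (\<integral>\<^sup>+y. \<integral>\<^sup>+x. k (x - y) * h y \<partial>lborel \<partial>lborel)"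
    by (rule lborel_pair.Fubini'[symmetric]) measurable
  also have "\<dots> = (\<integral>\<^sup>+y. (\<integral>\<^sup>+x. k x \<partial>lborel) * h y \<partial>lborel)"
  proof (intro nn_integral_cong)
    fix y
    have "(\<integral>\<^sup>+x. k (x - y) \<partial>lborel) = (\<integral>\<^sup>+x. k x \<partial>lborel)"
      using nn_integral_lborel_translation[of k "- y"] by simp
    then show "(\<integral>\<^sup>+x. k (x - y) * h y \<partial>lborel) = (\<integral>\<^sup>+x. k x \<partial>lborel) * h y"
      by (subst nn_integral_multc) auto
  qed
  also have "\<dots> = (\<integral>\<^sup>+x. k x \<partial>lborel) * (\<integral>\<^sup>+y. h y \<partial>lborel)"
    by (rule nn_integral_cmult) measurable
  finally show ?thesis .
qed

lemma convolution_Cauchy_Schwarz: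
  fixes k h :: "'a::euclidean_space \<Rightarrow> real"
  assumes [measurable]: "k \<in> borel_measurable borel" "h \<in> borel_measurable borel"
    and k0: "\<And>x. k x \<ge> 0" and h0: "\<And>x. h x \<ge> 0"
  shows "(\<integral>\<^sup>+y. ennreal (k (x - y) * h y) \<partial>lborel)\<^sup>2
    \<le> (\<integral>\<^sup>+y. ennreal (k y) \<partial>lborel) * (\<integral>\<^sup>+y. ennreal (k (x - y)) * ennreal ((h y)\<^sup>2) \<partial>lborel)"
proof -
  let ?a = "\<lambda>y. ennreal (sqrt (k (x - y)))" and ?b = "\<lambda>y. ennreal (sqrt (k (x - y)) * h y)"
  have "(\<integral>\<^sup>+y. ennreal (k (x - y) * h y) \<partial>lborel)\<^sup>2 = (\<integral>\<^sup>+y. ?a y * ?b y \<partial>lborel)\<^sup>2"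
    using k0 h0 by (simp flip: ennreal_mult mult.assoc)
  also have "\<dots> \<le> (\<integral>\<^sup>+y. ?a y ^ 2 \<partial>lborel) * (\<integral>\<^sup>+y. ?b y ^ 2 \<partial>lborel)"
    by (rule Cauchy_Schwarz_nn_integral) measurable
  also have "(\<integral>\<^sup>+y. ?a y ^ 2 \<partial>lborel) = (\<integral>\<^sup>+y. ennreal (k (x - y)) \<partial>lborel)"
    using k0 by (simp add: ennreal_power)
  also have "\<dots> = (\<integral>\<^sup>+y. ennreal (k y) \<partial>lborel)"
    by (rule nn_integral_lborel_reflect) measurable
  also have "(\<integral>\<^sup>+y. ?b y ^ 2 \<partial>lborel) = (\<integral>\<^sup>+y. ennreal (k (x - y)) * ennreal ((h y)\<^sup>2) \<partial>lborel)"
    using k0 h0 by (simp add: ennreal_power power_mult_distrib flip: ennreal_mult)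
  finally show ?thesis .
qed

definition sobolev_sq :: "real \<Rightarrow> ('a::euclidean_space \<Rightarrow> complex) \<Rightarrow> real"
  where "sobolev_sq s f = (\<integral>\<xi>. (1 + (norm \<xi>)\<^sup>2) powr s * (cmod (fourier f \<xi>))\<^sup>2 \<partial>lborel)"

lemma sobolev_sq_nonneg: "sobolev_sq s f \<ge> 0"
  unfolding sobolev_sq_def by (intro integral_nonneg_AE) auto

lemma ennreal_sobolev_sq:
  fixes f :: "'a::euclidean_space \<Rightarrow> complex"
  assumes "schwartz f"
  shows "ennreal (sobolev_sq s f) = (\<integral>\<^sup>+\<xi>. ennreal ((1 + (norm \<xi>)\<^sup>2) powr s * (cmod (fourier f \<xi>))\<^sup>2) \<partial>lborel)"
  unfolding sobolev_sq_def
  by (intro nn_integral_eq_integral[symmetric] rapid_integrable_weight_sq fourier_rapid assms) auto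

lemma sobolev_norm_eq:
  fixes f :: "'a::euclidean_space \<Rightarrow> complex"
  assumes f: "schwartz f"
  shows "sobolev_norm s f = ennreal (sqrt (sobolev_sq s f / (2 * pi) ^ DIM('a)))"
proof -
  define G where "G = (\<lambda>\<xi>::'a. of_real ((1 + (norm \<xi>)\<^sup>2) powr (s / 2)) * fourier f \<xi>)"
  have G: "rapid G" unfolding G_def by (intro rapid_mult_weight fourier_rapid f)
  note Gi = rapid_integrable[OF G]
  obtain B where B: "\<And>x. cmod (G x) \<le> B" using rapid_bounded[OF G] by metis
  have [measurable]: "fourier G \<in> borel_measurable borel" by (rule borel_measurable_fourier[OF Gi])
  let ?c = "(2 * pi) ^ DIM('a)"
  have c: "?c > 0" by simp
  have bes: "bessel s f x = fourier G (- x) /\<^sub>R ?c" for x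
    unfolding bessel_def fourier_def G_def by (simp add: inner_commute mult.assoc)
  have G2: "(cmod (G \<xi>))\<^sup>2 = (1 + (norm \<xi>)\<^sup>2) powr s * (cmod (fourier f \<xi>))\<^sup>2" for \<xi>
    unfolding G_def by (simp add: norm_mult power_mult_distrib flip: powr_power) (simp add: power2_eq_square flip: powr_add)
  have "(\<integral>\<^sup>+x. ennreal ((cmod (fourier G (- x)))\<^sup>2) \<partial>lborel) = (\<integral>\<^sup>+x. ennreal ((cmod (fourier G x))\<^sup>2) \<partial>lborel)"
    using nn_integral_lborel_reflect[of "\<lambda>x. ennreal ((cmod (fourier G x))\<^sup>2)" 0] by simp
  also have "\<dots> = ennreal ?c * ennreal (sobolev_sq s f)"
    unfolding plancherel[OF Gi rapid_continuous[OF G] B] G2 ennreal_sobolev_sq[OF f] ..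
  finally have P: "(\<integral>\<^sup>+x. ennreal ((cmod (fourier G (- x)))\<^sup>2) \<partial>lborel) = ennreal (?c * sobolev_sq s f)"
    by (simp add: ennreal_mult sobolev_sq_nonneg)
  have "(\<integral>\<^sup>+x\<in>UNIV. ennpowr (ennreal (cmod (bessel s f x))) 2 \<partial>lborel)
     = (\<integral>\<^sup>+x. ennreal (1 / ?c\<^sup>2) * ennreal ((cmod (fourier G (- x)))\<^sup>2) \<partial>lborel)"
    unfolding bes
    by (intro nn_integral_cong) (simp add: ennpowr_ennreal power_mult_distrib power_divide field_simps flip: ennreal_mult)
  also have "\<dots> = ennreal (1 / ?c\<^sup>2) * ennreal (?c * sobolev_sq s f)"
    unfolding P[symmetric] by (rule nn_integral_cmult) measurable
  also have "\<dots> = ennreal (sobolev_sq s f / ?c)"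
    using sobolev_sq_nonneg[of s f] by (simp add: power2_eq_square flip: ennreal_mult)
  finally show ?thesis
    unfolding sobolev_norm_def Lq_norm_def
    by (simp add: ennpowr_ennreal sobolev_sq_nonneg powr_half_sqrt)
qed

lemma L2_le_sobolev:
  fixes f :: "'a::euclidean_space \<Rightarrow> complex"
  assumes f: "schwartz f" and s: "s \<ge> 0"
  shows "(\<integral>\<^sup>+x. ennreal ((cmod (f x))\<^sup>2) \<partial>lborel) \<le> ennreal (sobolev_sq s f)"
proof -
  note r = schwartz_rapid[OF f]
  obtain B where B: "\<And>x. cmod (f x) \<le> B" using rapid_bounded[OF r] by metis
  have one: "1 \<le> (2 * pi) ^ DIM('a)" using pi_gt3 by (intro one_le_power) simp
  have "1 * (\<integral>\<^sup>+x. ennreal ((cmod (f x))\<^sup>2) \<partial>lborel) \<le> ennreal ((2 * pi) ^ DIM('a)) * (\<integral>\<^sup>+x. ennreal ((cmod (f x))\<^sup>2) \<partial>lborel)"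
    using one by (intro mult_right_mono) auto
  also have "\<dots> = (\<integral>\<^sup>+\<xi>. ennreal ((cmod (fourier f \<xi>))\<^sup>2) \<partial>lborel)"
    by (rule plancherel[OF rapid_integrable[OF r] rapid_continuous[OF r] B, symmetric])
  also have "\<dots> \<le> (\<integral>\<^sup>+\<xi>. ennreal ((1 + (norm \<xi>)\<^sup>2) powr s * (cmod (fourier f \<xi>))\<^sup>2) \<partial>lborel)"
    using s by (intro nn_integral_mono ennreal_leI) (auto intro!: mult_le_cancel_right1[THEN iffD2] ge_one_powr_ge_zero)
  finally show ?thesis by (simp add: ennreal_sobolev_sq[OF f])
qed

lemma peetre:
  fixes \<xi> \<eta> :: "'a::euclidean_space"
  assumes s: "s \<ge> 0"
  shows "(1 + (norm \<xi>)\<^sup>2) powr s \<le> 2 powr s * ((1 + (norm (\<xi> - \<eta>))\<^sup>2) powr s * (1 + (norm \<eta>)\<^sup>2) powr s)"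
proof -
  let ?a = "norm (\<xi> - \<eta>)" and ?b = "norm \<eta>"
  have "norm \<xi> \<le> ?a + ?b" using norm_triangle_ineq[of "\<xi> - \<eta>" \<eta>] by simp
  then have "(norm \<xi>)\<^sup>2 \<le> (?a + ?b)\<^sup>2" by (intro power_mono) auto
  also have "\<dots> \<le> 2 * ?a\<^sup>2 + 2 * ?b\<^sup>2"
    using zero_le_power2[of "?a - ?b"] by (simp add: power2_eq_square algebra_simps)
  finally have 1: "(norm \<xi>)\<^sup>2 \<le> 2 * ?a\<^sup>2 + 2 * ?b\<^sup>2" .
  have "2 * ((1 + ?a\<^sup>2) * (1 + ?b\<^sup>2)) = 2 + (2 * ?a\<^sup>2 + 2 * ?b\<^sup>2) + 2 * (?a\<^sup>2 * ?b\<^sup>2)"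
    by (simp add: algebra_simps)
  with 1 mult_nonneg_nonneg[OF zero_le_power2[of ?a] zero_le_power2[of ?b]]
  have "1 + (norm \<xi>)\<^sup>2 \<le> 2 * ((1 + ?a\<^sup>2) * (1 + ?b\<^sup>2))" by linarith
  then have "(1 + (norm \<xi>)\<^sup>2) powr s \<le> (2 * ((1 + ?a\<^sup>2) * (1 + ?b\<^sup>2))) powr s"
    by (intro powr_mono2 s) auto
  then show ?thesis by (simp add: powr_mult)
qed

lemma schwartz_cutoff:
  assumes "smooth \<psi>" "\<And>x. norm x \<ge> 4 \<Longrightarrow> \<psi> x = 0" "schwartz f"
  shows "schwartz (\<lambda>x. \<psi> x * f (x + y))"
  by (rule smooth_compact_support_imp_schwartz[where R=4])
    (use assms(2) smooth_mult[OF assms(1) smooth_translation[OF schwartz_imp_smooth[OF assms(3)]]] in auto)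

text \<open>As a function of the translation parameter \<open>y\<close>, the transform of a localized piece at a fixed
  frequency is a convolution, to which inversion and Plancherel in \<open>y\<close> apply.\<close>

lemma
  fixes \<psi> f :: "'a::euclidean_space \<Rightarrow> complex" and \<xi> :: 'a
  assumes \<psi>: "rapid \<psi>" "rapid (fourier \<psi>)" and f: "rapid f" "rapid (fourier f)"
  defines "\<Gamma> \<equiv> \<lambda>y. fourier (\<lambda>x. \<psi> x * f (x + y)) \<xi>"
  shows cutoff_fourier_sq: "(\<integral>\<^sup>+y. ennreal ((cmod (\<Gamma> y))\<^sup>2) \<partial>lborel)
      \<le> (\<integral>\<^sup>+\<eta>. ennreal ((cmod (fourier \<psi> (\<xi> - \<eta>)))\<^sup>2) * ennreal ((cmod (fourier f \<eta>))\<^sup>2) \<partial>lborel)"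
    and cutoff_fourier_le: "ennreal (cmod (\<Gamma> y))
      \<le> (\<integral>\<^sup>+\<eta>. ennreal (cmod (fourier \<psi> (\<xi> - \<eta>)) * cmod (fourier f \<eta>)) \<partial>lborel)"
proof -
  note \<psi>i = rapid_integrable[OF \<psi>(1)] and fi = rapid_integrable[OF f(1)]
  have [measurable]: "\<psi> \<in> borel_measurable borel" "f \<in> borel_measurable borel"
    "fourier \<psi> \<in> borel_measurable borel" "fourier f \<in> borel_measurable borel"
    using \<psi> f by (auto intro: rapid_measurable)
  obtain B where B: "\<And>x. cmod (f x) \<le> B" using rapid_bounded[OF f(1)] by metis
  obtain B' where B': "\<And>x. cmod (fourier \<psi> x) \<le> B'" using rapid_bounded[OF \<psi>(2)] by metis
  have \<Gamma>: "\<Gamma> y = (\<integral>x. cis (- (x \<bullet> \<xi>)) * (\<psi> x * f (x + y)) \<partial>lborel)" for y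
    unfolding \<Gamma>_def fourier_def ..
  have int2: "integrable (lborel \<Otimes>\<^sub>M lborel) (\<lambda>(x, y). cis (\<phi> x y) * (\<psi> x * f (x + y)))"
    if [measurable]: "(\<lambda>(x, y). \<phi> x y) \<in> borel_measurable (lborel \<Otimes>\<^sub>M lborel)" for \<phi> :: "'a \<Rightarrow> 'a \<Rightarrow> real"
  proof (rule lborel_pair.Fubini_integrable)
    have fx: "integrable lborel (\<lambda>y. f (x + y))" for x
      using integrable_lborel_translation[OF fi, of x] by (simp add: add.commute)
    have n: "(\<integral>y. cmod (cis (\<phi> x y) * (\<psi> x * f (x + y))) \<partial>lborel) = cmod (\<psi> x) * (\<integral>y. cmod (f y) \<partial>lborel)" for x
      using integral_lborel_translation[of "\<lambda>y. cmod (f y)" x] by (simp add: norm_mult add.commute)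
    show "integrable lborel (\<lambda>x. \<integral>y. cmod (case (x, y) of (x, y) \<Rightarrow> cis (\<phi> x y) * (\<psi> x * f (x + y))) \<partial>lborel)"
      unfolding prod.case n by (intro integrable_mult_left integrable_norm \<psi>i)
    show "AE x in lborel. integrable lborel (\<lambda>y. case (x, y) of (x, y) \<Rightarrow> cis (\<phi> x y) * (\<psi> x * f (x + y)))"
      unfolding prod.case by (intro AE_I2 integrable_cis_mult integrable_mult_right fx) measurable
  qed measurable
  have \<Gamma>i: "integrable lborel \<Gamma>"
    unfolding \<Gamma>[abs_def] using lborel_pair.integrable_snd[OF int2[of "\<lambda>x y. - (x \<bullet> \<xi>)"]] by simp
  have le: "cmod (cis (- (x \<bullet> \<xi>)) * (\<psi> x * f (x + y))) \<le> cmod (\<psi> x) * B" for x y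
    by (auto simp: norm_mult intro!: mult_left_mono B)
  have \<psi>B: "integrable lborel (\<lambda>x. cmod (\<psi> x) * B)" by (intro integrable_mult_left integrable_norm \<psi>i)
  have \<Gamma>c: "continuous_on UNIV \<Gamma>"
    unfolding \<Gamma>[abs_def]
    by (rule continuous_on_integral_dominated[where g="\<lambda>x. cmod (\<psi> x) * B"])
      (use le \<psi>B in \<open>auto intro!: continuous_intros continuous_on_compose2[OF rapid_continuous[OF f(1)]] simp del: norm_mult\<close>)
  have \<Gamma>B: "cmod (\<Gamma> y) \<le> (\<integral>x. cmod (\<psi> x) * B \<partial>lborel)" for y
    unfolding \<Gamma> 
    by (rule Bochner_Integration.integral_norm_bound_integral[OF Bochner_Integration.integrable_bound[OF \<psi>B] \<psi>B])
      (use le in \<open>auto intro!: AE_I2 order_trans[OF _ abs_ge_self] simp del: norm_mult\<close>)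
  have F\<Gamma>: "fourier \<Gamma> \<eta> = fourier \<psi> (\<xi> - \<eta>) * fourier f \<eta>" for \<eta>
  proof -
    have e: "cis (- (y \<bullet> \<eta>)) * (cis (- (x \<bullet> \<xi>)) * z) = cis (- (x \<bullet> \<xi>) - y \<bullet> \<eta>) * z" for x y z
      unfolding diff_conv_add_uminus cis_mult[symmetric] by (simp only: mult_ac)
    have "fourier \<Gamma> \<eta> = (\<integral>y. \<integral>x. cis (- (x \<bullet> \<xi>) - y \<bullet> \<eta>) * (\<psi> x * f (x + y)) \<partial>lborel \<partial>lborel)"
      unfolding fourier_def[of \<Gamma>] \<Gamma> integral_mult_right_zero[symmetric] e ..
    also have "\<dots> = (\<integral>x. \<integral>y. cis (- (x \<bullet> \<xi>) - y \<bullet> \<eta>) * (\<psi> x * f (x + y)) \<partial>lborel \<partial>lborel)"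
      by (rule lborel_pair.Fubini_integral[OF int2]) measurable
    also have "\<dots> = (\<integral>x. cis (- (x \<bullet> (\<xi> - \<eta>))) * \<psi> x * fourier f \<eta> \<partial>lborel)"
    proof (intro Bochner_Integration.integral_cong refl)
      fix x
      have "(\<integral>y. cis (- (x \<bullet> \<xi>) - y \<bullet> \<eta>) * (\<psi> x * f (x + y)) \<partial>lborel)
        = (\<integral>y. cis (- (x \<bullet> \<xi>)) * \<psi> x * (cis (- (y \<bullet> \<eta>)) * f (y + x)) \<partial>lborel)"
        unfolding diff_conv_add_uminus cis_mult[symmetric] by (simp only: mult_ac add.commute)
      also have "\<dots> = cis (- (x \<bullet> \<xi>)) * \<psi> x * fourier (\<lambda>y. f (y + x)) \<eta>"
        unfolding fourier_def by (rule integral_mult_right_zero)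
      also have "\<dots> = (cis (- (x \<bullet> \<xi>)) * cis (x \<bullet> \<eta>)) * \<psi> x * fourier f \<eta>"
        unfolding fourier_translation[OF fi, of x] by (simp only: mult_ac)
      also have "\<dots> = cis (- (x \<bullet> (\<xi> - \<eta>))) * \<psi> x * fourier f \<eta>"
        by (simp add: cis_mult inner_diff_right)
      finally show "(\<integral>y. cis (- (x \<bullet> \<xi>) - y \<bullet> \<eta>) * (\<psi> x * f (x + y)) \<partial>lborel) = cis (- (x \<bullet> (\<xi> - \<eta>))) * \<psi> x * fourier f \<eta>" .
    qed
    also have "\<dots> = fourier \<psi> (\<xi> - \<eta>) * fourier f \<eta>"
      unfolding fourier_def[of \<psi>] by (rule integral_mult_left_zero)
    finally show ?thesis .
  qed
  have one: "1 \<le> (2 * pi) ^ DIM('a)" using pi_gt3 by (intro one_le_power) simp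
  have "1 * (\<integral>\<^sup>+y. ennreal ((cmod (\<Gamma> y))\<^sup>2) \<partial>lborel) \<le> ennreal ((2 * pi) ^ DIM('a)) * (\<integral>\<^sup>+y. ennreal ((cmod (\<Gamma> y))\<^sup>2) \<partial>lborel)"
    using one by (intro mult_right_mono) auto
  also have "\<dots> = (\<integral>\<^sup>+\<eta>. ennreal ((cmod (fourier \<Gamma> \<eta>))\<^sup>2) \<partial>lborel)"
    by (rule plancherel[OF \<Gamma>i \<Gamma>c \<Gamma>B, symmetric])
  also have "\<dots> = (\<integral>\<^sup>+\<eta>. ennreal ((cmod (fourier \<psi> (\<xi> - \<eta>)))\<^sup>2) * ennreal ((cmod (fourier f \<eta>))\<^sup>2) \<partial>lborel)"
    unfolding F\<Gamma> by (simp add: norm_mult power_mult_distrib ennreal_mult)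
  finally show "(\<integral>\<^sup>+y. ennreal ((cmod (\<Gamma> y))\<^sup>2) \<partial>lborel)
      \<le> (\<integral>\<^sup>+\<eta>. ennreal ((cmod (fourier \<psi> (\<xi> - \<eta>)))\<^sup>2) * ennreal ((cmod (fourier f \<eta>))\<^sup>2) \<partial>lborel)" by simp
  have F\<Gamma>i: "integrable lborel (fourier \<Gamma>)"
  proof (rule Bochner_Integration.integrable_bound)
    show "integrable lborel (\<lambda>\<eta>. of_real B' * fourier f \<eta>)"
      by (intro integrable_mult_right rapid_integrable f)
    show "AE \<eta> in lborel. cmod (fourier \<Gamma> \<eta>) \<le> cmod (of_real B' * fourier f \<eta>)"
      unfolding F\<Gamma> using B' by (auto simp: norm_mult intro!: AE_I2 mult_right_mono order_trans[OF B' abs_ge_self])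
  qed (simp add: borel_measurable_fourier[OF \<Gamma>i])
  have "cmod (\<Gamma> y) \<le> (2 * pi) ^ DIM('a) * cmod (\<Gamma> y)" using one by (simp add: mult_le_cancel_right1)
  also have "\<dots> = cmod (\<integral>\<eta>. cis (y \<bullet> \<eta>) * fourier \<Gamma> \<eta> \<partial>lborel)"
    unfolding fourier_inversion[OF \<Gamma>i \<Gamma>c \<Gamma>B F\<Gamma>i] norm_mult norm_of_real by simp
  finally have "ennreal (cmod (\<Gamma> y)) \<le> ennreal (cmod (\<integral>\<eta>. cis (y \<bullet> \<eta>) * fourier \<Gamma> \<eta> \<partial>lborel))"
    by (rule ennreal_leI)
  also have "\<dots> \<le> (\<integral>\<^sup>+\<eta>. ennreal (cmod (cis (y \<bullet> \<eta>) * fourier \<Gamma> \<eta>)) \<partial>lborel)"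
    by (intro integral_norm_bound_ennreal integrable_cis_mult F\<Gamma>i) measurable
  finally show "ennreal (cmod (\<Gamma> y)) \<le> (\<integral>\<^sup>+\<eta>. ennreal (cmod (fourier \<psi> (\<xi> - \<eta>)) * cmod (fourier f \<eta>)) \<partial>lborel)"
    by (simp add: F\<Gamma> norm_mult)
qed

lemma cutoff_sobolev:
  fixes \<psi> :: "'a::euclidean_space \<Rightarrow> complex"
  assumes \<psi>: "smooth \<psi>" "\<And>x. norm x \<ge> 4 \<Longrightarrow> \<psi> x = 0" and s: "s \<ge> 0"
  obtains c where "c \<ge> 0"
    "\<And>f y. schwartz f \<Longrightarrow> sobolev_sq s (\<lambda>x. \<psi> x * f (x + y)) \<le> c * sobolev_sq s f"
    "\<And>f. schwartz f \<Longrightarrow> (\<integral>\<^sup>+y. ennreal (sobolev_sq s (\<lambda>x. \<psi> x * f (x + y))) \<partial>lborel) \<le> ennreal (c * sobolev_sq s f)"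
proof -
  have \<psi>s: "schwartz \<psi>" using smooth_compact_support_imp_schwartz[OF \<psi>] .
  note r\<psi> = schwartz_rapid[OF \<psi>s] fourier_rapid[OF \<psi>s]
  have [measurable]: "\<psi> \<in> borel_measurable borel" "fourier \<psi> \<in> borel_measurable borel"
    using r\<psi> by (auto intro: rapid_measurable)
  let ?w = "\<lambda>\<xi>::'a. (1 + (norm \<xi>)\<^sup>2) powr s"
  have split: "ennreal (?w \<xi>) * (ennreal (a * b)) \<le> ennreal (2 powr s) * (ennreal (?w (\<xi> - \<eta>) * a) * ennreal (?w \<eta> * b))"
    if "a \<ge> 0" "b \<ge> 0" for \<xi> \<eta> a b
  proof -
    have "?w \<xi> * (a * b) \<le> (2 powr s * (?w (\<xi> - \<eta>) * ?w \<eta>)) * (a * b)"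
      using that by (intro mult_right_mono peetre s) auto
    then have "?w \<xi> * (a * b) \<le> 2 powr s * ((?w (\<xi> - \<eta>) * a) * (?w \<eta> * b))" by (simp add: mult_ac)
    then show ?thesis using that by (simp flip: ennreal_mult)
  qed
  define K1 where "K1 = (\<integral>\<xi>. cmod (of_real (?w \<xi>) * fourier \<psi> \<xi>) \<partial>lborel)"
  define K0 where "K0 = (\<integral>\<xi>. cmod (fourier \<psi> \<xi>) \<partial>lborel)"
  have K1: "(\<integral>\<^sup>+\<xi>. ennreal (?w \<xi> * cmod (fourier \<psi> \<xi>)) \<partial>lborel) = ennreal K1" "K1 \<ge> 0"
    unfolding K1_def using nn_integral_eq_integral[OF integrable_norm[OF rapid_integrable[OF rapid_mult_weight[OF r\<psi>(2), of s]]]]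
    by (auto simp: norm_mult)
  have K0: "(\<integral>\<^sup>+\<xi>. ennreal (cmod (fourier \<psi> \<xi>)) \<partial>lborel) = ennreal K0" "K0 \<ge> 0"
    unfolding K0_def using nn_integral_eq_integral[OF integrable_norm[OF rapid_integrable[OF r\<psi>(2)]]] by auto
  define c1 where "c1 = 2 powr s * sobolev_sq s \<psi>"
  define c2 where "c2 = K0 * (2 powr s * K1)"
  have c: "c1 \<ge> 0" "c2 \<ge> 0" unfolding c1_def c2_def using K0 K1 sobolev_sq_nonneg[of s \<psi>] by auto
  have main: "(\<integral>\<^sup>+y. ennreal (sobolev_sq s (\<lambda>x. \<psi> x * f (x + y))) \<partial>lborel) \<le> ennreal (c1 * sobolev_sq s f)"
    "sobolev_sq s (\<lambda>x. \<psi> x * f (x + y)) \<le> c2 * sobolev_sq s f" if f: "schwartz f" for f y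
  proof -
    note rf = schwartz_rapid[OF f] fourier_rapid[OF f]
    have [measurable]: "f \<in> borel_measurable borel" "fourier f \<in> borel_measurable borel"
      using rf by (auto intro: rapid_measurable)
    have sc: "schwartz (\<lambda>x. \<psi> x * f (x + y))" for y by (rule schwartz_cutoff[OF \<psi> f])
    define \<Gamma> where "\<Gamma> = (\<lambda>y \<xi>. fourier (\<lambda>x. \<psi> x * f (x + y)) \<xi>)"
    have [measurable]: "case_prod \<Gamma> \<in> borel_measurable (lborel \<Otimes>\<^sub>M lborel)"
      unfolding \<Gamma>_def fourier_def by measurable
    have [measurable]: "\<Gamma> y \<in> borel_measurable borel" for y
      unfolding \<Gamma>_def fourier_def by measurable
    have N: "ennreal (sobolev_sq s (\<lambda>x. \<psi> x * f (x + y))) = (\<integral>\<^sup>+\<xi>. ennreal (?w \<xi>) * ennreal ((cmod (\<Gamma> y \<xi>))\<^sup>2) \<partial>lborel)" for y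
      unfolding ennreal_sobolev_sq[OF sc] \<Gamma>_def by (simp add: ennreal_mult)
    note sq = cutoff_fourier_sq[OF r\<psi> rf, folded \<Gamma>_def] and le = cutoff_fourier_le[OF r\<psi> rf, folded \<Gamma>_def]
    have "(\<integral>\<^sup>+y. ennreal (sobolev_sq s (\<lambda>x. \<psi> x * f (x + y))) \<partial>lborel)
       = (\<integral>\<^sup>+\<xi>. \<integral>\<^sup>+y. ennreal (?w \<xi>) * ennreal ((cmod (\<Gamma> y \<xi>))\<^sup>2) \<partial>lborel \<partial>lborel)"
      unfolding N by (rule lborel_pair.Fubini') measurable
    also have "\<dots> = (\<integral>\<^sup>+\<xi>. ennreal (?w \<xi>) * (\<integral>\<^sup>+y. ennreal ((cmod (\<Gamma> y \<xi>))\<^sup>2) \<partial>lborel) \<partial>lborel)"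
      by (intro nn_integral_cong nn_integral_cmult) (simp add: \<Gamma>_def fourier_def)
    also have "\<dots> \<le> (\<integral>\<^sup>+\<xi>. ennreal (?w \<xi>) * (\<integral>\<^sup>+\<eta>. ennreal ((cmod (fourier \<psi> (\<xi> - \<eta>)))\<^sup>2) * ennreal ((cmod (fourier f \<eta>))\<^sup>2) \<partial>lborel) \<partial>lborel)"
      by (rule nn_integral_mono, rule mult_left_mono) (simp_all add: \<Gamma>_def cutoff_fourier_sq[OF r\<psi> rf])
    also have "\<dots> = (\<integral>\<^sup>+\<xi>. \<integral>\<^sup>+\<eta>. ennreal (?w \<xi>) * ennreal ((cmod (fourier \<psi> (\<xi> - \<eta>)))\<^sup>2 * (cmod (fourier f \<eta>))\<^sup>2) \<partial>lborel \<partial>lborel)"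
      by (subst nn_integral_cmult[symmetric]) (simp_all add: ennreal_mult)
    also have "\<dots> \<le> (\<integral>\<^sup>+\<xi>. \<integral>\<^sup>+\<eta>. ennreal (2 powr s) * (ennreal (?w (\<xi> - \<eta>) * (cmod (fourier \<psi> (\<xi> - \<eta>)))\<^sup>2) * ennreal (?w \<eta> * (cmod (fourier f \<eta>))\<^sup>2)) \<partial>lborel \<partial>lborel)"
      by (intro nn_integral_mono split) auto
    also have "\<dots> = ennreal (2 powr s) * (ennreal (sobolev_sq s \<psi>) * ennreal (sobolev_sq s f))"
      unfolding ennreal_sobolev_sq[OF f] ennreal_sobolev_sq[OF \<psi>s]
      by (subst nn_integral_convolution[symmetric]) (simp_all add: nn_integral_cmult)
    also have "\<dots> = ennreal (c1 * sobolev_sq s f)"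
      unfolding c1_def using sobolev_sq_nonneg[of s \<psi>] sobolev_sq_nonneg[of s f] by (simp add: mult.assoc flip: ennreal_mult)
    finally show "(\<integral>\<^sup>+y. ennreal (sobolev_sq s (\<lambda>x. \<psi> x * f (x + y))) \<partial>lborel) \<le> ennreal (c1 * sobolev_sq s f)" .
    have "ennreal (sobolev_sq s (\<lambda>x. \<psi> x * f (x + y))) = (\<integral>\<^sup>+\<xi>. ennreal (?w \<xi>) * (ennreal (cmod (\<Gamma> y \<xi>)))\<^sup>2 \<partial>lborel)"
      unfolding N by (simp add: ennreal_power)
    also have "\<dots> \<le> (\<integral>\<^sup>+\<xi>. ennreal (?w \<xi>) * (ennreal K0 * (\<integral>\<^sup>+\<eta>. ennreal (cmod (fourier \<psi> (\<xi> - \<eta>))) * ennreal ((cmod (fourier f \<eta>))\<^sup>2) \<partial>lborel)) \<partial>lborel)"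
    proof (intro nn_integral_mono mult_left_mono)
      fix \<xi>
      have "(ennreal (cmod (\<Gamma> y \<xi>)))\<^sup>2 \<le> (\<integral>\<^sup>+\<eta>. ennreal (cmod (fourier \<psi> (\<xi> - \<eta>)) * cmod (fourier f \<eta>)) \<partial>lborel)\<^sup>2"
        unfolding \<Gamma>_def by (intro power_mono cutoff_fourier_le[OF r\<psi> rf]) simp
      also have "\<dots> \<le> (\<integral>\<^sup>+\<eta>. ennreal (cmod (fourier \<psi> \<eta>)) \<partial>lborel) * (\<integral>\<^sup>+\<eta>. ennreal (cmod (fourier \<psi> (\<xi> - \<eta>))) * ennreal ((cmod (fourier f \<eta>))\<^sup>2) \<partial>lborel)"
        by (rule convolution_Cauchy_Schwarz) auto
      finally show "(ennreal (cmod (\<Gamma> y \<xi>)))\<^sup>2 \<le> ennreal K0 * (\<integral>\<^sup>+\<eta>. ennreal (cmod (fourier \<psi> (\<xi> - \<eta>))) * ennreal ((cmod (fourier f \<eta>))\<^sup>2) \<partial>lborel)"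
        unfolding K0 .
    qed simp
    also have "\<dots> = ennreal K0 * (\<integral>\<^sup>+\<xi>. \<integral>\<^sup>+\<eta>. ennreal (?w \<xi>) * ennreal (cmod (fourier \<psi> (\<xi> - \<eta>)) * (cmod (fourier f \<eta>))\<^sup>2) \<partial>lborel \<partial>lborel)"
      by (simp add: nn_integral_cmult ennreal_mult mult.left_commute[of _ "ennreal K0"])
    also have "\<dots> \<le> ennreal K0 * (\<integral>\<^sup>+\<xi>. \<integral>\<^sup>+\<eta>. ennreal (2 powr s) * (ennreal (?w (\<xi> - \<eta>) * cmod (fourier \<psi> (\<xi> - \<eta>))) * ennreal (?w \<eta> * (cmod (fourier f \<eta>))\<^sup>2)) \<partial>lborel \<partial>lborel)"
      by (intro mult_left_mono nn_integral_mono split) auto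
    also have "\<dots> = ennreal K0 * (ennreal (2 powr s) * (ennreal K1 * ennreal (sobolev_sq s f)))"
      unfolding ennreal_sobolev_sq[OF f] K1(1)[symmetric]
      by (subst nn_integral_convolution[symmetric]) (simp_all add: nn_integral_cmult)
    also have "\<dots> = ennreal (c2 * sobolev_sq s f)"
      unfolding c2_def using K0 K1 sobolev_sq_nonneg[of s f] by (simp add: mult.assoc flip: ennreal_mult)
    finally show "sobolev_sq s (\<lambda>x. \<psi> x * f (x + y)) \<le> c2 * sobolev_sq s f"
      using c sobolev_sq_nonneg[of s f] by (simp add: ennreal_le_iff)
  qed
  show ?thesis
  proof
    show "c1 + c2 \<ge> 0" using c by simp
    fix f :: "'a \<Rightarrow> complex" assume f: "schwartz f"
    have 1: "c2 * sobolev_sq s f \<le> (c1 + c2) * sobolev_sq s f" "c1 * sobolev_sq s f \<le> (c1 + c2) * sobolev_sq s f"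
      using c by (auto intro!: mult_right_mono sobolev_sq_nonneg)
    show "sobolev_sq s (\<lambda>x. \<psi> x * f (x + y)) \<le> (c1 + c2) * sobolev_sq s f" for y
      using main(2)[OF f] 1(1) by (rule order_trans)
    show "(\<integral>\<^sup>+y. ennreal (sobolev_sq s (\<lambda>x. \<psi> x * f (x + y))) \<partial>lborel) \<le> ennreal ((c1 + c2) * sobolev_sq s f)"
      using main(1)[OF f] ennreal_leI[OF 1(2)] by (rule order_trans)
  qed
qed

section \<open>Globalizing the maximal estimate\<close>

lemma far_kernel_nonneg: "far_kernel z \<ge> 0"
  unfolding far_kernel_def by (intro divide_nonneg_pos integral_nonneg_AE) (auto simp: far_weight_nonneg)

lemma far_kernel_measurable [measurable]: "far_kernel \<in> borel_measurable borel"
  unfolding far_kernel_def[abs_def] by measurable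

lemma far_kernel_le:
  "far_kernel (z::'a::euclidean_space) \<le> (\<integral>v. far_weight DIM('a) v \<partial>lborel) / sqrt pi"
  unfolding far_kernel_def
proof (intro divide_right_mono integral_mono_AE integrable_far_weight)
  show "integrable lborel (\<lambda>v. far_weight DIM('a) v * exp (- (v\<^sup>2 * (norm z)\<^sup>2 / 8)))"
    by (rule Bochner_Integration.integrable_bound[OF integrable_far_weight[of "DIM('a)"]])
      (auto simp: abs_mult far_weight_nonneg intro!: mult_left_le)
  show "AE v in lborel. far_weight DIM('a) v * exp (- (v\<^sup>2 * (norm z)\<^sup>2 / 8)) \<le> far_weight DIM('a) v"
    by (auto intro!: mult_left_le far_weight_nonneg)
qed simp

lemma integrable_far_kernel: "integrable lborel (far_kernel :: 'a::euclidean_space \<Rightarrow> real)"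
proof -
  have gauss: "integrable lborel (\<lambda>z::'a. exp (- (v\<^sup>2 * (norm z)\<^sup>2 / 8)))"
    "(\<integral>z. exp (- (v\<^sup>2 * (norm (z::'a))\<^sup>2 / 8)) \<partial>lborel) = (sqrt 8 / v * sqrt pi) ^ DIM('a)" if v: "v > 0" for v :: real
  proof -
    have e: "exp (- ((norm z)\<^sup>2) / (sqrt 8 / v)\<^sup>2) = exp (- (v\<^sup>2 * (norm z)\<^sup>2 / 8))" for z :: 'a
      using v by (simp add: power_divide mult.commute)
    have p: "sqrt 8 / v > 0" using v by simp
    show "integrable lborel (\<lambda>z::'a. exp (- (v\<^sup>2 * (norm z)\<^sup>2 / 8)))"
      using integrable_gaussian[OF p, where 'a='a] unfolding e .
    have "complex_of_real (\<integral>z. exp (- (v\<^sup>2 * (norm (z::'a))\<^sup>2 / 8)) \<partial>lborel) = of_real ((sqrt 8 / v * sqrt pi) ^ DIM('a))"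
      using fourier_gaussian[OF p, of "0::'a"] unfolding e by simp
    then show "(\<integral>z. exp (- (v\<^sup>2 * (norm (z::'a))\<^sup>2 / 8)) \<partial>lborel) = (sqrt 8 / v * sqrt pi) ^ DIM('a)"
      by (simp only: of_real_eq_iff)
  qed
  have "integrable (lborel \<Otimes>\<^sub>M lborel) (\<lambda>(v, z::'a). far_weight DIM('a) v * exp (- (v\<^sup>2 * (norm z)\<^sup>2 / 8)))"
  proof (rule lborel_pair.Fubini_integrable)
    have eq: "(\<integral>z. norm (far_weight DIM('a) v * exp (- (v\<^sup>2 * (norm (z::'a))\<^sup>2 / 8))) \<partial>lborel)
        = sqrt 2 ^ DIM('a) * (exp (- (v\<^sup>2) / 4) * indicator {0<..} v)" for v
    proof (cases "v > 0")
      case True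
      have "(sqrt 8 / v * sqrt pi) * (v / (2 * sqrt pi)) = sqrt 8 / 2" using True by simp
      also have "\<dots> = sqrt 2" using real_sqrt_mult[of 4 2] by simp
      finally have s: "(v / (2 * sqrt pi)) ^ DIM('a) * (sqrt 8 / v * sqrt pi) ^ DIM('a) = sqrt 2 ^ DIM('a)"
        unfolding power_mult_distrib[symmetric] by (simp only: mult.commute)
      have "(\<integral>z. norm (far_weight DIM('a) v * exp (- (v\<^sup>2 * (norm (z::'a))\<^sup>2 / 8))) \<partial>lborel)
          = far_weight DIM('a) v * (sqrt 8 / v * sqrt pi) ^ DIM('a)"
        unfolding gauss(2)[OF True, symmetric] by (simp add: abs_mult far_weight_nonneg)
      also have "\<dots> = ((v / (2 * sqrt pi)) ^ DIM('a) * (sqrt 8 / v * sqrt pi) ^ DIM('a)) * exp (- (v\<^sup>2) / 4)"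
        using True unfolding far_weight_def by (simp only: mult_ac) simp
      finally show ?thesis using True unfolding s by simp
    qed (simp add: far_weight_def)
    have "integrable lborel (\<lambda>v::real. exp (- (v\<^sup>2) / 4))" using integrable_gaussian_real[of 2] by simp
    then have "integrable lborel (\<lambda>v::real. sqrt 2 ^ DIM('a) * (exp (- (v\<^sup>2) / 4) * indicator {0<..} v))"
      by (intro integrable_mult_right integrable_real_mult_indicator) auto
    then show "integrable lborel (\<lambda>v. \<integral>z. norm (case (v, z::'a) of (v, z) \<Rightarrow> far_weight DIM('a) v * exp (- (v\<^sup>2 * (norm z)\<^sup>2 / 8))) \<partial>lborel)"
      unfolding prod.case eq .
    show "AE v in lborel. integrable lborel (\<lambda>z. case (v, z::'a) of (v, z) \<Rightarrow> far_weight DIM('a) v * exp (- (v\<^sup>2 * (norm z)\<^sup>2 / 8)))"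
    proof (rule AE_I2)
      fix v :: real
      show "integrable lborel (\<lambda>z. case (v, z::'a) of (v, z) \<Rightarrow> far_weight DIM('a) v * exp (- (v\<^sup>2 * (norm z)\<^sup>2 / 8)))"
      proof (cases "v > 0")
        case True then show ?thesis unfolding prod.case by (intro integrable_mult_right gauss)
      qed (simp add: far_weight_def)
    qed
  qed measurable
  from lborel_pair.integrable_snd[OF this] show ?thesis
    unfolding far_kernel_def[abs_def] by simp
qed

definition far_maximal :: "('a::euclidean_space \<Rightarrow> complex) \<Rightarrow> 'a \<Rightarrow> real"
  where "far_maximal f x = (\<integral>y. far_kernel (x - y) * cmod (f y) \<partial>lborel)"

lemma far_maximal_nonneg: "far_maximal f x \<ge> 0"
  unfolding far_maximal_def by (intro integral_nonneg_AE) (auto simp: far_kernel_nonneg)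

lemma integrable_far_maximal:
  fixes f :: "'a::euclidean_space \<Rightarrow> complex"
  assumes f: "integrable lborel f"
  shows "integrable lborel (\<lambda>y. far_kernel (x - y) * cmod (f y))"
proof -
  have [measurable]: "f \<in> borel_measurable borel" using f by auto
  show ?thesis
  proof (rule Bochner_Integration.integrable_bound[OF integrable_mult_right[OF integrable_norm[OF f]]])
    let ?B = "(\<integral>v. far_weight DIM('a) v \<partial>lborel) / sqrt pi"
    have "norm (far_kernel (x - y) * cmod (f y)) \<le> ?B * cmod (f y)" for y
      using mult_right_mono[OF far_kernel_le[of "x - y"] norm_ge_zero[of "f y"]] far_kernel_nonneg[of "x - y"]
      by (simp add: abs_mult)
    then show "AE y in lborel. norm (far_kernel (x - y) * cmod (f y)) \<le> norm (?B * cmod (f y))"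
      by (intro AE_I2) (metis abs_ge_self order_trans real_norm_def)
  qed measurable
qed

lemma far_maximal_Lq:
  fixes q s :: real
  assumes q: "q \<ge> 2" and s: "s \<ge> 0"
  obtains c where "c \<ge> 0" "\<And>f :: 'a::euclidean_space \<Rightarrow> complex. schwartz f \<Longrightarrow>
    (\<integral>\<^sup>+x. ennreal (far_maximal f x powr q) \<partial>lborel) \<le> ennreal ((c * sobolev_sq s f) powr (q / 2))"
proof -
  define A where "A = integral\<^sup>L lborel (far_kernel :: 'a \<Rightarrow> real)"
  define B where "B = (\<integral>v. far_weight DIM('a) v \<partial>lborel) / sqrt pi"
  have A: "(\<integral>\<^sup>+x. ennreal (far_kernel (x::'a)) \<partial>lborel) = ennreal A" "A \<ge> 0"
    unfolding A_def using nn_integral_eq_integral[OF integrable_far_kernel[where 'a='a]]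
    by (auto simp: far_kernel_nonneg intro!: integral_nonneg_AE)
  have B: "far_kernel (z::'a) \<le> B" for z unfolding B_def by (rule far_kernel_le)
  have B0: "B \<ge> 0" using order_trans[OF far_kernel_nonneg B] .
  show ?thesis
  proof
    show "A * (A + B) \<ge> 0" using A B0 by simp
    fix f :: "'a \<Rightarrow> complex" assume f: "schwartz f"
    note fi = rapid_integrable[OF schwartz_rapid[OF f]]
    have [measurable]: "f \<in> borel_measurable borel" using fi by auto
    let ?N = "sobolev_sq s f"
    have N0: "?N \<ge> 0" by (rule sobolev_sq_nonneg)
    have [measurable]: "far_maximal f \<in> borel_measurable borel" unfolding far_maximal_def[abs_def] by measurable
    have CS: "ennreal ((far_maximal f x)\<^sup>2) \<le> ennreal A * (\<integral>\<^sup>+y. ennreal (far_kernel (x - y)) * ennreal ((cmod (f y))\<^sup>2) \<partial>lborel)" for x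
    proof -
      have "ennreal (far_maximal f x) = (\<integral>\<^sup>+y. ennreal (far_kernel (x - y) * cmod (f y)) \<partial>lborel)"
        unfolding far_maximal_def
        by (rule nn_integral_eq_integral[OF integrable_far_maximal[OF fi], symmetric]) (auto simp: far_kernel_nonneg)
      then have "ennreal ((far_maximal f x)\<^sup>2) = (\<integral>\<^sup>+y. ennreal (far_kernel (x - y) * cmod (f y)) \<partial>lborel)\<^sup>2"
        by (simp add: ennreal_power[symmetric] far_maximal_nonneg)
      also have "\<dots> \<le> (\<integral>\<^sup>+y. ennreal (far_kernel (y::'a)) \<partial>lborel) * (\<integral>\<^sup>+y. ennreal (far_kernel (x - y)) * ennreal ((cmod (f y))\<^sup>2) \<partial>lborel)"
        by (rule convolution_Cauchy_Schwarz) (auto simp: far_kernel_nonneg)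
      finally show ?thesis unfolding A .
    qed
    note L2 = L2_le_sobolev[OF f s]
    have pw: "(far_maximal f x)\<^sup>2 \<le> A * (A + B) * ?N" for x
    proof -
      note CS[of x]
      also have "ennreal A * (\<integral>\<^sup>+y. ennreal (far_kernel (x - y)) * ennreal ((cmod (f y))\<^sup>2) \<partial>lborel)
         \<le> ennreal A * (\<integral>\<^sup>+y. ennreal B * ennreal ((cmod (f y))\<^sup>2) \<partial>lborel)"
        by (intro mult_left_mono nn_integral_mono mult_right_mono ennreal_leI B) auto
      also have "\<dots> = ennreal A * (ennreal B * (\<integral>\<^sup>+y. ennreal ((cmod (f y))\<^sup>2) \<partial>lborel))"
        by (subst nn_integral_cmult) auto
      also have "\<dots> \<le> ennreal A * (ennreal (A + B) * ennreal ?N)"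
        using A by (intro mult_left_mono mult_mono L2 ennreal_leI) auto
      also have "\<dots> = ennreal (A * (A + B) * ?N)" 
      using A B0 N0 by (simp only: mult.assoc ennreal_mult mult_nonneg_nonneg add_nonneg_nonneg)
      finally show ?thesis using A B0 N0 by (simp add: ennreal_le_iff)
    qed
    have "(\<integral>\<^sup>+x. ennreal ((far_maximal f x)\<^sup>2) \<partial>lborel)
       \<le> (\<integral>\<^sup>+x. ennreal A * (\<integral>\<^sup>+y. ennreal (far_kernel (x - y)) * ennreal ((cmod (f y))\<^sup>2) \<partial>lborel) \<partial>lborel)"
      by (rule nn_integral_mono) (rule CS)
    also have "\<dots> = ennreal A * (ennreal A * (\<integral>\<^sup>+y. ennreal ((cmod (f y))\<^sup>2) \<partial>lborel))"
      unfolding A(1)[symmetric] by (subst nn_integral_convolution[symmetric]) (simp_all add: nn_integral_cmult)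
    also have "\<dots> \<le> ennreal A * (ennreal (A + B) * ennreal ?N)"
      using B0 by (intro mult_left_mono mult_mono L2 ennreal_leI) auto
    also have "\<dots> = ennreal (A * (A + B) * ?N)" 
      using A B0 N0 by (simp only: mult.assoc ennreal_mult mult_nonneg_nonneg add_nonneg_nonneg)
    finally have int: "(\<integral>\<^sup>+x. ennreal ((far_maximal f x)\<^sup>2) \<partial>lborel) \<le> ennreal (A * (A + B) * ?N)" .
    have e: "((far_maximal f x)\<^sup>2) powr (q / 2) = far_maximal f x powr q" for x
      using far_maximal_nonneg[of f x] by (simp add: powr_powr flip: powr_numeral)
    have "(\<integral>\<^sup>+x. ennreal (((far_maximal f x)\<^sup>2) powr (q / 2)) \<partial>lborel) \<le> ennreal ((A * (A + B) * ?N) powr (q / 2))"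
      by (rule nn_integral_powr_le[OF _ _ pw _ int]) (use A B0 N0 q in auto)
    then show "(\<integral>\<^sup>+x. ennreal (far_maximal f x powr q) \<partial>lborel) \<le> ennreal ((A * (A + B) * ?N) powr (q / 2))"
      unfolding e .
  qed
qed

lemma continuous_on_wave:
  fixes f :: "'a::euclidean_space \<Rightarrow> complex"
  assumes ff: "integrable lborel (fourier f)"
  shows "continuous_on UNIV (wave t f)"
proof -
  have [measurable]: "fourier f \<in> borel_measurable borel" using ff by auto
  show ?thesis
    unfolding wave_def[abs_def]
    by (intro continuous_intros continuous_on_integral_dominated[where g="\<lambda>\<xi>. cmod (fourier f \<xi>)"])
      (auto intro!: continuous_intros ff simp: norm_mult)
qed

lemma wave_maximal_measurable:
  fixes f :: "'a::euclidean_space \<Rightarrow> complex"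
  assumes "integrable lborel (fourier f)"
  shows "wave_maximal f \<in> borel_measurable borel"
proof (rule borel_measurableI_greater)
  fix c
  have "{x \<in> space borel. c < wave_maximal f x} = (\<Union>t\<in>{0<..<1}. {x. c < ennreal (cmod (wave t f x))})"
    by (auto simp: wave_maximal_def less_SUP_iff)
  moreover have "open (\<Union>t\<in>{0<..<1}. {x. c < ennreal (cmod (wave t f x))})"
    by (intro open_UN ballI open_Collect_less continuous_on_const continuous_on_ennreal continuous_on_norm
        continuous_on_wave assms)
  ultimately show "{x \<in> space borel. c < wave_maximal f x} \<in> sets borel" by simp
qed

lemma wave_translation:
  fixes f :: "'a::euclidean_space \<Rightarrow> complex"
  assumes "integrable lborel f"
  shows "wave t f (x + y) = wave t (\<lambda>x. f (x + y)) x"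
proof -
  have "cis ((x + y) \<bullet> \<xi> + t * norm \<xi>) = cis (x \<bullet> \<xi> + t * norm \<xi>) * cis (y \<bullet> \<xi>)" for \<xi>
    by (simp add: cis_mult inner_add_left add_ac)
  then show ?thesis unfolding wave_def fourier_translation[OF assms, of y] by (simp only: mult.assoc)
qed

lemma
  fixes f g :: "'a::euclidean_space \<Rightarrow> complex"
  assumes f: "integrable lborel f" "integrable lborel (fourier f)"
    and g: "integrable lborel g" "integrable lborel (fourier g)"
  shows fourier_diff: "fourier (\<lambda>x. f x - g x) \<xi> = fourier f \<xi> - fourier g \<xi>"
    and wave_diff: "wave t (\<lambda>x. f x - g x) x = wave t f x - wave t g x"
proof -
  show *: "fourier (\<lambda>x. f x - g x) \<xi> = fourier f \<xi> - fourier g \<xi>" for \<xi>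
    unfolding fourier_def right_diff_distrib
    by (intro Bochner_Integration.integral_diff integrable_cis_mult f g) measurable
  show "wave t (\<lambda>x. f x - g x) x = wave t f x - wave t g x"
    unfolding wave_def * right_diff_distrib
    by (subst Bochner_Integration.integral_diff) (auto intro!: integrable_cis_mult f g simp: scaleR_diff_right)
qed

text \<open>Near and far contributions: the cutoff leaves no mass of the remainder within distance 2 of
  the unit ball, hence off the light cones of its points for times below 1.\<close>

lemma wave_maximal_local:
  fixes f \<psi> :: "'a::euclidean_space \<Rightarrow> complex"
  assumes f: "schwartz f" and \<psi>: "smooth \<psi>" "\<And>x. norm x \<le> 3 \<Longrightarrow> \<psi> x = 1" "\<And>x. norm x \<ge> 4 \<Longrightarrow> \<psi> x = 0"
    and D: "\<And>x. cmod (1 - \<psi> x) \<le> D" and x: "x \<in> ball 0 1"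
  shows "wave_maximal f (x + y) \<le> wave_maximal (\<lambda>x. \<psi> x * f (x + y)) x + ennreal (D * far_maximal f (x + y))"
  unfolding wave_maximal_def[of f]
proof (rule SUP_least)
  fix t :: real assume t: "t \<in> {0<..<1}"
  let ?g = "\<lambda>x. \<psi> x * f (x + y)" and ?h = "\<lambda>x. f (x + y)"
  let ?r = "\<lambda>x. ?h x - ?g x"
  have fi: "integrable lborel f" "integrable lborel (fourier f)"
    by (intro rapid_integrable schwartz_rapid fourier_rapid f)+
  have sg: "schwartz ?g" by (rule schwartz_cutoff[OF \<psi>(1,3) f])
  have gi: "integrable lborel ?g" "integrable lborel (fourier ?g)"
    by (intro rapid_integrable schwartz_rapid fourier_rapid sg)+
  have hi: "integrable lborel ?h" by (rule integrable_lborel_translation[OF fi(1)])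
  have hi': "integrable lborel (fourier ?h)"
    unfolding fourier_translation[OF fi(1), abs_def] by (intro integrable_cis_mult fi) measurable
  have ri: "integrable lborel ?r" using hi gi(1) by (rule Bochner_Integration.integrable_diff)
  have ri': "integrable lborel (fourier ?r)"
    unfolding fourier_diff[OF hi hi' gi, abs_def] using hi' gi(2) by (rule Bochner_Integration.integrable_diff)
  have r0: "?r z = 0" if "norm (x - z) < 2" for z
  proof -
    have "norm z \<le> norm x + norm (x - z)" using norm_triangle_ineq4[of x "x - z"] by simp
    then have "norm z \<le> 3" using that x by simp
    then show ?thesis using \<psi>(2) by simp
  qed
  have rle: "cmod (?r z) \<le> D * cmod (f (z + y))" for z
  proof -
    have "?r z = (1 - \<psi> z) * f (z + y)" by (simp add: algebra_simps)
    then show ?thesis using D[of z] by (simp add: norm_mult mult_right_mono)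
  qed
  have shift: "(\<integral>z. far_kernel (x - z) * cmod (f (z + y)) \<partial>lborel) = far_maximal f (x + y)"
  proof -
    have [measurable]: "f \<in> borel_measurable borel" using fi by auto
    show ?thesis unfolding far_maximal_def
      using integral_lborel_translation[of "\<lambda>z. far_kernel (x + y - z) * cmod (f z)" y] by simp
  qed
  have "cmod (wave t ?r x) \<le> (\<integral>z. far_kernel (x - z) * cmod (?r z) \<partial>lborel)"
    by (rule wave_far[OF ri ri' r0]) (use t in auto)
  also have "\<dots> \<le> (\<integral>z. D * (far_kernel (x - z) * cmod (f (z + y))) \<partial>lborel)"
    using rle by (intro integral_mono integrable_far_maximal[OF ri] integrable_mult_right integrable_far_maximal[OF hi])
      (auto simp: mult.left_commute[of D] intro!: mult_left_mono far_kernel_nonneg)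
  also have "\<dots> = D * far_maximal f (x + y)" by (simp add: shift)
  finally have far: "cmod (wave t ?r x) \<le> D * far_maximal f (x + y)" .
  have "cmod (wave t f (x + y)) \<le> cmod (wave t ?g x) + cmod (wave t ?r x)"
    unfolding wave_translation[OF fi(1)] wave_diff[OF hi hi' gi]
    using norm_triangle_ineq[of "wave t ?g x" "wave t ?h x - wave t ?g x"] by simp
  also have "\<dots> \<le> cmod (wave t ?g x) + D * far_maximal f (x + y)" using far by simp
  finally have "ennreal (cmod (wave t f (x + y))) \<le> ennreal (cmod (wave t ?g x) + D * far_maximal f (x + y))"
    by (rule ennreal_leI)
  also have "\<dots> \<le> ennreal (cmod (wave t ?g x)) + ennreal (D * far_maximal f (x + y))"
    using order_trans[OF norm_ge_zero far] by (simp add: ennreal_plus)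
  also have "\<dots> \<le> wave_maximal ?g x + ennreal (D * far_maximal f (x + y))"
    unfolding wave_maximal_def using t by (intro add_right_mono SUP_upper)
  finally show "ennreal (cmod (wave t f (x + y))) \<le> wave_maximal ?g x + ennreal (D * far_maximal f (x + y))" .
qed

lemma maximal_estimate_mono:
  assumes "maximal_estimate q s B" "A \<subseteq> B" "q > 0"
  shows "maximal_estimate q s A"
proof -
  have "Lq_norm q A g \<le> Lq_norm q B g" for g
    unfolding Lq_norm_def using assms(2,3)
    by (intro ennpowr_mono nn_integral_mono) (auto simp: indicator_def)
  then show ?thesis using assms(1) unfolding maximal_estimate_def by (meson order_trans)
qed

lemma maximal_estimate_globalize:
  fixes q s :: real
  assumes q: "q \<ge> 2" and s: "s \<ge> 0" and loc: "maximal_estimate q s (ball 0 1 :: 'a::euclidean_space set)"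
  shows "maximal_estimate q s (UNIV :: 'a set)"
proof -
  let ?B = "ball 0 1 :: 'a set" and ?p = "(2 * pi) ^ DIM('a)"
  obtain C0 where C0: "\<And>f :: 'a \<Rightarrow> complex. schwartz f \<Longrightarrow> Lq_norm q ?B (wave_maximal f) \<le> ennreal C0 * sobolev_norm s f"
    using loc unfolding maximal_estimate_def by blast
  define C where "C = max C0 0"
  have C: "C \<ge> 0" "ennreal C0 = ennreal C" by (auto simp: C_def max_def ennreal_neg)
  have local: "(\<integral>\<^sup>+x\<in>?B. ennpowr (wave_maximal f x) q \<partial>lborel) \<le> ennreal ((C\<^sup>2 / ?p) powr (q / 2)) * ennreal (sobolev_sq s f powr (q / 2))"
    if f: "schwartz f" for f :: "'a \<Rightarrow> complex"
  proof -
    have "Lq_norm q ?B (wave_maximal f) \<le> ennreal (C * sqrt (sobolev_sq s f / ?p))"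
      using C0[OF f] C sobolev_sq_nonneg[of s f] unfolding sobolev_norm_eq[OF f] by (simp add: ennreal_mult)
    then have "(\<integral>\<^sup>+x\<in>?B. ennpowr (wave_maximal f x) q \<partial>lborel) \<le> ennreal ((C * sqrt (sobolev_sq s f / ?p)) powr q)"
      unfolding Lq_norm_def using q C sobolev_sq_nonneg[of s f] by (subst (asm) ennpowr_inverse_le_iff) auto
    also have "(C * sqrt (sobolev_sq s f / ?p)) powr q = (C\<^sup>2 / ?p) powr (q / 2) * sobolev_sq s f powr (q / 2)"
    proof -
      have "C * sqrt (sobolev_sq s f / ?p) = sqrt (C\<^sup>2 / ?p * sobolev_sq s f)"
        using C by (simp add: real_sqrt_mult real_sqrt_divide)
      also have "\<dots> powr q = (C\<^sup>2 / ?p * sobolev_sq s f) powr (q / 2)"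
        using C sobolev_sq_nonneg[of s f] by (simp add: powr_powr flip: powr_half_sqrt)
      also have "\<dots> = (C\<^sup>2 / ?p) powr (q / 2) * sobolev_sq s f powr (q / 2)"
        by (rule powr_mult)
      finally show ?thesis .
    qed
    finally show ?thesis by (simp add: ennreal_mult)
  qed
  obtain \<psi> :: "'a \<Rightarrow> complex" where \<psi>: "smooth \<psi>" "\<And>x. norm x \<le> 3 \<Longrightarrow> \<psi> x = 1" "\<And>x. norm x \<ge> 4 \<Longrightarrow> \<psi> x = 0"
    using smooth_bump by blast
  obtain B\<psi> where "\<And>x. cmod (\<psi> x) \<le> B\<psi>"
    using rapid_bounded[OF schwartz_rapid[OF smooth_compact_support_imp_schwartz[OF \<psi>(1,3)]]] by metis
  then have D: "cmod (1 - \<psi> x) \<le> 1 + B\<psi>" for x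
    using norm_triangle_ineq4[of 1 "\<psi> x"] by (metis add_left_mono norm_one order_trans)
  define D where "D = 1 + B\<psi>"
  have D0: "D \<ge> 0" using order_trans[OF norm_ge_zero D[of 0]] by (simp add: D_def)
  obtain c1 where c1: "c1 \<ge> 0"
    "\<And>f y. schwartz f \<Longrightarrow> sobolev_sq s (\<lambda>x. \<psi> x * f (x + y)) \<le> c1 * sobolev_sq s f"
    "\<And>f. schwartz f \<Longrightarrow> (\<integral>\<^sup>+y. ennreal (sobolev_sq s (\<lambda>x. \<psi> x * f (x + y))) \<partial>lborel) \<le> ennreal (c1 * sobolev_sq s f)"
    proof (rule cutoff_sobolev[OF \<psi>(1) _ s], goal_cases)
    case (1 x)
    then show ?case by (intro \<psi>(3))
  next
    case (2 c)
    show thesis using 2(2-4) by (rule 2(1))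
  qed
  obtain c2 where c2: "c2 \<ge> 0" "\<And>f :: 'a \<Rightarrow> complex. schwartz f \<Longrightarrow>
    (\<integral>\<^sup>+x. ennreal (far_maximal f x powr q) \<partial>lborel) \<le> ennreal ((c2 * sobolev_sq s f) powr (q / 2))"
    proof (rule far_maximal_Lq[OF q s, where 'a='a], goal_cases)
    case (1 c)
    show thesis using 1(2,3) by (rule 1(1))
  qed
  define b where "b = measure lborel ?B"
  have b: "emeasure lborel ?B = ennreal b" "b > 0"
    unfolding b_def using content_ball_pos[of 1 "0::'a"] emeasure_lborel_ball_finite[of "0::'a" 1]
    by (auto simp: emeasure_eq_ennreal_measure less_top[symmetric] measure_completion)
  define E where "E = 2 powr q * ((C\<^sup>2 / ?p) powr (q / 2) * c1 powr (q / 2) + b * (D powr q * c2 powr (q / 2)))"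
  have E0: "E \<ge> 0" unfolding E_def using b by auto
  have main: "ennreal b * (\<integral>\<^sup>+x. ennpowr (wave_maximal f x) q \<partial>lborel) \<le> ennreal (E * sobolev_sq s f powr (q / 2))"
    if f: "schwartz f" for f :: "'a \<Rightarrow> complex"
  proof -
    let ?N = "sobolev_sq s f"
    have fi: "integrable lborel f" "integrable lborel (fourier f)"
      by (intro rapid_integrable schwartz_rapid fourier_rapid f)+
    have [measurable]: "f \<in> borel_measurable borel" using fi by auto
    have [measurable]: "wave_maximal f \<in> borel_measurable borel" by (rule wave_maximal_measurable[OF fi(2)])
    have [measurable]: "far_maximal f \<in> borel_measurable borel" unfolding far_maximal_def[abs_def] by measurable
    define g where "g = (\<lambda>y x. \<psi> x * f (x + y))"
    have g: "schwartz (g y)" for y unfolding g_def by (rule schwartz_cutoff[OF \<psi>(1,3) f])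
    have [measurable]: "wave_maximal (g y) \<in> borel_measurable borel" for y
      by (intro wave_maximal_measurable rapid_integrable fourier_rapid g)
    have [measurable]: "\<psi> \<in> borel_measurable borel"
      by (intro rapid_measurable schwartz_rapid smooth_compact_support_imp_schwartz[OF \<psi>(1,3)])
    have [measurable]: "(\<lambda>y. sobolev_sq s (g y)) \<in> borel_measurable borel"
      unfolding sobolev_sq_def g_def fourier_def by measurable
    have [measurable]: "?B \<in> sets borel" by simp
    let ?H = "\<lambda>x. ennreal ((D * far_maximal f x) powr q)"
    have pw: "ennpowr (wave_maximal f (x + y)) q * indicator ?B x
       \<le> ennreal (2 powr q) * (ennpowr (wave_maximal (g y) x) q * indicator ?B x + ?H (x + y) * indicator ?B x)" for x y
    proof (cases "x \<in> ?B")
      case True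
      have "ennpowr (wave_maximal f (x + y)) q \<le> ennpowr (wave_maximal (g y) x + ennreal (D * far_maximal f (x + y))) q"
        unfolding g_def using q by (intro ennpowr_mono wave_maximal_local[OF f \<psi> _ True]) (auto simp: D_def D)
      also have "\<dots> \<le> ennreal (2 powr q) * (ennpowr (wave_maximal (g y) x) q + ?H (x + y))"
        using D0 far_maximal_nonneg[of f] q by (intro ennpowr_add_le) auto
      finally show ?thesis using True by simp
    qed simp
    have "ennreal b * (\<integral>\<^sup>+x. ennpowr (wave_maximal f x) q \<partial>lborel)
       = (\<integral>\<^sup>+x. (\<integral>\<^sup>+y. ennpowr (wave_maximal f y) q \<partial>lborel) * indicator ?B x \<partial>lborel)"
      by (subst nn_integral_cmult_indicator) (auto simp: b mult.commute)
    also have "\<dots> = (\<integral>\<^sup>+x. \<integral>\<^sup>+y. ennpowr (wave_maximal f (x + y)) q * indicator ?B x \<partial>lborel \<partial>lborel)"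
    proof (intro nn_integral_cong)
      fix x
      have "(\<integral>\<^sup>+y. ennpowr (wave_maximal f (x + y)) q \<partial>lborel) = (\<integral>\<^sup>+y. ennpowr (wave_maximal f y) q \<partial>lborel)"
        using nn_integral_lborel_translation[of "\<lambda>y. ennpowr (wave_maximal f y) q" x] by (simp add: add.commute)
      then show "(\<integral>\<^sup>+y. ennpowr (wave_maximal f y) q \<partial>lborel) * indicator ?B x
        = (\<integral>\<^sup>+y. ennpowr (wave_maximal f (x + y)) q * indicator ?B x \<partial>lborel)"
        by (simp add: nn_integral_multc)
    qed
    also have "\<dots> = (\<integral>\<^sup>+y. \<integral>\<^sup>+x. ennpowr (wave_maximal f (x + y)) q * indicator ?B x \<partial>lborel \<partial>lborel)"
      by (rule lborel_pair.Fubini'[symmetric]) measurable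
    also have "\<dots> \<le> (\<integral>\<^sup>+y. \<integral>\<^sup>+x. ennreal (2 powr q) * (ennpowr (wave_maximal (g y) x) q * indicator ?B x + ?H (x + y) * indicator ?B x) \<partial>lborel \<partial>lborel)"
      by (intro nn_integral_mono pw)
    also have "\<dots> = (\<integral>\<^sup>+y. ennreal (2 powr q) * ((\<integral>\<^sup>+x\<in>?B. ennpowr (wave_maximal (g y) x) q \<partial>lborel) + (\<integral>\<^sup>+x. ?H (x + y) * indicator ?B x \<partial>lborel)) \<partial>lborel)"
      by (intro nn_integral_cong) (simp add: nn_integral_cmult nn_integral_add)
    also have "\<dots> \<le> (\<integral>\<^sup>+y. ennreal (2 powr q) * (ennreal ((C\<^sup>2 / ?p) powr (q / 2)) * ennreal (sobolev_sq s (g y) powr (q / 2)) + (\<integral>\<^sup>+x. ?H (x + y) * indicator ?B x \<partial>lborel)) \<partial>lborel)"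
      by (intro nn_integral_mono mult_left_mono add_right_mono local g) simp
    also have "\<dots> = ennreal (2 powr q) * (ennreal ((C\<^sup>2 / ?p) powr (q / 2)) * (\<integral>\<^sup>+y. ennreal (sobolev_sq s (g y) powr (q / 2)) \<partial>lborel)
        + (\<integral>\<^sup>+y. \<integral>\<^sup>+x. ?H (x + y) * indicator ?B x \<partial>lborel \<partial>lborel))"
      by (simp add: nn_integral_cmult nn_integral_add)
    also have "(\<integral>\<^sup>+y. \<integral>\<^sup>+x. ?H (x + y) * indicator ?B x \<partial>lborel \<partial>lborel) = (\<integral>\<^sup>+x. \<integral>\<^sup>+y. ?H (x + y) * indicator ?B x \<partial>lborel \<partial>lborel)"
      by (rule lborel_pair.Fubini') measurable
    also have "\<dots> = (\<integral>\<^sup>+x. (\<integral>\<^sup>+y. ?H y \<partial>lborel) * indicator ?B x \<partial>lborel)"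
    proof (intro nn_integral_cong)
      fix x
      have "(\<integral>\<^sup>+y. ?H (x + y) \<partial>lborel) = (\<integral>\<^sup>+y. ?H y \<partial>lborel)"
        using nn_integral_lborel_translation[of ?H x] by (simp add: add.commute)
      then show "(\<integral>\<^sup>+y. ?H (x + y) * indicator ?B x \<partial>lborel) = (\<integral>\<^sup>+y. ?H y \<partial>lborel) * indicator ?B x"
        by (simp add: nn_integral_multc)
    qed
    also have "\<dots> = ennreal b * (\<integral>\<^sup>+y. ?H y \<partial>lborel)"
      by (subst nn_integral_cmult_indicator) (auto simp: b mult.commute)
    also have "(\<integral>\<^sup>+y. ?H y \<partial>lborel) = ennreal (D powr q) * (\<integral>\<^sup>+x. ennreal (far_maximal f x powr q) \<partial>lborel)"
      using D0 far_maximal_nonneg[of f] by (simp add: powr_mult ennreal_mult nn_integral_cmult)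
    also have "ennreal (2 powr q) * (ennreal ((C\<^sup>2 / ?p) powr (q / 2)) * (\<integral>\<^sup>+y. ennreal (sobolev_sq s (g y) powr (q / 2)) \<partial>lborel)
        + ennreal b * (ennreal (D powr q) * (\<integral>\<^sup>+x. ennreal (far_maximal f x powr q) \<partial>lborel)))
      \<le> ennreal (2 powr q) * (ennreal ((C\<^sup>2 / ?p) powr (q / 2)) * ennreal ((c1 * ?N) powr (q / 2))
        + ennreal b * (ennreal (D powr q) * ennreal ((c2 * ?N) powr (q / 2))))"
    proof (intro mult_left_mono add_mono c2(2) f)
      show "(\<integral>\<^sup>+y. ennreal (sobolev_sq s (g y) powr (q / 2)) \<partial>lborel) \<le> ennreal ((c1 * ?N) powr (q / 2))"
      proof (rule nn_integral_powr_le)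
        show "(\<lambda>y. sobolev_sq s (g y)) \<in> borel_measurable lborel" by measurable
      qed (use c1 f q sobolev_sq_nonneg[of s f] in \<open>auto simp: g_def sobolev_sq_nonneg\<close>)
    qed auto
    also have "\<dots> = ennreal (E * ?N powr (q / 2))"
      unfolding E_def using b by (simp add: powr_mult algebra_simps flip: ennreal_mult ennreal_plus)
    finally show ?thesis .
  qed
  show ?thesis
    unfolding maximal_estimate_def
  proof (intro exI allI impI)
    fix f :: "'a \<Rightarrow> complex" assume f: "schwartz f"
    let ?N = "sobolev_sq s f" and ?I = "\<integral>\<^sup>+x\<in>UNIV. ennpowr (wave_maximal f x) q \<partial>lborel"
    have N0: "?N \<ge> 0" by (rule sobolev_sq_nonneg)
    have "?I = ennreal (1 / b) * (ennreal b * ?I)"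
      using b by (simp add: mult.assoc[symmetric] flip: ennreal_mult)
    also have "\<dots> \<le> ennreal (1 / b) * ennreal (E * ?N powr (q / 2))"
      using main[OF f] by (intro mult_left_mono) auto
    also have "\<dots> = ennreal (E / b * ?N powr (q / 2))"
      using b E0 N0 by (simp flip: ennreal_mult)
    also have "E / b * ?N powr (q / 2) = (((E / b) powr (1 / q) * sqrt ?p) * sqrt (?N / ?p)) powr q"
    proof -
      have "((E / b) powr (1 / q) * sqrt ?p) * sqrt (?N / ?p) = (E / b) powr (1 / q) * sqrt ?N"
        by (simp add: real_sqrt_divide)
      also have "\<dots> powr q = ((E / b) powr (1 / q)) powr q * sqrt ?N powr q" by (rule powr_mult)
      also have "\<dots> = E / b * ?N powr (q / 2)"
        using q E0 b N0 by (simp add: powr_powr flip: powr_half_sqrt)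
      finally show ?thesis by simp
    qed
    finally have "Lq_norm q UNIV (wave_maximal f) \<le> ennreal (((E / b) powr (1 / q) * sqrt ?p) * sqrt (?N / ?p))"
      unfolding Lq_norm_def using q N0 by (subst ennpowr_inverse_le_iff) auto
    also have "\<dots> = ennreal ((E / b) powr (1 / q) * sqrt ?p) * sobolev_norm s f"
      unfolding sobolev_norm_eq[OF f] using N0 by (subst ennreal_mult) auto
    finally show "Lq_norm q UNIV (wave_maximal f) \<le> ennreal ((E / b) powr (1 / q) * sqrt ?p) * sobolev_norm s f" .
  qed
qed

theorem proposition1p2:
  fixes q s :: real
  assumes "CARD('n::finite) \<ge> 2" and "q \<ge> 2" and "s \<ge> 0"
  shows "maximal_estimate q s (UNIV :: (real ^ 'n) set) \<longleftrightarrow>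
         maximal_estimate q s (ball 0 1 :: (real ^ 'n) set)"
  using assms maximal_estimate_mono[of q s "UNIV :: (real ^ 'n) set" "ball 0 1"]
    maximal_estimate_globalize[of q s, where 'a="real ^ 'n"]
  by auto

end
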